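(* The partition ring $\mathbb A$ (defined in the context: $\mathbb A(\Lambda)\subseteq A(\Sigma_\Lambda)$ is the subring of the Burnside ring of $\Sigma_\Lambda$ additively generated by the classes $[\Sigma_\Lambda/\Sigma_\Gamma]$, $\Gamma\le\Lambda$) is the initial partition ring: for every partition ring $R$ there is exactly one map of partition rings $\mathbb A\to R$.
   Context: Partitions. A partition $\Lambda=(X,\sim_\Lambda)$ is a finite set $X$ with an equivalence relation; its classes are called blocks. A morphism $f\colon\Lambda\to\Omega=(Y,\sim_\Omega)$ is a bijection $f\colon X\to Y$ with $x\sim_\Lambda x'\Rightarrow f(x)\sim_\Omega f(x')$. There is a (unique) 2-isomorphism $f\Rightarrow g$ between morphisms $f,g\colon\Lambda\to\Omega$ exactly when $f(x)\sim_\Omega g(x)$ for all $x$. This defines a $(2,1)$-category $\mathcal P$; functors from $\mathcal P$ to an ordinary category identify 2-isomorphic morphisms. Write $\Lambda\le\Omega$ if $X=Y$ and the identity is a morphism $\Lambda\to\Omega$. $\Lambda\cap\Gamma$ is the coarsest common refinement; $\Lambda\sqcup\Omega$ the disjoint union; $\underline0$ the empty partition. $\Sigma_\Lambda$ is the group of bijections of $X$ preserving every block; a morphism $f\colon\Lambda\to\Omega$ induces an injection $\Sigma_\Lambda\to\Sigma_\Omega$, $\sigma\mapsto f\sigma f^{-1}$, and $\Sigma_{\Lambda\sqcup\Omega}=\Sigma_\Lambda\times\Sigma_\Omega$. For a bijection $\sigma$ of $X$, $\sigma\Lambda$ is the transported partition. Partition rings. A partition functor $M$ consists of abelian groups $M(\Lambda)$,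 a contravariant functor $M^*$ (restrictions) and a covariant functor $M_*$ (transfers) from $\mathcal P$ to abelian groups with common values $M(\Lambda)$, with $M_*(f)=M^*(f^{-1})$ for isomorphisms $f$, and for $\Gamma,\Lambda\le\Omega$ $$M^*(\Gamma\le\Omega)M_*(\Lambda\le\Omega)=\sum_{[\sigma]\in\Sigma_\Gamma\backslash\Sigma_\Omega/\Sigma_\Lambda}M_*(\Gamma\cap\sigma\Lambda\le\Gamma)\,M_*(\sigma)\,M^*(\sigma^{-1}\Gamma\cap\Lambda\le\Lambda).$$ It is lax symmetric monoidal if equipped with a unit $\mathbb Z\to M(\underline0)$ and external products $M(\Lambda)\otimes M(\Omega)\to M(\Lambda\sqcup\Omega)$, natural in pairs of restrictions and pairs of transfers, associative, unital, symmetric. A partition ring $R$ is a lax symmetric monoidal partition functor with each $R(\Lambda)$ a commutative ring, restrictions and external products ring maps, and Frobenius reciprocity $R_*(f)(R^*(f)(a)\,b)=a\,R_*(f)(b)$. A map of partition rings preserves all of this structure. The partition ring $\mathbb A$. $A(G)$ denotes the Burnside ring of a finite group $G$. $\mathbb A(\Lambda)\subseteq A(\Sigma_\Lambda)$ is the subgroup with basis the isomorphism classes of $\Sigma_\Lambda$-sets $\Sigma_\Lambda/\Sigma_\Gamma$, $\Gamma\le\Lambda$; it is a subring. Restrictions and transfers are given by restriction and induction of finite sets along the injections $\Sigma_\Lambda\to\Sigma_\Omega$ associated to morphisms of partitions; the external product sends $[V]\otimes[W]$ to the $\Sigma_\Lambda\times\Sigma_\Omega$-set $[V\times W]$, and the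 unit is $1\in\mathbb A(\underline0)=\mathbb Z$. *)

theory Defs
  imports "HOL-Algebra.Algebra"
begin

section \<open>Partitions\<close>

typedef 'a ptn = "{(E :: 'a set, r). finite E \<and> equiv E r}"
  by (rule exI[of _ "({}, {})"]) (simp add: equiv_def refl_on_def sym_def trans_def)

setup_lifting type_definition_ptn

lift_definition pts :: "'a ptn \<Rightarrow> 'a set" is fst .

lift_definition rel :: "'a ptn \<Rightarrow> ('a \<times> 'a) set" is snd .

definition morphism :: "'a ptn \<Rightarrow> 'b ptn \<Rightarrow> ('a \<Rightarrow> 'b) \<Rightarrow> bool" where
  "morphism \<Lambda> \<Omega> f \<longleftrightarrow> bij_betw f (pts \<Lambda>) (pts \<Omega>) \<and>
     (\<forall>x x'. (x, x') \<in> rel \<Lambda> \<longrightarrow> (f x, f x') \<in> rel \<Omega>)"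

definition two_iso :: "'a ptn \<Rightarrow> 'b ptn \<Rightarrow> ('a \<Rightarrow> 'b) \<Rightarrow> ('a \<Rightarrow> 'b) \<Rightarrow> bool" where
  "two_iso \<Lambda> \<Omega> f g \<longleftrightarrow> (\<forall>x \<in> pts \<Lambda>. (f x, g x) \<in> rel \<Omega>)"

definition isomorphism :: "'a ptn \<Rightarrow> 'b ptn \<Rightarrow> ('a \<Rightarrow> 'b) \<Rightarrow> bool" where
  "isomorphism \<Lambda> \<Omega> f \<longleftrightarrow> morphism \<Lambda> \<Omega> f \<and> morphism \<Omega> \<Lambda> (inv_into (pts \<Lambda>) f)"

definition refines :: "'a ptn \<Rightarrow> 'a ptn \<Rightarrow> bool" where
  "refines \<Lambda> \<Omega> \<longleftrightarrow> pts \<Lambda> = pts \<Omega> \<and> morphism \<Lambda> \<Omega> id"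

text \<open>Only used for two partitions of the same set.\<close>

lemma equiv_Int_Int: "equiv E r \<Longrightarrow> equiv F s \<Longrightarrow> equiv (E \<inter> F) (r \<inter> s)"
  by (rule equivI) (auto simp: equiv_def refl_on_def intro: sym_Int trans_Int)

lift_definition ptn_meet :: "'a ptn \<Rightarrow> 'a ptn \<Rightarrow> 'a ptn" is
  "\<lambda>(E, r) (F, s). (E \<inter> F, r \<inter> s)"
  by (clarsimp simp: equiv_Int_Int)

text \<open>
  Only used for \<open>\<sigma>\<close> injective on the underlying set. The relation is
  \<open>y \<sim> y'\<close> iff \<open>\<sigma>\<^sup>-\<^sup>1 y \<sim> \<sigma>\<^sup>-\<^sup>1 y'\<close>; in this form it is an equivalence
  relation on \<open>\<sigma> ` E\<close> for every function \<open>\<sigma>\<close>.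
\<close>

lemma equiv_transport: "equiv E r \<Longrightarrow> equiv (\<sigma> ` E)
    {(y, y'). y \<in> \<sigma> ` E \<and> y' \<in> \<sigma> ` E \<and> (inv_into E \<sigma> y, inv_into E \<sigma> y') \<in> r}"
  by (rule equivI)
    (auto simp: equiv_def refl_on_def inv_into_into intro!: symI transI dest: symD transD)

lift_definition transport :: "('a \<Rightarrow> 'b) \<Rightarrow> 'a ptn \<Rightarrow> 'b ptn" is
  "\<lambda>\<sigma> (E, r). (\<sigma> ` E,
     {(y, y'). y \<in> \<sigma> ` E \<and> y' \<in> \<sigma> ` E \<and> (inv_into E \<sigma> y, inv_into E \<sigma> y') \<in> r})"
  by (simp add: split_beta equiv_transport)

text \<open>
  A universe of points closed under formation of disjoint unions. It contains the
  points of an arbitrary type \<open>'u\<close>, and since it is infinite, every finite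
  set is in bijection with a finite set of points.
\<close>

datatype 'u point = Atom 'u | InL (unL: "'u point") | InR (unR: "'u point")

lift_definition empty_ptn :: "'a ptn" is "({}, {})"
  by (simp add: equiv_def refl_on_def sym_def trans_def)

lemma equiv_sum: "equiv E r \<Longrightarrow> equiv F s \<Longrightarrow>
    equiv (InL ` E \<union> InR ` F) (map_prod InL InL ` r \<union> map_prod InR InR ` s)"
  by (rule equivI)
    (auto simp: equiv_def refl_on_def intro!: symI transI dest: symD transD)

lift_definition sum_ptn :: "'u point ptn \<Rightarrow> 'u point ptn \<Rightarrow> 'u point ptn" is
  "\<lambda>(E, r) (F, s). (InL ` E \<union> InR ` F, map_prod InL InL ` r \<union> map_prod InR InR ` s)"
  by (clarsimp simp: equiv_sum)

fun sum_map :: "('u point \<Rightarrow> 'u point) \<Rightarrow> ('u point \<Rightarrow> 'u point) \<Rightarrow> 'u point \<Rightarrow> 'u point" where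
  "sum_map f g (InL x) = InL (f x)"
| "sum_map f g (InR y) = InR (g y)"
| "sum_map f g (Atom a) = Atom a"

fun assoc_map :: "'u point \<Rightarrow> 'u point" where
  "assoc_map (InL (InL x)) = InL x"
| "assoc_map (InL (InR y)) = InR (InL y)"
| "assoc_map (InR z) = InR (InR z)"
| "assoc_map x = x"

fun swap_map :: "'u point \<Rightarrow> 'u point" where
  "swap_map (InL x) = InR x"
| "swap_map (InR y) = InL y"
| "swap_map (Atom a) = Atom a"

text \<open>
  The group \<open>\<Sigma>\<^sub>\<Lambda>\<close>. A bijection of the underlying set is represented by the
  permutation of the whole type that extends it by the identity.
\<close>

definition Sigma_grp :: "'a ptn \<Rightarrow> ('a \<Rightarrow> 'a) monoid" where
  "Sigma_grp \<Lambda> = \<lparr>carrier = {\<sigma>. \<sigma> permutes pts \<Lambda> \<and> (\<forall>B \<in> pts \<Lambda> // rel \<Lambda>. \<sigma> ` B = B)},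
     monoid.mult = (\<circ>), one = id\<rparr>"

text \<open>The injection \<open>\<Sigma>\<^sub>\<Lambda> \<rightarrow> \<Sigma>\<^sub>\<Omega>\<close>, \<open>\<sigma> \<mapsto> f \<sigma> f\<^sup>-\<^sup>1\<close>, associated to \<open>f: \<Lambda> \<rightarrow> \<Omega>\<close>.\<close>

definition Sigma_map :: "'a ptn \<Rightarrow> 'b ptn \<Rightarrow> ('a \<Rightarrow> 'b) \<Rightarrow> ('a \<Rightarrow> 'a) \<Rightarrow> ('b \<Rightarrow> 'b)" where
  "Sigma_map \<Lambda> \<Omega> f \<sigma> =
     (\<lambda>y. if y \<in> pts \<Omega> then f (\<sigma> (inv_into (pts \<Lambda>) f y)) else y)"

text \<open>
  The projections of \<open>\<Sigma>\<^bsub>\<Lambda> \<squnion> \<Omega>\<^esub> = \<Sigma>\<^sub>\<Lambda> \<times> \<Sigma>\<^sub>\<Omega>\<close>; elements of the left-hand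
  side preserve both summands.
\<close>

definition left_part :: "('u point \<Rightarrow> 'u point) \<Rightarrow> 'u point \<Rightarrow> 'u point" where
  "left_part \<rho> x = unL (\<rho> (InL x))"

definition right_part :: "('u point \<Rightarrow> 'u point) \<Rightarrow> 'u point \<Rightarrow> 'u point" where
  "right_part \<rho> y = unR (\<rho> (InR y))"

definition double_cosets :: "('g, 'z) monoid_scheme \<Rightarrow> 'g set \<Rightarrow> 'g set \<Rightarrow> 'g set set" where
  "double_cosets G H K = (\<lambda>g. H <#>\<^bsub>G\<^esub> (g <#\<^bsub>G\<^esub> K)) ` carrier G"


section \<open>Partition functors and partition rings\<close>

text \<open>
  For \<open>f: \<Lambda> \<rightarrow> \<Omega>\<close>, the restriction \<open>M\<^sup>*(f): M(\<Omega>) \<rightarrow> M(\<Lambda>)\<close> is \<open>pf_res M \<Lambda> \<Omega> f\<close> and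
  the transfer \<open>M\<^sub>*(f): M(\<Lambda>) \<rightarrow> M(\<Omega>)\<close> is \<open>pf_tr M \<Lambda> \<Omega> f\<close>. The multiplicative part
  of \<open>pf_val M \<Lambda>\<close> is irrelevant until partition rings are introduced. The groups
  \<open>M(\<Lambda>)\<close> have their carriers in one type \<open>'m\<close> and may be disjoint or overlap.
\<close>

record ('u, 'm) pfunctor =
  pf_val :: "'u point ptn \<Rightarrow> 'm ring"
  pf_res :: "'u point ptn \<Rightarrow> 'u point ptn \<Rightarrow> ('u point \<Rightarrow> 'u point) \<Rightarrow> 'm \<Rightarrow> 'm"
  pf_tr :: "'u point ptn \<Rightarrow> 'u point ptn \<Rightarrow> ('u point \<Rightarrow> 'u point) \<Rightarrow> 'm \<Rightarrow> 'm"

text \<open>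
  Two functions that agree on the underlying set of \<open>\<Lambda>\<close> represent the same morphism;
  they are in particular related by \<open>two_iso\<close>.
\<close>

locale partition_functor =
  fixes M :: "('u, 'm, 'z) pfunctor_scheme"
  assumes val_group: "abelian_group (pf_val M \<Lambda>)"
    and res_hom: "morphism \<Lambda> \<Omega> f \<Longrightarrow>
      pf_res M \<Lambda> \<Omega> f \<in> hom (add_monoid (pf_val M \<Omega>)) (add_monoid (pf_val M \<Lambda>))"
    and tr_hom: "morphism \<Lambda> \<Omega> f \<Longrightarrow>
      pf_tr M \<Lambda> \<Omega> f \<in> hom (add_monoid (pf_val M \<Lambda>)) (add_monoid (pf_val M \<Omega>))"
    and res_id: "a \<in> carrier (pf_val M \<Lambda>) \<Longrightarrow> pf_res M \<Lambda> \<Lambda> id a = a"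
    and tr_id: "a \<in> carrier (pf_val M \<Lambda>) \<Longrightarrow> pf_tr M \<Lambda> \<Lambda> id a = a"
    and res_comp: "morphism \<Gamma> \<Lambda> f \<Longrightarrow> morphism \<Lambda> \<Omega> g \<Longrightarrow> a \<in> carrier (pf_val M \<Omega>) \<Longrightarrow>
      pf_res M \<Gamma> \<Omega> (g \<circ> f) a = pf_res M \<Gamma> \<Lambda> f (pf_res M \<Lambda> \<Omega> g a)"
    and tr_comp: "morphism \<Gamma> \<Lambda> f \<Longrightarrow> morphism \<Lambda> \<Omega> g \<Longrightarrow> a \<in> carrier (pf_val M \<Gamma>) \<Longrightarrow>
      pf_tr M \<Gamma> \<Omega> (g \<circ> f) a = pf_tr M \<Lambda> \<Omega> g (pf_tr M \<Gamma> \<Lambda> f a)"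
    and res_two_iso: "morphism \<Lambda> \<Omega> f \<Longrightarrow> morphism \<Lambda> \<Omega> g \<Longrightarrow> two_iso \<Lambda> \<Omega> f g \<Longrightarrow>
      a \<in> carrier (pf_val M \<Omega>) \<Longrightarrow> pf_res M \<Lambda> \<Omega> f a = pf_res M \<Lambda> \<Omega> g a"
    and tr_two_iso: "morphism \<Lambda> \<Omega> f \<Longrightarrow> morphism \<Lambda> \<Omega> g \<Longrightarrow> two_iso \<Lambda> \<Omega> f g \<Longrightarrow>
      a \<in> carrier (pf_val M \<Lambda>) \<Longrightarrow> pf_tr M \<Lambda> \<Omega> f a = pf_tr M \<Lambda> \<Omega> g a"
    and tr_iso: "isomorphism \<Lambda> \<Omega> f \<Longrightarrow> a \<in> carrier (pf_val M \<Lambda>) \<Longrightarrow>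
      pf_tr M \<Lambda> \<Omega> f a = pf_res M \<Omega> \<Lambda> (inv_into (pts \<Lambda>) f) a"
    \<comment> \<open>the double coset formula, for every choice \<open>\<sigma>\<close> of representatives\<close>
    and double_coset: "refines \<Gamma> \<Omega> \<Longrightarrow> refines \<Lambda> \<Omega> \<Longrightarrow> a \<in> carrier (pf_val M \<Lambda>) \<Longrightarrow>
      (\<forall>D \<in> double_cosets (Sigma_grp \<Omega>) (carrier (Sigma_grp \<Gamma>)) (carrier (Sigma_grp \<Lambda>)).
         \<sigma> D \<in> D) \<Longrightarrow>
      pf_res M \<Gamma> \<Omega> id (pf_tr M \<Lambda> \<Omega> id a) =
      (\<Oplus>\<^bsub>pf_val M \<Gamma>\<^esub> D \<in> double_cosets (Sigma_grp \<Omega>)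
           (carrier (Sigma_grp \<Gamma>)) (carrier (Sigma_grp \<Lambda>)).
         pf_tr M (ptn_meet \<Gamma> (transport (\<sigma> D) \<Lambda>)) \<Gamma> id
          (pf_tr M (ptn_meet (transport (inv_into UNIV (\<sigma> D)) \<Gamma>) \<Lambda>) (ptn_meet \<Gamma> (transport (\<sigma> D) \<Lambda>)) (\<sigma> D)
            (pf_res M (ptn_meet (transport (inv_into UNIV (\<sigma> D)) \<Gamma>) \<Lambda>) \<Lambda> id a)))"

text \<open>The external products are given by the corresponding biadditive maps.\<close>

record ('u, 'm) lax_pfunctor = "('u, 'm) pfunctor" +
  pf_unit :: "int \<Rightarrow> 'm"
  pf_ext :: "'u point ptn \<Rightarrow> 'u point ptn \<Rightarrow> 'm \<Rightarrow> 'm \<Rightarrow> 'm"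

locale lax_symmetric_monoidal_partition_functor = partition_functor M
  for M :: "('u, 'm, 'z) lax_pfunctor_scheme" +
  assumes unit_hom: "pf_unit M \<in> hom integer_group (add_monoid (pf_val M empty_ptn))"
    and ext_closed: "a \<in> carrier (pf_val M \<Lambda>) \<Longrightarrow> b \<in> carrier (pf_val M \<Omega>) \<Longrightarrow>
      pf_ext M \<Lambda> \<Omega> a b \<in> carrier (pf_val M (sum_ptn \<Lambda> \<Omega>))"
    and ext_add_left: "a \<in> carrier (pf_val M \<Lambda>) \<Longrightarrow> a' \<in> carrier (pf_val M \<Lambda>) \<Longrightarrow>
      b \<in> carrier (pf_val M \<Omega>) \<Longrightarrow>
      pf_ext M \<Lambda> \<Omega> (a \<oplus>\<^bsub>pf_val M \<Lambda>\<^esub> a') b =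
      pf_ext M \<Lambda> \<Omega> a b \<oplus>\<^bsub>pf_val M (sum_ptn \<Lambda> \<Omega>)\<^esub> pf_ext M \<Lambda> \<Omega> a' b"
    and ext_add_right: "a \<in> carrier (pf_val M \<Lambda>) \<Longrightarrow> b \<in> carrier (pf_val M \<Omega>) \<Longrightarrow>
      b' \<in> carrier (pf_val M \<Omega>) \<Longrightarrow>
      pf_ext M \<Lambda> \<Omega> a (b \<oplus>\<^bsub>pf_val M \<Omega>\<^esub> b') =
      pf_ext M \<Lambda> \<Omega> a b \<oplus>\<^bsub>pf_val M (sum_ptn \<Lambda> \<Omega>)\<^esub> pf_ext M \<Lambda> \<Omega> a b'"
    and ext_res: "morphism \<Lambda> \<Lambda>' f \<Longrightarrow> morphism \<Omega> \<Omega>' g \<Longrightarrow>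
      a \<in> carrier (pf_val M \<Lambda>') \<Longrightarrow> b \<in> carrier (pf_val M \<Omega>') \<Longrightarrow>
      pf_res M (sum_ptn \<Lambda> \<Omega>) (sum_ptn \<Lambda>' \<Omega>') (sum_map f g) (pf_ext M \<Lambda>' \<Omega>' a b) =
      pf_ext M \<Lambda> \<Omega> (pf_res M \<Lambda> \<Lambda>' f a) (pf_res M \<Omega> \<Omega>' g b)"
    and ext_tr: "morphism \<Lambda> \<Lambda>' f \<Longrightarrow> morphism \<Omega> \<Omega>' g \<Longrightarrow>
      a \<in> carrier (pf_val M \<Lambda>) \<Longrightarrow> b \<in> carrier (pf_val M \<Omega>) \<Longrightarrow>
      pf_tr M (sum_ptn \<Lambda> \<Omega>) (sum_ptn \<Lambda>' \<Omega>') (sum_map f g) (pf_ext M \<Lambda> \<Omega> a b) =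
      pf_ext M \<Lambda>' \<Omega>' (pf_tr M \<Lambda> \<Lambda>' f a) (pf_tr M \<Omega> \<Omega>' g b)"
    and ext_assoc: "a \<in> carrier (pf_val M \<Lambda>) \<Longrightarrow> b \<in> carrier (pf_val M \<Omega>) \<Longrightarrow>
      c \<in> carrier (pf_val M \<Gamma>) \<Longrightarrow>
      pf_tr M (sum_ptn (sum_ptn \<Lambda> \<Omega>) \<Gamma>) (sum_ptn \<Lambda> (sum_ptn \<Omega> \<Gamma>)) assoc_map
        (pf_ext M (sum_ptn \<Lambda> \<Omega>) \<Gamma> (pf_ext M \<Lambda> \<Omega> a b) c) =
      pf_ext M \<Lambda> (sum_ptn \<Omega> \<Gamma>) a (pf_ext M \<Omega> \<Gamma> b c)"
    and ext_unit_left: "a \<in> carrier (pf_val M \<Lambda>) \<Longrightarrow>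
      pf_tr M (sum_ptn empty_ptn \<Lambda>) \<Lambda> unR (pf_ext M empty_ptn \<Lambda> (pf_unit M n) a) =
      [n] \<cdot>\<^bsub>pf_val M \<Lambda>\<^esub> a"
    and ext_unit_right: "a \<in> carrier (pf_val M \<Lambda>) \<Longrightarrow>
      pf_tr M (sum_ptn \<Lambda> empty_ptn) \<Lambda> unL (pf_ext M \<Lambda> empty_ptn a (pf_unit M n)) =
      [n] \<cdot>\<^bsub>pf_val M \<Lambda>\<^esub> a"
    and ext_symmetric: "a \<in> carrier (pf_val M \<Lambda>) \<Longrightarrow> b \<in> carrier (pf_val M \<Omega>) \<Longrightarrow>
      pf_tr M (sum_ptn \<Lambda> \<Omega>) (sum_ptn \<Omega> \<Lambda>) swap_map (pf_ext M \<Lambda> \<Omega> a b) =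
      pf_ext M \<Omega> \<Lambda> b a"

locale partition_ring = lax_symmetric_monoidal_partition_functor R
  for R :: "('u, 'm, 'z) lax_pfunctor_scheme" +
  assumes val_ring: "cring (pf_val R \<Lambda>)"
    and res_ring_hom: "morphism \<Lambda> \<Omega> f \<Longrightarrow>
      pf_res R \<Lambda> \<Omega> f \<in> ring_hom (pf_val R \<Omega>) (pf_val R \<Lambda>)"
    and ext_mult: "a \<in> carrier (pf_val R \<Lambda>) \<Longrightarrow> a' \<in> carrier (pf_val R \<Lambda>) \<Longrightarrow>
      b \<in> carrier (pf_val R \<Omega>) \<Longrightarrow> b' \<in> carrier (pf_val R \<Omega>) \<Longrightarrow>
      pf_ext R \<Lambda> \<Omega> (a \<otimes>\<^bsub>pf_val R \<Lambda>\<^esub> a') (b \<otimes>\<^bsub>pf_val R \<Omega>\<^esub> b') =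
      pf_ext R \<Lambda> \<Omega> a b \<otimes>\<^bsub>pf_val R (sum_ptn \<Lambda> \<Omega>)\<^esub> pf_ext R \<Lambda> \<Omega> a' b'"
    and ext_one: "pf_ext R \<Lambda> \<Omega> \<one>\<^bsub>pf_val R \<Lambda>\<^esub> \<one>\<^bsub>pf_val R \<Omega>\<^esub> = \<one>\<^bsub>pf_val R (sum_ptn \<Lambda> \<Omega>)\<^esub>"
    and frobenius: "morphism \<Lambda> \<Omega> f \<Longrightarrow> a \<in> carrier (pf_val R \<Omega>) \<Longrightarrow>
      b \<in> carrier (pf_val R \<Lambda>) \<Longrightarrow>
      pf_tr R \<Lambda> \<Omega> f (pf_res R \<Lambda> \<Omega> f a \<otimes>\<^bsub>pf_val R \<Lambda>\<^esub> b) =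
      a \<otimes>\<^bsub>pf_val R \<Omega>\<^esub> pf_tr R \<Lambda> \<Omega> f b"

text \<open>
  A map between partition rings is a family of functions on carriers; they are taken
  extensional so that equal maps are equal as HOL functions.
\<close>

definition partition_ring_map ::
  "('u, 'm, 'y) lax_pfunctor_scheme \<Rightarrow> ('u, 'n, 'z) lax_pfunctor_scheme \<Rightarrow>
   ('u point ptn \<Rightarrow> 'm \<Rightarrow> 'n) \<Rightarrow> bool" where
  "partition_ring_map R S \<phi> \<longleftrightarrow>
     (\<forall>\<Lambda>. \<phi> \<Lambda> \<in> extensional (carrier (pf_val R \<Lambda>))) \<and>
     (\<forall>\<Lambda>. \<phi> \<Lambda> \<in> ring_hom (pf_val R \<Lambda>) (pf_val S \<Lambda>)) \<and>
     (\<forall>\<Lambda> \<Omega> f. morphism \<Lambda> \<Omega> f \<longrightarrow> (\<forall>a \<in> carrier (pf_val R \<Omega>).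
        \<phi> \<Lambda> (pf_res R \<Lambda> \<Omega> f a) = pf_res S \<Lambda> \<Omega> f (\<phi> \<Omega> a))) \<and>
     (\<forall>\<Lambda> \<Omega> f. morphism \<Lambda> \<Omega> f \<longrightarrow> (\<forall>a \<in> carrier (pf_val R \<Lambda>).
        \<phi> \<Omega> (pf_tr R \<Lambda> \<Omega> f a) = pf_tr S \<Lambda> \<Omega> f (\<phi> \<Lambda> a))) \<and>
     (\<forall>n. \<phi> empty_ptn (pf_unit R n) = pf_unit S n) \<and>
     (\<forall>\<Lambda> \<Omega>. \<forall>a \<in> carrier (pf_val R \<Lambda>). \<forall>b \<in> carrier (pf_val R \<Omega>).
        \<phi> (sum_ptn \<Lambda> \<Omega>) (pf_ext R \<Lambda> \<Omega> a b) = pf_ext S \<Lambda> \<Omega> (\<phi> \<Lambda> a) (\<phi> \<Omega> b))"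


section \<open>Finite \<open>G\<close>-sets and the Burnside ring\<close>

type_synonym ('g, 'e) gset = "'e set \<times> ('g \<Rightarrow> 'e \<Rightarrow> 'e)"

definition fin_gset :: "('g, 'z) monoid_scheme \<Rightarrow> ('g, 'e) gset \<Rightarrow> bool" where
  "fin_gset G V \<longleftrightarrow> finite (fst V) \<and> group_action G (fst V) (snd V)"

definition gset_iso :: "('g, 'z) monoid_scheme \<Rightarrow> ('g, 'e) gset \<Rightarrow> ('g, 'f) gset \<Rightarrow> bool" where
  "gset_iso G V W \<longleftrightarrow> (\<exists>h. bij_betw h (fst V) (fst W) \<and>
     (\<forall>g \<in> carrier G. \<forall>x \<in> fst V. h (snd V g x) = snd W g (h x)))"

definition gset_triv :: "'e set \<Rightarrow> ('g, 'e) gset" where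
  "gset_triv E = (E, \<lambda>g. restrict id E)"

definition gset_sum :: "('g, 'e) gset \<Rightarrow> ('g, 'f) gset \<Rightarrow> ('g, 'e + 'f) gset" where
  "gset_sum V W = (fst V <+> fst W,
     \<lambda>g. restrict (map_sum (snd V g) (snd W g)) (fst V <+> fst W))"

definition gset_prod :: "('g, 'e) gset \<Rightarrow> ('g, 'f) gset \<Rightarrow> ('g, 'e \<times> 'f) gset" where
  "gset_prod V W = (fst V \<times> fst W,
     \<lambda>g. restrict (map_prod (snd V g) (snd W g)) (fst V \<times> fst W))"

definition gset_cosets :: "('g, 'z) monoid_scheme \<Rightarrow> 'g set \<Rightarrow> ('g, 'g set) gset" where
  "gset_cosets G H = (lcosets\<^bsub>G\<^esub> H, \<lambda>g. \<lambda>C \<in> lcosets\<^bsub>G\<^esub> H. g <#\<^bsub>G\<^esub> C)"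

text \<open>Restriction and induction along an injective homomorphism \<open>h: G \<rightarrow> H\<close>.\<close>

definition gset_res :: "('g \<Rightarrow> 'h) \<Rightarrow> ('h, 'e) gset \<Rightarrow> ('g, 'e) gset" where
  "gset_res h V = (fst V, \<lambda>g. snd V (h g))"

text \<open>
  The induced \<open>H\<close>-set is \<open>H \<times>\<^sub>G V\<close>, the quotient of \<open>H \<times> V\<close> by \<open>(k h(g), v) \<sim> (k, g v)\<close>.
\<close>

definition ind_rel :: "('g, 'y) monoid_scheme \<Rightarrow> ('h, 'z) monoid_scheme \<Rightarrow> ('g \<Rightarrow> 'h) \<Rightarrow>
    ('g, 'e) gset \<Rightarrow> (('h \<times> 'e) \<times> ('h \<times> 'e)) set" where
  "ind_rel G H h V = {((k \<otimes>\<^bsub>H\<^esub> h g, v), (k, snd V g v)) | k g v.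
     k \<in> carrier H \<and> g \<in> carrier G \<and> v \<in> fst V}"

definition gset_ind :: "('g, 'y) monoid_scheme \<Rightarrow> ('h, 'z) monoid_scheme \<Rightarrow> ('g \<Rightarrow> 'h) \<Rightarrow>
    ('g, 'e) gset \<Rightarrow> ('h, ('h \<times> 'e) set) gset" where
  "gset_ind G H h V =
     ((carrier H \<times> fst V) // ind_rel G H h V,
      \<lambda>k. \<lambda>C \<in> (carrier H \<times> fst V) // ind_rel G H h V. (\<lambda>(k', v). (k \<otimes>\<^bsub>H\<^esub> k', v)) ` C)"

text \<open>
  The Burnside ring is the Grothendieck ring of the semiring of isomorphism classes of
  finite \<open>G\<close>-sets. Its elements are the classes \<open>[V] - [W]\<close> of pairs of finite
  \<open>G\<close>-sets, where the underlying sets of representatives are finite sets of natural numbers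
  (every finite \<open>G\<close>-set is isomorphic to such a one). \<open>gdiff G V W\<close> is the
  class \<open>[V] - [W]\<close> for finite \<open>G\<close>-sets with elements in arbitrary types.
\<close>

type_synonym 'g burnside = "(('g, nat) gset \<times> ('g, nat) gset) set"

definition gdiff :: "('g, 'z) monoid_scheme \<Rightarrow> ('g, 'e) gset \<Rightarrow> ('g, 'f) gset \<Rightarrow> 'g burnside" where
  "gdiff G V W = {(V', W'). fin_gset G V' \<and> fin_gset G W' \<and>
     (\<exists>Z :: ('g, nat) gset. fin_gset G Z \<and>
        gset_iso G (gset_sum (gset_sum V W') Z) (gset_sum (gset_sum V' W) Z))}"

abbreviation (input) gset_empty :: "('g, nat) gset" where
  "gset_empty \<equiv> gset_triv {}"

definition gclass :: "('g, 'z) monoid_scheme \<Rightarrow> ('g, 'e) gset \<Rightarrow> 'g burnside" where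
  "gclass G V = gdiff G V gset_empty"

text \<open>
  Operations on classes are given by formulas in representatives. As in the theory of
  equivalence relations, these are written as unions over all representatives, all of
  which contribute the same class.
\<close>

definition burnside_add :: "('g, 'z) monoid_scheme \<Rightarrow> 'g burnside \<Rightarrow> 'g burnside \<Rightarrow> 'g burnside" where
  "burnside_add G A B =
     (\<Union>(V, W) \<in> A. \<Union>(V', W') \<in> B. gdiff G (gset_sum V V') (gset_sum W W'))"

definition burnside_mult :: "('g, 'z) monoid_scheme \<Rightarrow> 'g burnside \<Rightarrow> 'g burnside \<Rightarrow> 'g burnside" where
  "burnside_mult G A B = (\<Union>(V, W) \<in> A. \<Union>(V', W') \<in> B.
     gdiff G (gset_sum (gset_prod V V') (gset_prod W W'))
             (gset_sum (gset_prod V W') (gset_prod W V')))"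

definition burnside_ring :: "('g, 'z) monoid_scheme \<Rightarrow> 'g burnside ring" where
  "burnside_ring G =
     \<lparr>carrier = {gdiff G V W | (V :: ('g, nat) gset) (W :: ('g, nat) gset).
        fin_gset G V \<and> fin_gset G W},
      monoid.mult = burnside_mult G,
      one = gclass G (gset_triv {0 :: nat}),
      ring.zero = gclass G gset_empty,
      ring.add = burnside_add G\<rparr>"

definition burnside_res :: "('g, 'y) monoid_scheme \<Rightarrow> ('g \<Rightarrow> 'h) \<Rightarrow> 'h burnside \<Rightarrow> 'g burnside" where
  "burnside_res G h A = (\<Union>(V, W) \<in> A. gdiff G (gset_res h V) (gset_res h W))"

definition burnside_ind :: "('g, 'y) monoid_scheme \<Rightarrow> ('h, 'z) monoid_scheme \<Rightarrow> ('g \<Rightarrow> 'h) \<Rightarrow>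
    'g burnside \<Rightarrow> 'h burnside" where
  "burnside_ind G H h A = (\<Union>(V, W) \<in> A. gdiff H (gset_ind G H h V) (gset_ind G H h W))"


section \<open>The partition ring \<open>\<bbbA>\<close>\<close>

text \<open>The product of a \<open>\<Sigma>\<^sub>\<Lambda>\<close>-set and a \<open>\<Sigma>\<^sub>\<Omega>\<close>-set as a \<open>\<Sigma>\<^bsub>\<Lambda> \<squnion> \<Omega>\<^esub>\<close>-set.\<close>

definition gset_ext :: "('u point \<Rightarrow> 'u point, 'e) gset \<Rightarrow> ('u point \<Rightarrow> 'u point, 'f) gset \<Rightarrow>
    ('u point \<Rightarrow> 'u point, 'e \<times> 'f) gset" where
  "gset_ext V W = gset_prod (gset_res left_part V) (gset_res right_part W)"

definition burnside_ext :: "'u point ptn \<Rightarrow> 'u point ptn \<Rightarrow> ('u point \<Rightarrow> 'u point) burnside \<Rightarrow>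
    ('u point \<Rightarrow> 'u point) burnside \<Rightarrow> ('u point \<Rightarrow> 'u point) burnside" where
  "burnside_ext \<Lambda> \<Omega> A B = (\<Union>(V, W) \<in> A. \<Union>(V', W') \<in> B.
     gdiff (Sigma_grp (sum_ptn \<Lambda> \<Omega>))
       (gset_sum (gset_ext V V') (gset_ext W W'))
       (gset_sum (gset_ext V W') (gset_ext W V')))"

text \<open>\<open>\<bbbA>(\<Lambda>)\<close>: the additive subgroup of the Burnside ring generated by the \<open>[\<Sigma>\<^sub>\<Lambda>/\<Sigma>\<^sub>\<Gamma>]\<close>.\<close>

definition A_val :: "'a ptn \<Rightarrow> ('a \<Rightarrow> 'a) burnside ring" where
  "A_val \<Lambda> = burnside_ring (Sigma_grp \<Lambda>)
     \<lparr>carrier := generate (add_monoid (burnside_ring (Sigma_grp \<Lambda>)))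
        {gclass (Sigma_grp \<Lambda>) (gset_cosets (Sigma_grp \<Lambda>) (carrier (Sigma_grp \<Gamma>))) | \<Gamma>.
           refines \<Gamma> \<Lambda>}\<rparr>"

definition A_ring :: "('u, ('u point \<Rightarrow> 'u point) burnside) lax_pfunctor" where
  "A_ring = \<lparr>
     pf_val = A_val,
     pf_res = (\<lambda>\<Lambda> \<Omega> f. burnside_res (Sigma_grp \<Lambda>) (Sigma_map \<Lambda> \<Omega> f)),
     pf_tr = (\<lambda>\<Lambda> \<Omega> f. burnside_ind (Sigma_grp \<Lambda>) (Sigma_grp \<Omega>) (Sigma_map \<Lambda> \<Omega> f)),
     pf_unit = (\<lambda>n. [n] \<cdot>\<^bsub>A_val empty_ptn\<^esub> \<one>\<^bsub>A_val empty_ptn\<^esub>),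
     pf_ext = burnside_ext\<rparr>"

end

(*
  By Burnside's theorem an element [V] - [W] of a Burnside ring is determined by its marks
  |V^K| - |W^K|, K running over the subgroups. In terms of marks, sums and products are pointwise,
  restriction along h is evaluation at h(K), and induction along h: G -> H is given by
    |G| mark(ind V)(K) = sum over those k in H with k^-1 K k <= h(G) of mark(V)(h^-1(k^-1 K k)).
  Hence all axioms, the double coset formula included, become reindexings of finite sums, and they
  hold already for the full Burnside rings of the groups Sigma_Lambda.

  In any partition ring the transfers of units generate a partition ring: the double coset formula
  gives closure under restrictions, and Frobenius reciprocity then gives closure under products. For
  the full Burnside rings the result is A, as [Sigma_Lambda / Sigma_Gamma] is the transfer of 1 along
  Gamma <= Lambda. The same argument applied to pairs shows that the subgroup of A(Lambda) x R(Lambda)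
  generated by the pairs (tr 1, tr 1) is closed under all operations. A map A -> R has to have this
  subgroup as its graph; that it is a graph is the linear independence of the classes
  [Sigma_Lambda / Sigma_Gamma] for non-conjugate Gamma.
*)
theory Submission
  imports Defs
begin

section \<open>Marks of finite \<open>G\<close>-sets\<close>

text \<open>Elements of a Burnside ring are sets of pairs of representatives, and operations are
  unions over such pairs. Marks turn each identity into one between integers, and
  \<open>burnside_eqI\<close> leads back. The induction formula is kept multiplied by the order of
  the source group, which avoids division; that factor is cancelled at the end of each comparison.

  The axioms do not say that the unit map sends 1 to the one of the ring. A map can be compatible
  with the unit maps only because \<open>pf_unit_eq\<close> derives this from the unit laws and the
  multiplicativity of external products.

  The generators are indexed by all refinements, and conjugate refinements give equal generators, so
  this family is in general dependent. What is shown is that an integer relation between the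
  generators of A holds also between the corresponding transfers in R. Two facts combine: conjugate
  refinements have equal transfers in every partition ring, because elements of
  \<open>\<Sigma>\<^sub>\<Lambda>\<close> are 2-isomorphic to the identity; and up to conjugacy the
  table of marks is triangular with respect to the orders of the groups.\<close>

lemma fin_gsetI:
  fixes G (structure)
  assumes "group G" "finite E"
    and ext: "\<And>g. g \<in> carrier G \<Longrightarrow> \<phi> g \<in> extensional E"
    and closed: "\<And>g x. g \<in> carrier G \<Longrightarrow> x \<in> E \<Longrightarrow> \<phi> g x \<in> E"
    and one: "\<And>x. x \<in> E \<Longrightarrow> \<phi> \<one>\<^bsub>G\<^esub> x = x"
    and mult: "\<And>g h x. g \<in> carrier G \<Longrightarrow> h \<in> carrier G \<Longrightarrow> x \<in> E \<Longrightarrow>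
      \<phi> (g \<otimes>\<^bsub>G\<^esub> h) x = \<phi> g (\<phi> h x)"
  shows "fin_gset G (E, \<phi>)"
proof -
  interpret group G by fact
  have bij: "\<phi> g \<in> Bij E" if "g \<in> carrier G" for g
  proof -
    have "bij_betw (\<phi> g) E E"
      by (rule bij_betwI[where g="\<phi> (inv g)"])
        (use that in \<open>auto simp: closed mult[symmetric] one\<close>)
    then show ?thesis using ext[OF that] by (simp add: Bij_def)
  qed
  have "\<phi> \<in> hom G (BijGroup E)"
  proof (rule homI)
    show "\<phi> g \<in> carrier (BijGroup E)" if "g \<in> carrier G" for g
      using bij[OF that] by (simp add: BijGroup_def)
    show "\<phi> (g \<otimes> h) = \<phi> g \<otimes>\<^bsub>BijGroup E\<^esub> \<phi> h" if "g \<in> carrier G" "h \<in> carrier G" for g h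
      using that bij ext[of "g \<otimes> h"]
      by (auto simp: BijGroup_def compose_def mult extensional_def)
  qed
  then have "group_action G E \<phi>"
    by (simp add: group_action_def group_hom_def group_hom_axioms_def group_BijGroup is_group)
  then show ?thesis using assms(2) by (simp add: fin_gset_def)
qed

context
  fixes G :: "('g, 'z) monoid_scheme" and V :: "('g, 'e) gset"
  assumes fin: "fin_gset G V"
begin

lemma fin_gset_group: "group G"
  using fin unfolding fin_gset_def group_action_def group_hom_def by simp

lemma fin_gset_finite: "finite (fst V)"
  using fin unfolding fin_gset_def by simp

lemma fin_gset_closed: "g \<in> carrier G \<Longrightarrow> x \<in> fst V \<Longrightarrow> snd V g x \<in> fst V"
  using fin group_action.element_image unfolding fin_gset_def by metis

lemma fin_gset_one: "x \<in> fst V \<Longrightarrow> snd V \<one>\<^bsub>G\<^esub> x = x"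
  using fin group_action.id_eq_one unfolding fin_gset_def by (metis restrict_apply')

lemma fin_gset_mult:
  "g \<in> carrier G \<Longrightarrow> h \<in> carrier G \<Longrightarrow> x \<in> fst V \<Longrightarrow>
    snd V (g \<otimes>\<^bsub>G\<^esub> h) x = snd V g (snd V h x)"
  using fin group_action.composition_rule unfolding fin_gset_def by fastforce

lemma fin_gset_extensional: "g \<in> carrier G \<Longrightarrow> snd V g \<in> extensional (fst V)"
  using fin group_action.bij_prop0[of G "fst V" "snd V" g] unfolding fin_gset_def Bij_def by blast

lemma fin_gset_inv:
  assumes "g \<in> carrier G" "x \<in> fst V"
  shows "snd V (inv\<^bsub>G\<^esub> g) (snd V g x) = x" "snd V g (snd V (inv\<^bsub>G\<^esub> g) x) = x"
  using assms group.inv_closed[OF fin_gset_group]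
  by (simp_all add: fin_gset_mult[symmetric] fin_gset_one group.l_inv[OF fin_gset_group]
      group.r_inv[OF fin_gset_group])

end

section \<open>Fixed points, marks and conjugate subgroups\<close>

definition fixpts :: "('g, 'e) gset \<Rightarrow> 'g set \<Rightarrow> 'e set" where
  "fixpts V K = {v \<in> fst V. \<forall>k \<in> K. snd V k v = v}"

text \<open>An entry of Burnside's table of marks. It is an integer because virtual sets [V] - [W]
  have differences of marks.\<close>

definition mark :: "('g, 'e) gset \<Rightarrow> 'g set \<Rightarrow> int" where
  "mark V K = int (card (fixpts V K))"

text \<open>This is k^-1 K k, a right action of the group on subsets. With this convention a coset k
  S is fixed by \<open>K\<close> exactly if \<open>conj_by G k K\<close> lies in \<open>S\<close>,
  so the sums for induction run over \<open>k\<close> without inverses.\<close>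

definition conj_by :: "('g, 'z) monoid_scheme \<Rightarrow> 'g \<Rightarrow> 'g set \<Rightarrow> 'g set" where
  "conj_by G k K = (\<lambda>x. inv\<^bsub>G\<^esub> k \<otimes>\<^bsub>G\<^esub> x \<otimes>\<^bsub>G\<^esub> k) ` K"

context group begin

lemma conj_by_closed: "k \<in> carrier G \<Longrightarrow> K \<subseteq> carrier G \<Longrightarrow> conj_by G k K \<subseteq> carrier G"
  by (auto simp: conj_by_def)

lemma conj_by_one: "K \<subseteq> carrier G \<Longrightarrow> conj_by G \<one> K = K"
  by (force simp: conj_by_def image_iff)

lemma conj_by_mult:
  assumes "k \<in> carrier G" "j \<in> carrier G" "K \<subseteq> carrier G"
  shows "conj_by G (k \<otimes> j) K = conj_by G j (conj_by G k K)"
  using assms by (auto simp: conj_by_def image_image inv_mult_group m_assoc subset_iff intro!: image_cong)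

lemma conj_by_inv:
  assumes "k \<in> carrier G" "K \<subseteq> carrier G"
  shows "conj_by G (inv k) (conj_by G k K) = K" "conj_by G k (conj_by G (inv k) K) = K"
  using assms by (simp_all add: conj_by_mult[symmetric] conj_by_one)

lemma subgroup_conj_by:
  assumes "k \<in> carrier G" "subgroup K G"
  shows "subgroup (conj_by G k K) G"
proof (rule subgroupI)
  interpret K: subgroup K G by fact
  show "conj_by G k K \<subseteq> carrier G" using assms conj_by_closed K.subset by blast
  show "conj_by G k K \<noteq> {}" using K.one_closed unfolding conj_by_def by blast
  fix a assume "a \<in> conj_by G k K"
  then obtain x where x: "x \<in> K" "a = inv k \<otimes> x \<otimes> k" by (auto simp: conj_by_def)
  then have "inv a = inv k \<otimes> inv x \<otimes> k"
    using assms K.mem_carrier by (simp add: inv_mult_group m_assoc)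
  then show "inv a \<in> conj_by G k K" using x by (auto simp: conj_by_def)
  fix b assume "b \<in> conj_by G k K"
  then obtain y where y: "y \<in> K" "b = inv k \<otimes> y \<otimes> k" by (auto simp: conj_by_def)
  have "a \<otimes> b = inv k \<otimes> (x \<otimes> (k \<otimes> inv k) \<otimes> y) \<otimes> k"
    using assms(1) K.mem_carrier x y by (simp only: m_assoc inv_closed m_closed)
  also have "\<dots> = inv k \<otimes> (x \<otimes> y) \<otimes> k"
    using assms(1) K.mem_carrier x y by simp
  finally show "a \<otimes> b \<in> conj_by G k K" using x y by (auto simp: conj_by_def)
qed

lemma card_conj_by:
  assumes "k \<in> carrier G" "K \<subseteq> carrier G"
  shows "card (conj_by G k K) = card K"
  unfolding conj_by_def
  by (rule card_image, rule inj_onI) (use assms in \<open>auto simp: subset_iff\<close>)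

end

text \<open>The action of k^-1 carries the points fixed by \<open>K\<close> to those fixed by k^-1 K
  k, and \<open>k\<close> carries them back.\<close>

lemma mark_conj_by:
  fixes G (structure)
  assumes V: "fin_gset G V" and k: "k \<in> carrier G" and K: "K \<subseteq> carrier G"
  shows "mark V (conj_by G k K) = mark V K"
proof -
  interpret group G using V by (rule fin_gset_group)
  have "bij_betw (snd V (inv k)) (fixpts V K) (fixpts V (conj_by G k K))"
  proof (rule bij_betwI[where g="snd V k"])
    have *: "snd V (inv k \<otimes> x \<otimes> k) v = snd V (inv k) (snd V x (snd V k v))"
      if "x \<in> K" "v \<in> fst V" for x v
      using that K k V by (auto simp: fin_gset_mult fin_gset_closed subset_iff)
    show "snd V (inv k) \<in> fixpts V K \<rightarrow> fixpts V (conj_by G k K)"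
      using V K k * by (auto simp: fixpts_def conj_by_def fin_gset_closed fin_gset_inv)
    show "snd V k \<in> fixpts V (conj_by G k K) \<rightarrow> fixpts V K"
    proof
      fix v assume v: "v \<in> fixpts V (conj_by G k K)"
      then have v': "v \<in> fst V" by (simp add: fixpts_def)
      have "snd V x (snd V k v) = snd V k v" if x: "x \<in> K" for x
      proof -
        have "snd V (inv k) (snd V x (snd V k v)) = v"
          using v x *[OF x v'] by (auto simp: fixpts_def conj_by_def)
        moreover have "snd V x (snd V k v) \<in> fst V"
          using V K k v' x by (auto simp: fin_gset_closed)
        ultimately show ?thesis using fin_gset_inv(2)[OF V k] by metis
      qed
      then show "snd V k v \<in> fixpts V K" using V k v' by (simp add: fixpts_def fin_gset_closed)
    qed
  qed (use V k in \<open>auto simp: fixpts_def fin_gset_inv\<close>)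
  then show ?thesis by (simp add: mark_def bij_betw_same_card)
qed

text \<open>An isomorphism restricts to a bijection of fixed points. \<open>gset_iso\<close> does
  not require its arguments to be actions, so \<open>closed\<close> is stated separately:
  injectivity of the isomorphism is applied to \<open>snd V g v\<close> and \<open>v\<close>, and
  both have to be points of \<open>V\<close>.\<close>

lemma mark_gset_iso:
  assumes "gset_iso G V W" and K: "K \<subseteq> carrier G"
    and closed: "\<And>g v. g \<in> carrier G \<Longrightarrow> v \<in> fst V \<Longrightarrow> snd V g v \<in> fst V"
  shows "mark V K = mark W K"
proof -
  obtain h where h: "bij_betw h (fst V) (fst W)"
    and eq: "\<And>g x. g \<in> carrier G \<Longrightarrow> x \<in> fst V \<Longrightarrow> h (snd V g x) = snd W g (h x)"
    using assms(1) unfolding gset_iso_def by blast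
  have "bij_betw h (fixpts V K) (fixpts W K)"
  proof (rule bij_betw_imageI)
    show "inj_on h (fixpts V K)"
      using h by (auto simp: bij_betw_def fixpts_def inj_on_def)
    show "h ` fixpts V K = fixpts W K"
    proof (intro equalityI subsetI)
      fix w assume "w \<in> h ` fixpts V K"
      then obtain v where "v \<in> fixpts V K" "w = h v" by blast
      then show "w \<in> fixpts W K"
        using eq[of _ v, symmetric] K h by (auto simp: fixpts_def subset_iff bij_betw_apply)
    next
      fix w assume w: "w \<in> fixpts W K"
      then obtain v where v: "v \<in> fst V" "w = h v"
        using h by (auto simp: fixpts_def bij_betw_def)
      have "snd V k v = v" if "k \<in> K" for k
        using h eq[of k v] v w that K closed[of k v]
        by (auto simp: fixpts_def bij_betw_def inj_on_def)
      then show "w \<in> h ` fixpts V K" using v by (auto simp: fixpts_def)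
    qed
  qed
  then show ?thesis by (simp add: mark_def bij_betw_same_card)
qed

context
  fixes G :: "('g, 'z) monoid_scheme" (structure) and V :: "('g, 'e) gset"
  assumes V: "fin_gset G V"
begin

lemma fin_gset_subset:
  assumes "E \<subseteq> fst V" "\<And>g x. g \<in> carrier G \<Longrightarrow> x \<in> E \<Longrightarrow> snd V g x \<in> E"
  shows "fin_gset G (E, \<lambda>g. restrict (snd V g) E)"
proof (rule fin_gsetI)
  show "finite E" using assms(1) V finite_subset fin_gset_finite by blast
qed (use assms V fin_gset_group[OF V] in
    \<open>auto simp: subset_iff fin_gset_one fin_gset_mult group.is_monoid monoid.one_closed monoid.m_closed\<close>)

text \<open>Fixedness is a condition on single points, so the fixed points split along
  \<open>E\<close>. Applied to an orbit, this lets the proof of Burnside's theorem subtract the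
  marks of matched orbits.\<close>

lemma mark_subset:
  assumes "E \<subseteq> fst V"
  shows "mark V K = mark (E, \<lambda>g. restrict (snd V g) E) K +
    mark (fst V - E, \<lambda>g. restrict (snd V g) (fst V - E)) K"
proof -
  have "fixpts V K = fixpts (E, \<lambda>g. restrict (snd V g) E) K \<union>
      fixpts (fst V - E, \<lambda>g. restrict (snd V g) (fst V - E)) K"
    using assms by (auto simp: fixpts_def)
  moreover have "finite (fixpts (E, \<lambda>g. restrict (snd V g) E) K)"
    "finite (fixpts (fst V - E, \<lambda>g. restrict (snd V g) (fst V - E)) K)"
    using finite_subset[OF assms fin_gset_finite[OF V]] fin_gset_finite[OF V]
    unfolding fixpts_def by simp_all
  ultimately show ?thesis
    by (simp add: mark_def card_Un_disjoint fixpts_def disjoint_iff)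
qed

lemma stabilizer_subgroup_gset: "x \<in> fst V \<Longrightarrow> subgroup (stabilizer G (snd V) x) G"
  using V group_action.stabilizer_subgroup[of G "fst V" "snd V" x] unfolding fin_gset_def by simp

lemma orbit_gset:
  assumes x: "x \<in> fst V"
  shows "x \<in> orbit G (snd V) x" "orbit G (snd V) x \<subseteq> fst V"
    "\<And>g y. g \<in> carrier G \<Longrightarrow> y \<in> orbit G (snd V) x \<Longrightarrow> snd V g y \<in> orbit G (snd V) x"
    "\<And>g y. g \<in> carrier G \<Longrightarrow> y \<in> fst V - orbit G (snd V) x \<Longrightarrow> snd V g y \<in> fst V - orbit G (snd V) x"
proof -
  interpret group G using V by (rule fin_gset_group)
  show "x \<in> orbit G (snd V) x"
    unfolding orbit_def by (rule CollectI, rule exI[of _ \<one>]) (simp add: fin_gset_one[OF V x])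
  show "orbit G (snd V) x \<subseteq> fst V"
    using fin_gset_closed[OF V _ x] by (auto simp: orbit_def)
  show *: "snd V g y \<in> orbit G (snd V) x" if "g \<in> carrier G" "y \<in> orbit G (snd V) x" for g y
  proof -
    obtain h where h: "h \<in> carrier G" "y = snd V h x" 
      using \<open>y \<in> _\<close> unfolding orbit_def by blast
    show ?thesis
      unfolding orbit_def h(2) using \<open>g \<in> _\<close> h(1)
      by (intro CollectI exI[of _ "g \<otimes> h"]) (simp add: fin_gset_mult[OF V _ _ x])
  qed
  fix g y assume g: "g \<in> carrier G" and y: "y \<in> fst V - orbit G (snd V) x"
  have "y \<in> orbit G (snd V) x" if "snd V g y \<in> orbit G (snd V) x"
    using *[OF inv_closed[OF g] that] fin_gset_inv(1)[OF V g, of y] y by simp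
  then show "snd V g y \<in> fst V - orbit G (snd V) x"
    using fin_gset_closed[OF V g, of y] y by auto
qed

end

text \<open>Both orbits are copies of the cosets of the common stabilizer; the isomorphism sends g x
  to g y.\<close>

lemma orbits_iso:
  fixes G (structure)
  assumes V: "fin_gset G V" and W: "fin_gset G W" and x: "x \<in> fst V" and y: "y \<in> fst W"
    and stab: "stabilizer G (snd V) x = stabilizer G (snd W) y"
  shows "\<exists>h. bij_betw h (orbit G (snd V) x) (orbit G (snd W) y) \<and>
     (\<forall>g \<in> carrier G. \<forall>v \<in> orbit G (snd V) x. h (snd V g v) = snd W g (h v))"
proof -
  interpret group G using V by (rule fin_gset_group)
  have coll: "snd U g z = snd U g' z \<longleftrightarrow> inv g' \<otimes> g \<in> stabilizer G (snd U) z"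
    if U: "fin_gset G U" and "z \<in> fst U" "g \<in> carrier G" "g' \<in> carrier G"
    for U :: "('a, 'x) gset" and z g g'
    using that fin_gset_mult[OF U, of "inv g'" g z] fin_gset_closed[OF U]
      fin_gset_inv[OF U, of g'] unfolding stabilizer_def
    by (auto) (metis)
  have iff: "snd V g x = snd V g' x \<longleftrightarrow> snd W g y = snd W g' y"
    if "g \<in> carrier G" "g' \<in> carrier G" for g g'
    using coll[OF V x that] coll[OF W y that] stab by simp
  \<comment> \<open>The choice of a group element that moves \<open>x\<close> to \<open>v\<close>
    does not matter: by \<open>iff\<close>, two such elements also move \<open>y\<close> to the same
    point.\<close>
  define h where "h v = snd W (SOME g. g \<in> carrier G \<and> snd V g x = v) y" for v
  have h: "h (snd V g x) = snd W g y" if g: "g \<in> carrier G" for g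
  proof -
    have "(SOME g'. g' \<in> carrier G \<and> snd V g' x = snd V g x) \<in> carrier G \<and>
      snd V (SOME g'. g' \<in> carrier G \<and> snd V g' x = snd V g x) x = snd V g x"
      by (rule someI[of _ g]) (simp add: g)
    then show ?thesis using iff[OF _ g] unfolding h_def by blast
  qed
  have "bij_betw h (orbit G (snd V) x) (orbit G (snd W) y)"
  proof (rule bij_betw_imageI)
    show "inj_on h (orbit G (snd V) x)"
      by (rule inj_onI) (auto simp: orbit_def h iff)
    show "h ` orbit G (snd V) x = orbit G (snd W) y"
      by (auto simp: orbit_def h image_iff) (metis h)
  qed
  moreover have "h (snd V g v) = snd W g (h v)" if "g \<in> carrier G" "v \<in> orbit G (snd V) x" for g v
  proof -
    obtain k where k: "k \<in> carrier G" "v = snd V k x" using \<open>v \<in> _\<close> by (auto simp: orbit_def)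
    then show ?thesis using h[of "g \<otimes> k"] h[of k] \<open>g \<in> _\<close>
      by (simp add: fin_gset_mult[OF V _ _ x] fin_gset_mult[OF W _ _ y])
  qed
  ultimately show ?thesis by blast
qed

text \<open>
  Burnside's theorem. A point of \<open>V\<close> with maximal stabilizer \<open>H\<close> can be matched with a point of
  \<open>W\<close> that has the same stabilizer, because \<open>H\<close> and its supergroups have fixed points in both or in
  neither; the two orbits are isomorphic and can be split off.
\<close>

theorem gset_iso_if_mark_eq:
  fixes G (structure) and V :: "('g, 'e) gset" and W :: "('g, 'f) gset"
  assumes "fin_gset G V" "fin_gset G W" and fin: "finite (carrier G)"
    and "\<And>K. subgroup K G \<Longrightarrow> mark V K = mark W K"
  shows "gset_iso G V W"
  using assms(1,2,4)
proof (induction "card (fst V)" arbitrary: V W rule: less_induct)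
  case less
  note V = less.prems(1) and W = less.prems(2) and marks = less.prems(3)
  interpret group G using V by (rule fin_gset_group)
  note fV = fin_gset_finite[OF V] and fW = fin_gset_finite[OF W]
  have fix_iff: "fixpts V K = {} \<longleftrightarrow> fixpts W K = {}" if "subgroup K G" for K
  proof -
    have "finite (fixpts V K)" "finite (fixpts W K)" using fV fW by (simp_all add: fixpts_def)
    then show ?thesis using marks[OF that] unfolding mark_def by (metis card_0_eq of_nat_eq_iff)
  qed
  \<comment> \<open>At the trivial subgroup the mark counts all points, which settles the case of an
    empty \<open>V\<close>.\<close>
  have triv: "fixpts U {\<one>} = fst U" if "fin_gset G U" for U :: "('g, 'x) gset"
    using fin_gset_one[OF that] by (auto simp: fixpts_def)
  show ?case
  proof (cases "fst V = {}")
    case True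
    then have "fst W = {}"
      using fix_iff[OF triv_subgroup] triv V W by metis
    then show ?thesis using True by (auto simp: gset_iso_def bij_betw_def)
  next
    case False
    define st where "st = stabilizer G (snd V)"
    obtain x where x: "x \<in> fst V" and max: "\<And>z. z \<in> fst V \<Longrightarrow> card (st z) \<le> card (st x)"
      using obtains_MAX[OF fV False, of "\<lambda>z. card (st z)"] fV by (metis Max_ge finite_imageI imageI)
    have sx: "subgroup (st x) G" unfolding st_def using stabilizer_subgroup_gset[OF V x] .
    have "x \<in> fixpts V (st x)" using x by (auto simp: st_def fixpts_def stabilizer_def)
    then obtain y where y: "y \<in> fst W" and ysub: "\<And>k. k \<in> st x \<Longrightarrow> snd W k y = y"
      using fix_iff[OF sx] unfolding fixpts_def by blast
    have sy: "subgroup (stabilizer G (snd W) y) G" by (rule stabilizer_subgroup_gset[OF W y])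
    have sub: "st x \<subseteq> stabilizer G (snd W) y"
      using ysub subgroup.subset[OF sx] by (auto simp: stabilizer_def)
    have "y \<in> fixpts W (stabilizer G (snd W) y)" using y by (auto simp: fixpts_def stabilizer_def)
    then obtain z where z: "z \<in> fst V" "\<And>k. k \<in> stabilizer G (snd W) y \<Longrightarrow> snd V k z = z"
      using fix_iff[OF sy] unfolding fixpts_def by blast
    \<comment> \<open>The stabilizer of \<open>y\<close> lies between those of \<open>x\<close> and
      \<open>z\<close>, and the stabilizer of \<open>x\<close> has maximal order, so the first two
      are equal.\<close>
    then have "stabilizer G (snd W) y \<subseteq> st z"
      using subgroup.subset[OF sy] by (auto simp: st_def stabilizer_def)
    moreover have "finite (st z)" using fin by (simp add: st_def stabilizer_def)
    ultimately have "card (stabilizer G (snd W) y) \<le> card (st x)"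
      using card_mono max[OF z(1)] le_trans by blast
    then have stab: "stabilizer G (snd V) x = stabilizer G (snd W) y"
      using sub fin card_seteq[of "stabilizer G (snd W) y" "st x"]
      by (simp add: st_def stabilizer_def)
    define O1 O2 where "O1 = orbit G (snd V) x" and "O2 = orbit G (snd W) y"
    obtain h1 where h1: "bij_betw h1 O1 O2"
      "\<And>g v. g \<in> carrier G \<Longrightarrow> v \<in> O1 \<Longrightarrow> h1 (snd V g v) = snd W g (h1 v)"
      using orbits_iso[OF V W x y stab] unfolding O1_def O2_def by blast
    note o1 = orbit_gset[OF V x, folded O1_def] and o2 = orbit_gset[OF W y, folded O2_def]
    define V' W' where "V' = (fst V - O1, \<lambda>g. restrict (snd V g) (fst V - O1))"
      and "W' = (fst W - O2, \<lambda>g. restrict (snd W g) (fst W - O2))"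
    have V': "fin_gset G V'" unfolding V'_def using o1 by (intro fin_gset_subset[OF V]) auto
    have W': "fin_gset G W'" unfolding W'_def using o2 by (intro fin_gset_subset[OF W]) auto
    have "gset_iso G (O1, \<lambda>g. restrict (snd V g) O1) (O2, \<lambda>g. restrict (snd W g) O2)"
      unfolding gset_iso_def using h1 o1 o2
      by (auto intro!: exI[of _ h1] simp: bij_betw_apply)
    then have "mark (O1, \<lambda>g. restrict (snd V g) O1) K = mark (O2, \<lambda>g. restrict (snd W g) O2) K"
      if "subgroup K G" for K
      by (rule mark_gset_iso) (use subgroup.subset[OF that] o1 in auto)
    then have "mark V' K = mark W' K" if "subgroup K G" for K
      using that marks[OF that] mark_subset[OF V o1(2), of K] mark_subset[OF W o2(2), of K]
      by (simp add: V'_def W'_def)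
    moreover have "card (fst V') < card (fst V)"
      using fV o1(1) x by (auto simp: V'_def intro!: psubset_card_mono)
    ultimately have "gset_iso G V' W'" using less.hyps V' W' by blast
    then obtain h2 where h2_iso: "bij_betw h2 (fst V') (fst W')"
      "\<forall>g \<in> carrier G. \<forall>v \<in> fst V'. h2 (snd V' g v) = snd W' g (h2 v)"
      unfolding gset_iso_def by blast
    then have h2: "bij_betw h2 (fst V - O1) (fst W - O2)" by (simp add: V'_def W'_def)
    have h2_eq: "h2 (snd V g v) = snd W g (h2 v)" if "g \<in> carrier G" "v \<in> fst V - O1" for g v
      using h2_iso(2) that bij_betw_apply[OF h2 that(2)] by (simp add: V'_def W'_def)
    define h where "h v = (if v \<in> O1 then h1 v else h2 v)" for v
    have "bij_betw h (O1 \<union> (fst V - O1)) (O2 \<union> (fst W - O2))"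
    proof (rule bij_betw_combine)
      show "bij_betw h O1 O2"
        by (rule bij_betw_cong[THEN iffD2, OF _ h1(1)]) (simp add: h_def)
      show "bij_betw h (fst V - O1) (fst W - O2)"
        by (rule bij_betw_cong[THEN iffD2, OF _ h2]) (simp add: h_def)
    qed auto
    then have "bij_betw h (fst V) (fst W)" using o1(2) o2(2) by (simp add: Un_absorb1)
    moreover have "h (snd V g v) = snd W g (h v)" if "g \<in> carrier G" "v \<in> fst V" for g v
      using that h1(2)[of g v] h2_eq[of g v] o1(3)[of g v] o1(4)[of g v] by (auto simp: h_def)
    ultimately show ?thesis unfolding gset_iso_def by blast
  qed
qed

section \<open>Sums, products and restrictions of finite sets with an action, and their
  marks\<close>

lemma fin_gset_sum: "fin_gset G V \<Longrightarrow> fin_gset G W \<Longrightarrow> fin_gset G (gset_sum V W)"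
  unfolding gset_sum_def
  by (rule fin_gsetI)
    (auto simp: fin_gset_group fin_gset_finite fin_gset_closed fin_gset_one fin_gset_mult
      group.is_monoid[OF fin_gset_group] monoid.m_closed)

lemma fin_gset_prod: "fin_gset G V \<Longrightarrow> fin_gset G W \<Longrightarrow> fin_gset G (gset_prod V W)"
  unfolding gset_prod_def
  by (rule fin_gsetI)
    (auto simp: fin_gset_group fin_gset_finite fin_gset_closed fin_gset_one fin_gset_mult
      group.is_monoid[OF fin_gset_group] monoid.m_closed)

lemma fin_gset_triv: "group G \<Longrightarrow> finite E \<Longrightarrow> fin_gset G (gset_triv E)"
  unfolding gset_triv_def by (rule fin_gsetI) auto

lemma fin_gset_res:
  assumes "group G" "h \<in> hom G H" "fin_gset H V"
  shows "fin_gset G (gset_res h V)"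
proof -
  interpret h: group_hom G H h
    using assms fin_gset_group[OF assms(3)] by (simp add: group_hom_def group_hom_axioms_def)
  show ?thesis
    unfolding gset_res_def
    by (rule fin_gsetI)
      (use assms in \<open>auto simp: fin_gset_finite fin_gset_closed fin_gset_one fin_gset_mult
        fin_gset_extensional\<close>)
qed

lemma mark_sum:
  assumes "fin_gset G V" "fin_gset G W"
  shows "mark (gset_sum V W) K = mark V K + mark W K"
proof -
  have "fixpts (gset_sum V W) K = fixpts V K <+> fixpts W K"
    by (auto simp: fixpts_def gset_sum_def)
  then show ?thesis
    using fin_gset_finite[OF assms(1)] fin_gset_finite[OF assms(2)]
    by (simp add: mark_def card_Plus fixpts_def)
qed

lemma mark_prod: "mark (gset_prod V W) K = mark V K * mark W K"
proof -
  have "fixpts (gset_prod V W) K = fixpts V K \<times> fixpts W K"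
    by (auto simp: fixpts_def gset_prod_def)
  then show ?thesis by (simp add: mark_def card_cartesian_product)
qed

lemma mark_triv: "mark (gset_triv E) K = int (card E)"
  by (simp add: mark_def fixpts_def gset_triv_def)

lemma mark_res: "mark (gset_res h V) K = mark V (h ` K)"
  by (simp add: mark_def fixpts_def gset_res_def)

text \<open>The pairs in a \<open>burnside\<close> class have points in \<open>nat\<close>, whereas
  sums, products, induced sets and cosets have points in other types. Numbering the points
  transports the action and keeps the marks.\<close>

lemma fin_gset_nat_copy:
  fixes V :: "('g, 'e) gset"
  assumes V: "fin_gset G V"
  obtains V' :: "('g, nat) gset"
  where "fin_gset G V'" "\<And>K. K \<subseteq> carrier G \<Longrightarrow> mark V' K = mark V K"
proof -
  interpret group G using V by (rule fin_gset_group)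
  obtain f where f: "bij_betw f (fst V) {0..<card (fst V)}"
    using ex_bij_betw_finite_nat[OF fin_gset_finite[OF V]] by blast
  define f' where "f' = inv_into (fst V) f"
  have f': "f' (f x) = x" if "x \<in> fst V" for x
    using f that by (simp add: f'_def bij_betw_inv_into_left)
  define E where "E = f ` fst V"
  define V' where "V' = (E, \<lambda>g. restrict (\<lambda>i. f (snd V g (f' i))) E)"
  have "fin_gset G V'"
    unfolding V'_def
    by (rule fin_gsetI) (auto simp: E_def f' fin_gset_finite[OF V] fin_gset_closed[OF V]
        fin_gset_one[OF V] fin_gset_mult[OF V] inj_on_eq_iff[OF bij_betw_imp_inj_on[OF f]])
  moreover have "gset_iso G V V'"
    unfolding gset_iso_def V'_def using f
    by (auto intro!: exI[of _ f] simp: E_def f' bij_betw_def)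
  then have "mark V' K = mark V K" if "K \<subseteq> carrier G" for K
    using mark_gset_iso[OF _ that] fin_gset_closed[OF V] by metis
  ultimately show ?thesis using that by blast
qed


section \<open>The Burnside ring in terms of marks\<close>

locale finite_group = group G for G (structure) +
  assumes finite_carrier: "finite (carrier G)"

text \<open>The ghost coordinate of a virtual set at \<open>K\<close>. The chosen pair is irrelevant
  when \<open>A\<close> is in the carrier and \<open>K\<close> is a subgroup, by
  \<open>burnside_ringD\<close>.\<close>

definition bmark :: "'g burnside \<Rightarrow> 'g set \<Rightarrow> int" where
  "bmark A K = (case SOME p. p \<in> A of (V, W) \<Rightarrow> mark V K - mark W K)"

context finite_group begin

text \<open>Marks are additive, so the stabilizing summand \<open>Z\<close> in \<open>gdiff\<close>
  cancels from them. Conversely, equality of marks already gives an isomorphism by Burnside's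
  theorem, so the empty \<open>Z\<close> serves.\<close>

lemma gdiff_iff:
  assumes "fin_gset G V" "fin_gset G W"
  shows "(V', W') \<in> gdiff G V W \<longleftrightarrow> fin_gset G V' \<and> fin_gset G W' \<and>
    (\<forall>K. subgroup K G \<longrightarrow> mark V K - mark W K = mark V' K - mark W' K)" (is "_ \<longleftrightarrow> ?r")
proof
  assume "(V', W') \<in> gdiff G V W"
  then obtain Z :: "('a, nat) gset" where *: "fin_gset G V'" "fin_gset G W'" "fin_gset G Z"
    "gset_iso G (gset_sum (gset_sum V W') Z) (gset_sum (gset_sum V' W) Z)"
    unfolding gdiff_def by blast
  have eq: "mark (gset_sum (gset_sum V W') Z) K = mark (gset_sum (gset_sum V' W) Z) K"
    if "subgroup K G" for K
    by (rule mark_gset_iso[OF *(4) subgroup.subset[OF that]])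
      (rule fin_gset_closed[OF fin_gset_sum[OF fin_gset_sum[OF assms(1) *(2)] *(3)]])
  then have "mark V K - mark W K = mark V' K - mark W' K" if "subgroup K G" for K
  proof -
    have "mark V K + mark W' K + mark Z K = mark V' K + mark W K + mark Z K"
      using eq[OF that] by (simp add: mark_sum[of G] fin_gset_sum assms *)
    then show ?thesis by simp
  qed
  then show ?r using * by blast
next
  assume r: ?r
  let ?Z = "gset_triv {} :: ('a, nat) gset"
  have Z: "fin_gset G ?Z" by (simp add: fin_gset_triv is_group)
  have "gset_iso G (gset_sum (gset_sum V W') ?Z) (gset_sum (gset_sum V' W) ?Z)"
  proof (rule gset_iso_if_mark_eq)
    fix K assume K: "subgroup K G"
    then have "mark V K + mark W' K = mark V' K + mark W K" using r by (simp add: algebra_simps)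
    then show "mark (gset_sum (gset_sum V W') ?Z) K = mark (gset_sum (gset_sum V' W) ?Z) K"
      using r assms Z by (simp add: mark_sum[of G] fin_gset_sum)
  qed (use r assms Z finite_carrier in \<open>simp_all add: fin_gset_sum\<close>)
  then show "(V', W') \<in> gdiff G V W" unfolding gdiff_def using r Z by blast
qed

lemma gdiff_eqI:
  assumes "fin_gset G V" "fin_gset G W" "fin_gset G V'" "fin_gset G W'"
    and "\<And>K. subgroup K G \<Longrightarrow> mark V K - mark W K = mark V' K - mark W' K"
  shows "gdiff G V W = gdiff G V' W'"
  using assms by (auto simp: gdiff_iff)

lemma gdiff_nat:
  fixes V :: "('a, 'e) gset" and W :: "('a, 'f) gset"
  assumes "fin_gset G V" "fin_gset G W"
  shows "\<exists>(V' :: ('a, nat) gset) (W' :: ('a, nat) gset). fin_gset G V' \<and> fin_gset G W' \<and> gdiff G V W = gdiff G V' W'"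
proof -
  obtain V' W' :: "('a, nat) gset" where *: "fin_gset G V'" "fin_gset G W'"
    "\<And>K. K \<subseteq> carrier G \<Longrightarrow> mark V' K = mark V K"
    "\<And>K. K \<subseteq> carrier G \<Longrightarrow> mark W' K = mark W K"
    using fin_gset_nat_copy[OF assms(1)] fin_gset_nat_copy[OF assms(2)] by metis
  have "gdiff G V W = gdiff G V' W'"
    using * assms by (intro gdiff_eqI) (auto dest!: subgroup.subset)
  with *(1,2) show ?thesis by blast
qed

lemma gdiff_in_burnside_ring:
  assumes "fin_gset G V" "fin_gset G W"
  shows "gdiff G V W \<in> carrier (burnside_ring G)"
  using gdiff_nat[OF assms] by (auto simp: burnside_ring_def)

lemma burnside_ring_ne:
  assumes "A \<in> carrier (burnside_ring G)"
  shows "A \<noteq> {}"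
proof -
  obtain V W :: "('a, nat) gset" where "fin_gset G V" "fin_gset G W" "A = gdiff G V W"
    using assms by (auto simp: burnside_ring_def)
  then have "(V, W) \<in> A" by (simp add: gdiff_iff)
  then show ?thesis by blast
qed

text \<open>Each class is recovered from any of its pairs, and its marks may be computed from any of
  them, because all of them have the same differences of marks.\<close>

lemma burnside_ringD:
  assumes "A \<in> carrier (burnside_ring G)" "(V, W) \<in> A"
  shows "fin_gset G V" "fin_gset G W" "A = gdiff G V W"
    "subgroup K G \<Longrightarrow> bmark A K = mark V K - mark W K"
proof -
  obtain V0 W0 :: "('a, nat) gset" where *: "fin_gset G V0" "fin_gset G W0" "A = gdiff G V0 W0"
    using assms by (auto simp: burnside_ring_def)
  have **: "fin_gset G V \<and> fin_gset G W \<and>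
    (\<forall>K. subgroup K G \<longrightarrow> mark V0 K - mark W0 K = mark V K - mark W K)" if "(V, W) \<in> A" for V W
    using that * by (simp add: gdiff_iff)
  show V: "fin_gset G V" and W: "fin_gset G W" using **[OF assms(2)] by auto
  show "A = gdiff G V W" unfolding *(3) using **[OF assms(2)] * by (intro gdiff_eqI) auto
  obtain V1 W1 where 1: "(SOME p. p \<in> A) = (V1, W1)" by (cases "SOME p. p \<in> A")
  then have "(V1, W1) \<in> A" using assms(2) someI[of "\<lambda>p. p \<in> A"] by metis
  then show "bmark A K = mark V K - mark W K" if "subgroup K G"
    using 1 **[OF \<open>(V1, W1) \<in> A\<close>] **[OF assms(2)] that by (simp add: bmark_def)
qed

lemma bmark_gdiff:
  assumes "fin_gset G V" "fin_gset G W" "subgroup K G"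
  shows "bmark (gdiff G V W) K = mark V K - mark W K"
proof -
  have A: "gdiff G V W \<in> carrier (burnside_ring G)" using assms by (simp add: gdiff_in_burnside_ring)
  obtain V' W' where V'W': "(V', W') \<in> gdiff G V W" using burnside_ring_ne[OF A] by auto
  then show ?thesis using burnside_ringD(4)[OF A V'W'] assms by (simp add: gdiff_iff)
qed

text \<open>The form in which Burnside's theorem is applied from here on: marks at subgroups
  separate the elements of the ring.\<close>

lemma burnside_eqI:
  assumes "A \<in> carrier (burnside_ring G)" "B \<in> carrier (burnside_ring G)"
    and "\<And>K. subgroup K G \<Longrightarrow> bmark A K = bmark B K"
  shows "A = B"
proof -
  obtain V W V' W' where "(V, W) \<in> A" "(V', W') \<in> B"
    using assms(1,2) burnside_ring_ne by (metis all_not_in_conv surj_pair)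
  note A = burnside_ringD[OF assms(1) this(1)] and B = burnside_ringD[OF assms(2) this(2)]
  show ?thesis unfolding A(3) B(3) using A B assms(3) by (intro gdiff_eqI) auto
qed

text \<open>The common pattern behind all operations on classes. If the marks do not depend on the
  index, all members of the union are the same class, and a nonempty index set leaves exactly that
  class.\<close>

lemma UN_gdiff:
  assumes "S \<noteq> {}" and "\<And>p. p \<in> S \<Longrightarrow> fin_gset G (f p)" "\<And>p. p \<in> S \<Longrightarrow> fin_gset G (g p)"
    and "\<And>p K. p \<in> S \<Longrightarrow> subgroup K G \<Longrightarrow> mark (f p) K - mark (g p) K = c K"
  shows "(\<Union>p \<in> S. gdiff G (f p) (g p)) \<in> carrier (burnside_ring G) \<and>
    (\<forall>K. subgroup K G \<longrightarrow> bmark (\<Union>p \<in> S. gdiff G (f p) (g p)) K = c K)"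
proof -
  obtain p where p: "p \<in> S" using assms(1) by blast
  have eq: "(\<Union>p \<in> S. gdiff G (f p) (g p)) = gdiff G (f p) (g p)"
  proof -
    have "gdiff G (f q) (g q) = gdiff G (f p) (g p)" if "q \<in> S" for q
      by (rule gdiff_eqI) (use assms p that in auto)
    then have "(\<Union>q \<in> S. gdiff G (f q) (g q)) = (\<Union>q \<in> S. gdiff G (f p) (g p))"
      by (rule SUP_cong[OF refl])
    then show ?thesis using p by auto
  qed
  show ?thesis
    unfolding eq using assms(2-4)[OF p] by (simp add: gdiff_in_burnside_ring bmark_gdiff)
qed

lemma gclass:
  assumes "fin_gset G V"
  shows "gclass G V \<in> carrier (burnside_ring G)"
    "subgroup K G \<Longrightarrow> bmark (gclass G V) K = mark V K"
  using assms
  by (simp_all add: gclass_def gdiff_in_burnside_ring bmark_gdiff fin_gset_triv is_group mark_triv)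

lemma burnside_zero:
  "\<zero>\<^bsub>burnside_ring G\<^esub> \<in> carrier (burnside_ring G)"
  "subgroup K G \<Longrightarrow> bmark \<zero>\<^bsub>burnside_ring G\<^esub> K = 0"
  using gclass[OF fin_gset_triv[OF is_group finite.emptyI]]
  by (simp_all add: burnside_ring_def mark_triv)

lemma burnside_one:
  "\<one>\<^bsub>burnside_ring G\<^esub> \<in> carrier (burnside_ring G)"
  "subgroup K G \<Longrightarrow> bmark \<one>\<^bsub>burnside_ring G\<^esub> K = 1"
  using gclass[OF fin_gset_triv[OF is_group, of "{0}"]]
  by (simp_all add: burnside_ring_def mark_triv)

lemma burnside_add:
  assumes A: "A \<in> carrier (burnside_ring G)" and B: "B \<in> carrier (burnside_ring G)"
  shows "A \<oplus>\<^bsub>burnside_ring G\<^esub> B \<in> carrier (burnside_ring G)"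
    "subgroup K G \<Longrightarrow> bmark (A \<oplus>\<^bsub>burnside_ring G\<^esub> B) K = bmark A K + bmark B K"
proof -
  \<comment> \<open>The nested union is rewritten as one union over pairs of representatives, the
    shape that \<open>UN_gdiff\<close> takes.\<close>
  have eq: "A \<oplus>\<^bsub>burnside_ring G\<^esub> B = (\<Union>p \<in> A \<times> B.
      gdiff G (gset_sum (fst (fst p)) (fst (snd p))) (gset_sum (snd (fst p)) (snd (snd p))))"
    by (auto simp: burnside_ring_def burnside_add_def) force
  have ne: "A \<times> B \<noteq> {}" using A B burnside_ring_ne by auto
  note AB = burnside_ringD[OF A] burnside_ringD[OF B]
  have "A \<oplus>\<^bsub>burnside_ring G\<^esub> B \<in> carrier (burnside_ring G) \<and>
    (\<forall>K. subgroup K G \<longrightarrow> bmark (A \<oplus>\<^bsub>burnside_ring G\<^esub> B) K = bmark A K + bmark B K)"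
    unfolding eq
    by (rule UN_gdiff[OF ne])
      (auto simp: AB(1,2,5,6) fin_gset_sum mark_sum[of G] AB(4) AB(8))
  then show "A \<oplus>\<^bsub>burnside_ring G\<^esub> B \<in> carrier (burnside_ring G)"
    "subgroup K G \<Longrightarrow> bmark (A \<oplus>\<^bsub>burnside_ring G\<^esub> B) K = bmark A K + bmark B K" by auto
qed

lemma burnside_mult:
  assumes A: "A \<in> carrier (burnside_ring G)" and B: "B \<in> carrier (burnside_ring G)"
  shows "A \<otimes>\<^bsub>burnside_ring G\<^esub> B \<in> carrier (burnside_ring G)"
    "subgroup K G \<Longrightarrow> bmark (A \<otimes>\<^bsub>burnside_ring G\<^esub> B) K = bmark A K * bmark B K"
proof -
  have eq: "A \<otimes>\<^bsub>burnside_ring G\<^esub> B = (\<Union>p \<in> A \<times> B.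
      gdiff G (gset_sum (gset_prod (fst (fst p)) (fst (snd p))) (gset_prod (snd (fst p)) (snd (snd p))))
        (gset_sum (gset_prod (fst (fst p)) (snd (snd p))) (gset_prod (snd (fst p)) (fst (snd p)))))"
    by (auto simp: burnside_ring_def burnside_mult_def) force
  have ne: "A \<times> B \<noteq> {}" using A B burnside_ring_ne by auto
  note AB = burnside_ringD[OF A] burnside_ringD[OF B]
  have "A \<otimes>\<^bsub>burnside_ring G\<^esub> B \<in> carrier (burnside_ring G) \<and>
    (\<forall>K. subgroup K G \<longrightarrow> bmark (A \<otimes>\<^bsub>burnside_ring G\<^esub> B) K = bmark A K * bmark B K)"
    unfolding eq
    by (rule UN_gdiff[OF ne])
      (auto simp: AB(1,2,5,6) fin_gset_sum fin_gset_prod mark_sum[of G] mark_prod AB(4) AB(8) algebra_simps)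
  then show "A \<otimes>\<^bsub>burnside_ring G\<^esub> B \<in> carrier (burnside_ring G)"
    "subgroup K G \<Longrightarrow> bmark (A \<otimes>\<^bsub>burnside_ring G\<^esub> B) K = bmark A K * bmark B K" by auto
qed

lemma burnside_neg:
  assumes A: "A \<in> carrier (burnside_ring G)"
  obtains B where "B \<in> carrier (burnside_ring G)" "\<And>K. subgroup K G \<Longrightarrow> bmark B K = - bmark A K"
proof -
  obtain V W where "(V, W) \<in> A" using burnside_ring_ne[OF A] by auto
  note VW = burnside_ringD[OF A this]
  show ?thesis
    by (rule that[of "gdiff G W V"]) (use VW in \<open>simp_all add: gdiff_in_burnside_ring bmark_gdiff\<close>)
qed

lemma cring_burnside_ring: "cring (burnside_ring G)"
proof (rule cringI)
  show "abelian_group (burnside_ring G)"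
  proof (rule abelian_groupI)
    fix A assume "A \<in> carrier (burnside_ring G)"
    then show "\<exists>B \<in> carrier (burnside_ring G). B \<oplus>\<^bsub>burnside_ring G\<^esub> A = \<zero>\<^bsub>burnside_ring G\<^esub>"
    proof (rule burnside_neg)
      fix B assume "B \<in> carrier (burnside_ring G)" "\<And>K. subgroup K G \<Longrightarrow> bmark B K = - bmark A K"
      then show ?thesis using \<open>A \<in> _\<close>
        by (intro bexI[of _ B] burnside_eqI) (simp_all add: burnside_add burnside_zero)
    qed
  qed ((rule burnside_eqI)?; simp add: burnside_add burnside_zero)+
  show "comm_monoid (burnside_ring G)"
    by (rule comm_monoidI) ((rule burnside_eqI)?; simp add: burnside_mult burnside_one)+
qed ((rule burnside_eqI)?; simp add: burnside_mult burnside_add algebra_simps)+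

lemma bmark_conj_by:
  assumes A: "A \<in> carrier (burnside_ring G)" and "subgroup K G" "k \<in> carrier G"
  shows "bmark A (conj_by G k K) = bmark A K"
proof -
  obtain V W where "(V, W) \<in> A" using burnside_ring_ne[OF A] by auto
  note VW = burnside_ringD[OF A this]
  show ?thesis
    using VW assms subgroup.subset[OF assms(2)] subgroup_conj_by[OF assms(3,2)]
    by (simp add: mark_conj_by)
qed

end

locale finite_group_hom = G: finite_group G + H: finite_group H for G (structure) and H (structure) +
  fixes h
  assumes hom: "h \<in> hom G H"

sublocale finite_group_hom \<subseteq> group_hom G H h
  by unfold_locales (rule hom)

context finite_group_hom begin

lemma burnside_res:
  assumes A: "A \<in> carrier (burnside_ring H)"
  shows "burnside_res G h A \<in> carrier (burnside_ring G)"
    "subgroup K G \<Longrightarrow> bmark (burnside_res G h A) K = bmark A (h ` K)"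
proof -
  have eq: "burnside_res G h A = (\<Union>p \<in> A. gdiff G (gset_res h (fst p)) (gset_res h (snd p)))"
    by (auto simp: burnside_res_def)
  note D = H.burnside_ringD[OF A]
  have "burnside_res G h A \<in> carrier (burnside_ring G) \<and>
    (\<forall>K. subgroup K G \<longrightarrow> bmark (burnside_res G h A) K = bmark A (h ` K))"
    unfolding eq
    by (rule G.UN_gdiff[OF H.burnside_ring_ne[OF A]])
      (auto simp: D(1,2) D(4)[OF _ subgroup_img_is_subgroup] intro!: fin_gset_res[OF G.is_group hom] simp: mark_res)
  then show "burnside_res G h A \<in> carrier (burnside_ring G)"
    "subgroup K G \<Longrightarrow> bmark (burnside_res G h A) K = bmark A (h ` K)" by auto
qed

end

section \<open>Induction of Burnside rings\<close>

locale finite_group_inj = finite_group_hom +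
  assumes inj: "inj_on h (carrier G)"

text \<open>The marks of \<open>A\<close> moved to the subgroups of the image of \<open>h\<close>
  and extended by 0 to the other subgroups. Its values at the conjugates of \<open>K\<close> are the
  summands of the induction formula.\<close>

definition bmark_ext :: "('g, 'y) monoid_scheme \<Rightarrow> ('g \<Rightarrow> 'h) \<Rightarrow> 'g burnside \<Rightarrow> 'h set \<Rightarrow> int" where
  "bmark_ext G h A K = (if K \<subseteq> h ` carrier G then bmark A {g \<in> carrier G. h g \<in> K} else 0)"

context finite_group_inj begin

context
  fixes V :: "('a, 'e) gset"
  assumes V: "fin_gset G V"
begin

lemma ind_rel_iff:
  "((k, v), (k', v')) \<in> ind_rel G H h V \<longleftrightarrow>
    k' \<in> carrier H \<and> v \<in> fst V \<and> (\<exists>g \<in> carrier G. k = k' \<otimes>\<^bsub>H\<^esub> h g \<and> v' = snd V g v)"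
  by (auto simp: ind_rel_def)

text \<open>The pairs in \<open>ind_rel\<close> already form an equivalence relation, without
  passing to a closure: \<open>inv g\<close> reverses the step made by \<open>g\<close>, and
  consecutive steps by \<open>g\<close> and \<open>g'\<close> compose to one by the product.\<close>

lemma equiv_ind_rel: "equiv (carrier H \<times> fst V) (ind_rel G H h V)"
proof (rule equivI)
  show "ind_rel G H h V \<subseteq> (carrier H \<times> fst V) \<times> (carrier H \<times> fst V)"
    by (auto simp: ind_rel_def fin_gset_closed[OF V])
  show "refl_on (carrier H \<times> fst V) (ind_rel G H h V)"
    by (rule refl_onI) (auto simp: ind_rel_iff fin_gset_one[OF V] intro!: bexI[of _ \<one>])
  show "sym (ind_rel G H h V)"
  proof (rule symI, clarify)
    fix k v k' v' assume "((k, v), (k', v')) \<in> ind_rel G H h V"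
    then obtain g where *: "k' \<in> carrier H" "v \<in> fst V" "g \<in> carrier G"
      "k = k' \<otimes>\<^bsub>H\<^esub> h g" "v' = snd V g v" by (auto simp: ind_rel_iff)
    then have "k' = k \<otimes>\<^bsub>H\<^esub> h (inv g)" by (simp add: H.m_assoc)
    then show "((k', v'), (k, v)) \<in> ind_rel G H h V"
      using * fin_gset_inv(1)[OF V *(3,2)] fin_gset_closed[OF V]
      by (auto simp: ind_rel_iff intro!: bexI[of _ "inv g"])
  qed
  show "trans (ind_rel G H h V)"
  proof (rule transI, clarify)
    fix k v k' v' k'' v''
    assume "((k, v), (k', v')) \<in> ind_rel G H h V" "((k', v'), (k'', v'')) \<in> ind_rel G H h V"
    then obtain g g' where *: "k'' \<in> carrier H" "v \<in> fst V" "g \<in> carrier G" "g' \<in> carrier G"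
      "k = k'' \<otimes>\<^bsub>H\<^esub> h g' \<otimes>\<^bsub>H\<^esub> h g" "v'' = snd V g' (snd V g v)" by (auto simp: ind_rel_iff)
    then show "((k, v), (k'', v'')) \<in> ind_rel G H h V"
      by (auto simp: ind_rel_iff H.m_assoc fin_gset_mult[OF V] intro!: bexI[of _ "g' \<otimes> g"])
  qed
qed

text \<open>The classes are the orbits of \<open>G\<close> on H x V, where \<open>g\<close> sends
  (k, v) to (k h(g)^-1, g v).\<close>

lemma ind_class:
  assumes "k \<in> carrier H" "v \<in> fst V"
  shows "ind_rel G H h V `` {(k, v)} = (\<lambda>g. (k \<otimes>\<^bsub>H\<^esub> h (inv g), snd V g v)) ` carrier G"
proof -
  have *: "k = k' \<otimes>\<^bsub>H\<^esub> h g \<longleftrightarrow> k' = k \<otimes>\<^bsub>H\<^esub> h (inv g)"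
    if "k' \<in> carrier H" "g \<in> carrier G" for k' g
    using that assms by (auto simp: H.m_assoc)
  have "p \<in> ind_rel G H h V `` {(k, v)} \<longleftrightarrow>
    fst p \<in> carrier H \<and> (\<exists>g \<in> carrier G. k = fst p \<otimes>\<^bsub>H\<^esub> h g \<and> snd p = snd V g v)" for p
    using ind_rel_iff[of k v "fst p" "snd p"] assms by simp
  also have "\<dots> p \<longleftrightarrow> (\<exists>g \<in> carrier G. p = (k \<otimes>\<^bsub>H\<^esub> h (inv g), snd V g v))" for p
    using * assms by (auto simp: prod_eq_iff)
  finally show ?thesis by (auto simp: image_iff)
qed

text \<open>The action of \<open>G\<close> on H x V is free because \<open>h\<close> is injective,
  so all its orbits have the same size.\<close>

lemma card_ind_class:
  assumes "C \<in> (carrier H \<times> fst V) // ind_rel G H h V"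
  shows "card C = order G"
proof -
  obtain k v where kv: "k \<in> carrier H" "v \<in> fst V" "C = ind_rel G H h V `` {(k, v)}"
    using assms by (auto elim!: quotientE)
  have "inj_on (\<lambda>g. (k \<otimes>\<^bsub>H\<^esub> h (inv g), snd V g v)) (carrier G)"
  proof (rule inj_onI)
    fix g g' assume g: "g \<in> carrier G" "g' \<in> carrier G"
      and "(k \<otimes>\<^bsub>H\<^esub> h (inv g), snd V g v) = (k \<otimes>\<^bsub>H\<^esub> h (inv g'), snd V g' v)"
    then have "h (inv g) = h (inv g')" using kv by auto
    then show "g = g'" using inj g by (metis G.inv_closed G.inv_inv inj_onD)
  qed
  then show ?thesis unfolding kv(3) ind_class[OF kv(1,2)] order_def by (rule card_image)
qed

lemma ind_action:
  assumes "k \<in> carrier H" "v \<in> fst V" "l \<in> carrier H"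
  shows "(\<lambda>(k', v). (l \<otimes>\<^bsub>H\<^esub> k', v)) ` (ind_rel G H h V `` {(k, v)}) =
    ind_rel G H h V `` {(l \<otimes>\<^bsub>H\<^esub> k, v)}"
  using assms by (auto simp: ind_class image_image H.m_assoc)

lemma snd_gset_ind:
  assumes "k \<in> carrier H" "v \<in> fst V" "l \<in> carrier H"
  shows "snd (gset_ind G H h V) l (ind_rel G H h V `` {(k, v)}) =
    ind_rel G H h V `` {(l \<otimes>\<^bsub>H\<^esub> k, v)}"
  using ind_action[OF assms] assms by (auto simp: gset_ind_def quotientI)

lemma fin_gset_ind: "fin_gset H (gset_ind G H h V)"
proof -
  have *: "fst (gset_ind G H h V) = (\<lambda>(k, v). ind_rel G H h V `` {(k, v)}) ` (carrier H \<times> fst V)"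
    by (auto simp: gset_ind_def quotient_def image_iff)
  have "fin_gset H (fst (gset_ind G H h V), snd (gset_ind G H h V))"
  proof (rule fin_gsetI)
    show "finite (fst (gset_ind G H h V))"
      unfolding * using H.finite_carrier fin_gset_finite[OF V] by simp
    show "snd (gset_ind G H h V) l \<in> extensional (fst (gset_ind G H h V))" for l
      by (simp add: gset_ind_def)
  qed (auto simp: * snd_gset_ind H.m_assoc)
  then show ?thesis by simp
qed

text \<open>A double count of the pairs (k, v) whose class is fixed by \<open>K\<close>. They fill
  classes of size |G|. On the other hand, for given \<open>k\<close> the admissible \<open>v\<close>
  are the fixed points of the preimage of k^-1 K k, provided that this conjugate lies in the image
  of \<open>h\<close>.\<close>

lemma mark_ind:
  assumes K: "K \<subseteq> carrier H"
  shows "int (order G) * mark (gset_ind G H h V) K = (\<Sum>k \<in> carrier H.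
    if conj_by H k K \<subseteq> h ` carrier G
    then mark V {g \<in> carrier G. h g \<in> conj_by H k K} else 0)"
proof -
  let ?r = "ind_rel G H h V" and ?F = "fixpts (gset_ind G H h V) K"
  \<comment> \<open>The pairs to be counted, sorted by their first entry.\<close>
  define P where "P = (SIGMA k:{k \<in> carrier H. conj_by H k K \<subseteq> h ` carrier G}.
    fixpts V {g \<in> carrier G. h g \<in> conj_by H k K})"
  have quot: "?F \<subseteq> (carrier H \<times> fst V) // ?r" by (auto simp: fixpts_def gset_ind_def)
  have fin: "finite (carrier H \<times> fst V)" using H.finite_carrier fin_gset_finite[OF V] by simp
  have P_sub: "P \<subseteq> carrier H \<times> fst V" by (auto simp: P_def fixpts_def)
  have class_fix: "?r `` {(k, v)} \<in> ?F \<longleftrightarrow> (k, v) \<in> P" if kv: "k \<in> carrier H" "v \<in> fst V" for k v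
  proof -
    have "?r `` {(k, v)} \<in> ?F \<longleftrightarrow> (\<forall>l \<in> K. ?r `` {(l \<otimes>\<^bsub>H\<^esub> k, v)} = ?r `` {(k, v)})"
      using kv K snd_gset_ind[OF kv] by (auto simp: fixpts_def gset_ind_def quotientI subset_iff)
    also have "\<dots> \<longleftrightarrow> (\<forall>l \<in> K. ((l \<otimes>\<^bsub>H\<^esub> k, v), (k, v)) \<in> ?r)"
      using kv K by (intro ball_cong refl eq_equiv_class_iff[OF equiv_ind_rel]) auto
    \<comment> \<open>The class of (l k, v) equals that of (k, v) exactly if l k = k h(g) for some
      \<open>g\<close> that fixes \<open>v\<close>.\<close>
    also have "\<dots> \<longleftrightarrow> (\<forall>l \<in> K. \<exists>g \<in> carrier G. inv\<^bsub>H\<^esub> k \<otimes>\<^bsub>H\<^esub> l \<otimes>\<^bsub>H\<^esub> k = h g \<and> v = snd V g v)"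
    proof (intro ball_cong refl)
      fix l assume "l \<in> K"
      then have "l \<otimes>\<^bsub>H\<^esub> k = k \<otimes>\<^bsub>H\<^esub> h g \<longleftrightarrow> inv\<^bsub>H\<^esub> k \<otimes>\<^bsub>H\<^esub> l \<otimes>\<^bsub>H\<^esub> k = h g" if "g \<in> carrier G" for g
        using that kv K by (auto simp: H.m_assoc H.inv_solve_left' subset_iff)
      then show "((l \<otimes>\<^bsub>H\<^esub> k, v), (k, v)) \<in> ?r \<longleftrightarrow>
          (\<exists>g \<in> carrier G. inv\<^bsub>H\<^esub> k \<otimes>\<^bsub>H\<^esub> l \<otimes>\<^bsub>H\<^esub> k = h g \<and> v = snd V g v)"
        using kv by (auto simp: ind_rel_iff)
    qed
    also have "\<dots> \<longleftrightarrow> (\<forall>x \<in> conj_by H k K. \<exists>g \<in> carrier G. x = h g \<and> v = snd V g v)"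
      by (simp add: conj_by_def)
    also have "\<dots> \<longleftrightarrow> conj_by H k K \<subseteq> h ` carrier G \<and>
        (\<forall>g \<in> carrier G. h g \<in> conj_by H k K \<longrightarrow> snd V g v = v)"
      (is "(\<forall>x \<in> ?X. ?P x) \<longleftrightarrow> _")
    proof (intro iffI conjI subsetI ballI impI)
      fix x assume "\<forall>x \<in> ?X. ?P x" "x \<in> ?X"
      then show "x \<in> h ` carrier G" by blast
    next
      fix g assume "\<forall>x \<in> ?X. ?P x" "g \<in> carrier G" "h g \<in> ?X"
      then obtain g' where "g' \<in> carrier G" "h g = h g'" "v = snd V g' v" by blast
      then show "snd V g v = v" using inj \<open>g \<in> carrier G\<close> by (simp add: inj_on_eq_iff)
    next
      fix x
      assume *: "?X \<subseteq> h ` carrier G \<and> (\<forall>g \<in> carrier G. h g \<in> ?X \<longrightarrow> snd V g v = v)" "x \<in> ?X"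
      then obtain g where "g \<in> carrier G" "x = h g" by blast
      then show "?P x" using * by (intro bexI[of _ g]) auto
    qed
    also have "\<dots> \<longleftrightarrow> (k, v) \<in> P" using kv by (auto simp: P_def fixpts_def)
    finally show ?thesis .
  qed
  \<comment> \<open>Whether a class is fixed may be tested at any of its elements by
    \<open>class_fix\<close>, so \<open>P\<close> is a union of whole classes.\<close>
  have "\<Union>?F = P"
  proof (intro equalityI subsetI)
    fix p assume "p \<in> \<Union>?F"
    then obtain C where C: "C \<in> ?F" "p \<in> C" by blast
    then have Cq: "C \<in> (carrier H \<times> fst V) // ?r" using quot by blast
    have p: "p \<in> carrier H \<times> fst V"
      using C(2) in_quotient_imp_subset[OF equiv_ind_rel Cq] by (rule subsetD[rotated])
    obtain q where q: "C = ?r `` {q}" using Cq by (rule quotientE)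
    then have "(q, p) \<in> ?r" using C(2) by simp
    then have "C = ?r `` {p}" unfolding q by (rule equiv_class_eq[OF equiv_ind_rel])
    then show "p \<in> P" using class_fix[of "fst p" "snd p"] p C(1) by auto
  next
    fix p assume p: "p \<in> P"
    then have "p \<in> carrier H \<times> fst V" using P_sub by blast
    then show "p \<in> \<Union>?F" using class_fix[of "fst p" "snd p"] p equiv_class_self[OF equiv_ind_rel, of p]
      by (cases p) auto
  qed
  moreover have "order G * card ?F = card (\<Union>?F)"
  proof (rule card_partition)
    show "finite ?F" 
      by (rule finite_subset[OF quot finite_quotient[OF fin equiv_type[OF equiv_ind_rel]]])
    show "finite (\<Union>?F)" using \<open>\<Union>?F = P\<close> finite_subset[OF P_sub fin] by simp
    show "card C = order G" if "C \<in> ?F" for C using that quot card_ind_class by blast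
    show "C \<inter> C' = {}" if "C \<in> ?F" "C' \<in> ?F" "C \<noteq> C'" for C C'
      using that quot quotient_disj[OF equiv_ind_rel] by blast
  qed
  moreover have "card P = (\<Sum>k \<in> {k \<in> carrier H. conj_by H k K \<subseteq> h ` carrier G}.
      card (fixpts V {g \<in> carrier G. h g \<in> conj_by H k K}))"
    unfolding P_def using H.finite_carrier fin_gset_finite[OF V]
    by (intro card_SigmaI) (auto simp: fixpts_def)
  ultimately have "int (order G * card ?F) = (\<Sum>k \<in> {k \<in> carrier H. conj_by H k K \<subseteq> h ` carrier G}.
      mark V {g \<in> carrier G. h g \<in> conj_by H k K})"
    by (simp add: mark_def)
  then show ?thesis
    unfolding mark_def sum.inter_filter[OF H.finite_carrier] by simp
qed

end

lemma subgroup_vimage: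
  assumes "subgroup K H"
  shows "subgroup {g \<in> carrier G. h g \<in> K} G"
proof -
  interpret K: subgroup K H by fact
  show ?thesis by (rule G.subgroupI) (auto simp: intro!: exI[of _ \<one>])
qed

lemma order_pos: "order G > 0"
  using G.finite_carrier by (auto simp: order_def card_gt_0_iff)

text \<open>Each representative has the marks given by \<open>mark_ind\<close>, and subtracting the
  two components of a pair gives the formula for virtual sets.\<close>

lemma burnside_ind:
  assumes A: "A \<in> carrier (burnside_ring G)"
  shows "burnside_ind G H h A \<in> carrier (burnside_ring H)"
    "subgroup K H \<Longrightarrow> int (order G) * bmark (burnside_ind G H h A) K =
      (\<Sum>k \<in> carrier H. bmark_ext G h A (conj_by H k K))"
proof -
  let ?S = "\<lambda>K. \<Sum>k \<in> carrier H. bmark_ext G h A (conj_by H k K)"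
  have eq: "burnside_ind G H h A = (\<Union>p \<in> A. gdiff H (gset_ind G H h (fst p)) (gset_ind G H h (snd p)))"
    by (auto simp: burnside_ind_def)
  note D = G.burnside_ringD[OF A]
  have S: "?S K = int (order G) * (mark (gset_ind G H h V) K - mark (gset_ind G H h W) K)"
    if K: "subgroup K H" and VW: "(V, W) \<in> A" for V W K
  proof -
    have "?S K = (\<Sum>k \<in> carrier H. if conj_by H k K \<subseteq> h ` carrier G
      then mark V {g \<in> carrier G. h g \<in> conj_by H k K} - mark W {g \<in> carrier G. h g \<in> conj_by H k K} else 0)"
      using K by (intro sum.cong)
        (auto simp: bmark_ext_def D(4)[OF VW] subgroup_vimage H.subgroup_conj_by)
    also have "\<dots> = int (order G) * mark (gset_ind G H h V) K - int (order G) * mark (gset_ind G H h W) K"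
      unfolding mark_ind[OF D(1)[OF VW] subgroup.subset[OF K]] mark_ind[OF D(2)[OF VW] subgroup.subset[OF K]]
      unfolding sum_subtractf[symmetric] by (intro sum.cong) auto
    finally show ?thesis by (simp add: algebra_simps)
  qed
  \<comment> \<open>\<open>UN_gdiff\<close> asks for an explicit value of the mark. The division is
    exact, since \<open>S\<close> exhibits the sum as a multiple of \<open>order G\<close>.\<close>
  have "burnside_ind G H h A \<in> carrier (burnside_ring H) \<and>
    (\<forall>K. subgroup K H \<longrightarrow> bmark (burnside_ind G H h A) K = ?S K div int (order G))"
    unfolding eq
    by (rule H.UN_gdiff[OF G.burnside_ring_ne[OF A]])
      (use S order_pos in \<open>auto simp: D(1,2) fin_gset_ind\<close>)
  moreover obtain V W where "(V, W) \<in> A" using G.burnside_ring_ne[OF A] by auto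
  ultimately show "burnside_ind G H h A \<in> carrier (burnside_ring H)"
    "subgroup K H \<Longrightarrow> int (order G) * bmark (burnside_ind G H h A) K = ?S K"
    using S order_pos by auto
qed

lemma burnside_ind_eqI:
  assumes "A \<in> carrier (burnside_ring G)" "B \<in> carrier (burnside_ring H)"
    and "\<And>K. subgroup K H \<Longrightarrow>
      (\<Sum>k \<in> carrier H. bmark_ext G h A (conj_by H k K)) = int (order G) * bmark B K"
  shows "burnside_ind G H h A = B"
proof (rule H.burnside_eqI)
  fix K assume "subgroup K H"
  then have "int (order G) * bmark (burnside_ind G H h A) K = int (order G) * bmark B K"
    using burnside_ind(2)[OF assms(1)] assms(3) by simp
  then show "bmark (burnside_ind G H h A) K = bmark B K" using order_pos by simp
qed (use assms burnside_ind in auto)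

text \<open>Conjugation by h(g) preserves the image of \<open>h\<close> and corresponds to
  conjugation by \<open>g\<close> on preimages, where marks are invariant. As a consequence the
  summand of the induction formula depends on \<open>k\<close> only through the coset k
  h(G).\<close>

lemma bmark_ext_conj_by:
  assumes A: "A \<in> carrier (burnside_ring G)" and K: "subgroup K H" and g: "g \<in> carrier G"
  shows "bmark_ext G h A (conj_by H (h g) K) = bmark_ext G h A K"
proof -
  have "conj_by H (h g) K \<subseteq> h ` carrier G \<longleftrightarrow> K \<subseteq> h ` carrier G"
  proof -
    \<comment> \<open>One inclusion for all \<open>L\<close> and \<open>g\<close> is enough; the
      converse is its instance for the conjugate of \<open>K\<close> and
      \<open>inv g\<close>.\<close>
    have *: "conj_by H (h g) L \<subseteq> h ` carrier G" if L: "L \<subseteq> h ` carrier G" and "g \<in> carrier G" for L g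
    proof
      fix x assume "x \<in> conj_by H (h g) L"
      then obtain y where "y \<in> L" "x = inv\<^bsub>H\<^esub> (h g) \<otimes>\<^bsub>H\<^esub> y \<otimes>\<^bsub>H\<^esub> h g"
        by (auto simp: conj_by_def)
      moreover from this obtain a where "a \<in> carrier G" "y = h a"
        using L by (meson imageE subsetD)
      ultimately have "a \<in> carrier G" "x = inv\<^bsub>H\<^esub> (h g) \<otimes>\<^bsub>H\<^esub> h a \<otimes>\<^bsub>H\<^esub> h g" by simp_all
      then have "x = h (inv g \<otimes> a \<otimes> g)" using that by simp
      then show "x \<in> h ` carrier G" using \<open>a \<in> _\<close> that by blast
    qed
    show ?thesis
      using *[of K g] *[of "conj_by H (h g) K" "inv g"] g subgroup.subset[OF K]
      by (auto simp: H.conj_by_inv)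
  qed
  moreover have "{a \<in> carrier G. h a \<in> conj_by H (h g) K} = conj_by G g {a \<in> carrier G. h a \<in> K}"
  proof (intro equalityI subsetI)
    fix a assume a: "a \<in> {a \<in> carrier G. h a \<in> conj_by H (h g) K}"
    then obtain x where x: "x \<in> K" "h a = inv\<^bsub>H\<^esub> (h g) \<otimes>\<^bsub>H\<^esub> x \<otimes>\<^bsub>H\<^esub> h g" by (auto simp: conj_by_def)
    have xc: "x \<in> carrier H" using subgroup.subset[OF K] x by blast
    have "h (g \<otimes> a \<otimes> inv g) = x"
      using x(2) a g xc by (simp add: H.m_assoc) (simp add: H.m_assoc[symmetric])
    then have "g \<otimes> a \<otimes> inv g \<in> {a \<in> carrier G. h a \<in> K}" using x a g by simp
    moreover have "a = inv g \<otimes> (g \<otimes> a \<otimes> inv g) \<otimes> g"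
      using a g by (simp add: G.m_assoc) (simp add: G.m_assoc[symmetric])
    ultimately show "a \<in> conj_by G g {a \<in> carrier G. h a \<in> K}" unfolding conj_by_def by blast
  next
    fix a assume "a \<in> conj_by G g {a \<in> carrier G. h a \<in> K}"
    then show "a \<in> {a \<in> carrier G. h a \<in> conj_by H (h g) K}"
      using g by (auto simp: conj_by_def)
  qed
  ultimately show ?thesis
    using G.bmark_conj_by[OF A subgroup_vimage[OF K] g] by (simp add: bmark_ext_def)
qed

end

section \<open>Functoriality, conjugation invariance and Frobenius reciprocity\<close>

lemma (in finite_group) sum_mult_right:
  fixes f :: "'a \<Rightarrow> 'c :: comm_monoid_add"
  assumes "c \<in> carrier G"
  shows "(\<Sum>k \<in> carrier G. f (k \<otimes> c)) = (\<Sum>k \<in> carrier G. f k)"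
proof (rule sum.reindex_bij_betw)
  show "bij_betw (\<lambda>k. k \<otimes> c) (carrier G) (carrier G)"
    by (rule bij_betwI[where g="\<lambda>k. k \<otimes> inv c"]) (use assms in \<open>auto simp: m_assoc\<close>)
qed

lemma (in finite_group_hom) image_conj_by:
  assumes "g \<in> carrier G" "K \<subseteq> carrier G"
  shows "h ` conj_by G g K = conj_by H (h g) (h ` K)"
  using assms by (force simp: conj_by_def image_image subset_iff intro!: image_cong)

lemma (in finite_group_hom) burnside_res_eqI:
  assumes "A \<in> carrier (burnside_ring H)" "B \<in> carrier (burnside_ring G)"
    and "\<And>K. subgroup K G \<Longrightarrow> bmark A (h ` K) = bmark B K"
  shows "burnside_res G h A = B"
  by (rule G.burnside_eqI) (use assms in \<open>simp_all add: burnside_res\<close>)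

lemma (in finite_group_hom) burnside_res_ring_hom:
  "burnside_res G h \<in> ring_hom (burnside_ring H) (burnside_ring G)"
  by (rule ring_hom_memI; (rule burnside_res_eqI)?;
      simp add: burnside_res H.burnside_mult G.burnside_mult H.burnside_add G.burnside_add
        H.burnside_one G.burnside_one subgroup_img_is_subgroup)

lemma burnside_res_comp:
  assumes "finite_group_hom G H h" "finite_group_hom H L l" "finite_group_hom G L f"
    and f: "\<And>g. g \<in> carrier G \<Longrightarrow> f g = l (h g)" and A: "A \<in> carrier (burnside_ring L)"
  shows "burnside_res G f A = burnside_res G h (burnside_res H l A)"
proof -
  interpret h: finite_group_hom G H h by fact
  interpret l: finite_group_hom H L l by fact
  interpret f: finite_group_hom G L f by fact
  show ?thesis
  proof (rule f.burnside_res_eqI)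
    fix K assume K: "subgroup K G"
    have "f ` K = l ` h ` K"
      unfolding image_image using subgroup.subset[OF K] by (intro image_cong) (auto simp: f)
    then show "bmark A (f ` K) = bmark (burnside_res G h (burnside_res H l A)) K"
      using K A by (simp add: h.burnside_res l.burnside_res h.subgroup_img_is_subgroup)
  qed (simp_all add: A h.burnside_res l.burnside_res)
qed

text \<open>Marks are constant on conjugacy classes. Since 2-isomorphic morphisms of partitions
  induce conjugate homomorphisms, this makes restriction well defined on 2-isomorphism
  classes.\<close>

lemma burnside_res_conj:
  assumes "finite_group_hom G H h" "finite_group_hom G H h'" and t: "t \<in> carrier H"
    and h': "\<And>g. g \<in> carrier G \<Longrightarrow> h' g = inv\<^bsub>H\<^esub> t \<otimes>\<^bsub>H\<^esub> h g \<otimes>\<^bsub>H\<^esub> t"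
    and A: "A \<in> carrier (burnside_ring H)"
  shows "burnside_res G h' A = burnside_res G h A"
proof -
  interpret h: finite_group_hom G H h by fact
  interpret h': finite_group_hom G H h' by fact
  show ?thesis
  proof (rule h'.burnside_res_eqI)
    fix K assume K: "subgroup K G"
    have "h' ` K = conj_by H t (h ` K)"
      unfolding conj_by_def image_image using subgroup.subset[OF K] by (intro image_cong) (auto simp: h')
    then show "bmark A (h' ` K) = bmark (burnside_res G h A) K"
      using K A t by (simp add: h.burnside_res h.H.bmark_conj_by h.subgroup_img_is_subgroup)
  qed (simp_all add: A h.burnside_res)
qed

lemma (in finite_group_inj) bmark_ext_add:
  assumes "A \<in> carrier (burnside_ring G)" "B \<in> carrier (burnside_ring G)" "subgroup K H"
  shows "bmark_ext G h (A \<oplus>\<^bsub>burnside_ring G\<^esub> B) K = bmark_ext G h A K + bmark_ext G h B K"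
  using assms by (simp add: bmark_ext_def G.burnside_add subgroup_vimage)

lemma (in finite_group_inj) burnside_ind_add:
  assumes "A \<in> carrier (burnside_ring G)" "B \<in> carrier (burnside_ring G)"
  shows "burnside_ind G H h (A \<oplus>\<^bsub>burnside_ring G\<^esub> B) =
    burnside_ind G H h A \<oplus>\<^bsub>burnside_ring H\<^esub> burnside_ind G H h B"
  by (rule burnside_ind_eqI)
    (use assms in \<open>auto simp: burnside_ind H.burnside_add G.burnside_add bmark_ext_add
      H.subgroup_conj_by sum.distrib algebra_simps\<close>)

lemma (in finite_group_inj) frobenius_reciprocity:
  assumes A: "A \<in> carrier (burnside_ring H)" and B: "B \<in> carrier (burnside_ring G)"
  shows "burnside_ind G H h (burnside_res G h A \<otimes>\<^bsub>burnside_ring G\<^esub> B) =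
    A \<otimes>\<^bsub>burnside_ring H\<^esub> burnside_ind G H h B"
proof (rule burnside_ind_eqI)
  fix K assume K: "subgroup K H"
  have "bmark_ext G h (burnside_res G h A \<otimes>\<^bsub>burnside_ring G\<^esub> B) (conj_by H k K) =
      bmark A K * bmark_ext G h B (conj_by H k K)" if k: "k \<in> carrier H" for k
  proof (cases "conj_by H k K \<subseteq> h ` carrier G")
    case True
    then have "h ` {g \<in> carrier G. h g \<in> conj_by H k K} = conj_by H k K" by auto
    then show ?thesis using True A B K k
      by (simp add: bmark_ext_def G.burnside_mult burnside_res subgroup_vimage H.subgroup_conj_by
          H.bmark_conj_by)
  qed (simp add: bmark_ext_def)
  then have "(\<Sum>k \<in> carrier H. bmark_ext G h (burnside_res G h A \<otimes>\<^bsub>burnside_ring G\<^esub> B) (conj_by H k K)) =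
      bmark A K * (int (order G) * bmark (burnside_ind G H h B) K)"
    using B K by (simp add: burnside_ind sum_distrib_left)
  then show "(\<Sum>k \<in> carrier H. bmark_ext G h (burnside_res G h A \<otimes>\<^bsub>burnside_ring G\<^esub> B) (conj_by H k K)) =
      int (order G) * bmark (A \<otimes>\<^bsub>burnside_ring H\<^esub> burnside_ind G H h B) K"
    using A B K by (simp add: H.burnside_mult burnside_ind)
qed (use assms in \<open>simp_all add: G.burnside_mult H.burnside_mult burnside_res burnside_ind\<close>)

lemma image_subset_image_iff:
  assumes "inj_on f C" "A \<subseteq> C" "B \<subseteq> C"
  shows "f ` A \<subseteq> f ` B \<longleftrightarrow> A \<subseteq> B"
proof
  assume *: "f ` A \<subseteq> f ` B"
  show "A \<subseteq> B"
  proof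
    fix a assume "a \<in> A"
    then show "a \<in> B" using * inj_on_image_mem_iff[OF assms(1) _ assms(3), of a] assms(2) by auto
  qed
qed auto

text \<open>Inserting one induction formula into the other gives a double sum over \<open>k\<close>
  and \<open>j\<close> of a summand that depends only on the product of \<open>k\<close> and
  \<open>l j\<close>. For each \<open>j\<close> a translation of \<open>k\<close> removes this
  dependence, and the resulting factor \<open>order H\<close> cancels.\<close>

lemma burnside_ind_comp:
  assumes "finite_group_inj G H h" "finite_group_inj H L l" "finite_group_inj G L f"
    and f: "\<And>g. g \<in> carrier G \<Longrightarrow> f g = l (h g)" and A: "A \<in> carrier (burnside_ring G)"
  shows "burnside_ind G L f A = burnside_ind H L l (burnside_ind G H h A)"
proof -
  interpret h: finite_group_inj G H h by fact
  interpret l: finite_group_inj H L l by fact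
  interpret f: finite_group_inj G L f by fact
  have f_img: "f ` carrier G = l ` h ` carrier G"
    unfolding image_image by (intro image_cong) (auto simp: f)
  \<comment> \<open>The summand of the inner induction, extended by 0 along \<open>l\<close>, is a
    summand of the induction along \<open>f\<close>. If \<open>Q\<close> is outside the image of
    \<open>l\<close>, then so is its conjugate by \<open>l j\<close>, and both sides vanish.\<close>
  have step: "(if Q \<subseteq> l ` carrier H then bmark_ext G h A (conj_by H j {x \<in> carrier H. l x \<in> Q}) else 0) =
      bmark_ext G f A (conj_by L (l j) Q)" if Q: "subgroup Q L" and j: "j \<in> carrier H" for Q j
  proof (cases "Q \<subseteq> l ` carrier H")
    case False
    have "\<not> conj_by L (l j) Q \<subseteq> f ` carrier G"
    proof
      assume "conj_by L (l j) Q \<subseteq> f ` carrier G"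
      then have *: "conj_by L (l j) Q \<subseteq> l ` carrier H" unfolding f_img by auto
      have "Q \<subseteq> l ` carrier H"
      proof
        fix x assume x: "x \<in> Q"
        then have xc: "x \<in> carrier L" using subgroup.subset[OF Q] by blast
        obtain y where y: "y \<in> carrier H" "inv\<^bsub>L\<^esub> (l j) \<otimes>\<^bsub>L\<^esub> x \<otimes>\<^bsub>L\<^esub> l j = l y"
          using * x by (auto simp: conj_by_def)
        have "x = l j \<otimes>\<^bsub>L\<^esub> (inv\<^bsub>L\<^esub> (l j) \<otimes>\<^bsub>L\<^esub> x \<otimes>\<^bsub>L\<^esub> l j) \<otimes>\<^bsub>L\<^esub> inv\<^bsub>L\<^esub> (l j)"
          using xc j by (simp add: l.H.m_assoc) (simp add: l.H.m_assoc[symmetric])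
        also have "\<dots> = l (j \<otimes>\<^bsub>H\<^esub> y \<otimes>\<^bsub>H\<^esub> inv\<^bsub>H\<^esub> j)" using y j by simp
        finally show "x \<in> l ` carrier H" using j y(1) by blast
      qed
      with False show False by simp
    qed
    with False show ?thesis by (simp add: bmark_ext_def)
  next
    case True
    define Y where "Y = {x \<in> carrier H. l x \<in> Q}"
    have Y: "Y \<subseteq> carrier H" by (auto simp: Y_def)
    have lY: "l ` Y = Q" using True by (auto simp: Y_def)
    have conj: "conj_by L (l j) Q = l ` conj_by H j Y" using l.image_conj_by[OF j Y] lY by simp
    have cY: "conj_by H j Y \<subseteq> carrier H" using Y j h.H.conj_by_closed by blast
    have "l ` conj_by H j Y \<subseteq> f ` carrier G \<longleftrightarrow> conj_by H j Y \<subseteq> h ` carrier G"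
      unfolding f_img by (rule image_subset_image_iff[OF l.inj cY]) auto
    moreover have "{g \<in> carrier G. f g \<in> l ` conj_by H j Y} = {g \<in> carrier G. h g \<in> conj_by H j Y}"
      by (intro Collect_cong conj_cong refl) (simp add: f inj_on_image_mem_iff[OF l.inj _ cY])
    ultimately show ?thesis using True by (simp add: bmark_ext_def conj Y_def[symmetric])
  qed
  have ext: "int (order G) * bmark_ext H l (burnside_ind G H h A) Q =
      (\<Sum>j \<in> carrier H. bmark_ext G f A (conj_by L (l j) Q))" if Q: "subgroup Q L" for Q
  proof -
    have "int (order G) * bmark_ext H l (burnside_ind G H h A) Q =
      (\<Sum>j \<in> carrier H. if Q \<subseteq> l ` carrier H then bmark_ext G h A (conj_by H j {x \<in> carrier H. l x \<in> Q}) else 0)"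
      using h.burnside_ind(2)[OF A l.subgroup_vimage[OF Q]] by (simp add: bmark_ext_def[of H])
    then show ?thesis using step[OF Q] by simp
  qed
  show ?thesis
  proof (rule f.burnside_ind_eqI)
    fix K assume K: "subgroup K L"
    let ?E = "\<lambda>k. bmark_ext G f A (conj_by L k K)"
    have "int (order H) * (int (order G) * bmark (burnside_ind H L l (burnside_ind G H h A)) K) =
        int (order G) * (\<Sum>k \<in> carrier L. bmark_ext H l (burnside_ind G H h A) (conj_by L k K))"
      using l.burnside_ind(2)[OF h.burnside_ind(1)[OF A] K] by simp
    also have "\<dots> = (\<Sum>k \<in> carrier L. \<Sum>j \<in> carrier H. ?E (k \<otimes>\<^bsub>L\<^esub> l j))"
      unfolding sum_distrib_left
      by (intro sum.cong refl) (simp add: ext l.H.subgroup_conj_by K l.H.conj_by_mult subgroup.subset)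
    also have "\<dots> = (\<Sum>j \<in> carrier H. \<Sum>k \<in> carrier L. ?E (k \<otimes>\<^bsub>L\<^esub> l j))" by (rule sum.swap)
    also have "\<dots> = int (order H) * (\<Sum>k \<in> carrier L. ?E k)"
      \<comment> \<open>For each \<open>j\<close>, right translation by \<open>l j\<close> permutes
        \<open>carrier L\<close>, so all inner sums agree.\<close>
      using l.H.sum_mult_right[of "l _" ?E] by (simp add: order_def)
    finally show "(\<Sum>k \<in> carrier L. ?E k) =
        int (order G) * bmark (burnside_ind H L l (burnside_ind G H h A)) K"
      using l.order_pos by simp
  qed (simp_all add: A h.burnside_ind l.burnside_ind)
qed

text \<open>The summand for \<open>h'\<close> at t^-1 Q t is the summand for \<open>h\<close> at
  \<open>Q\<close>; translating the summation variable by \<open>t\<close> matches the two sums.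
  This is the counterpart of \<open>burnside_res_conj\<close> for transfers.\<close>

lemma burnside_ind_conj:
  assumes "finite_group_inj G H h" "finite_group_inj G H h'" and t: "t \<in> carrier H"
    and h': "\<And>g. g \<in> carrier G \<Longrightarrow> h' g = inv\<^bsub>H\<^esub> t \<otimes>\<^bsub>H\<^esub> h g \<otimes>\<^bsub>H\<^esub> t"
    and A: "A \<in> carrier (burnside_ring G)"
  shows "burnside_ind G H h' A = burnside_ind G H h A"
proof -
  interpret h: finite_group_inj G H h by fact
  interpret h': finite_group_inj G H h' by fact
  have inj: "inj_on (\<lambda>x. inv\<^bsub>H\<^esub> t \<otimes>\<^bsub>H\<^esub> x \<otimes>\<^bsub>H\<^esub> t) (carrier H)"
    by (rule inj_onI) (use t in auto)
  have ext: "bmark_ext G h' A (conj_by H t Q) = bmark_ext G h A Q" if Q: "Q \<subseteq> carrier H" for Q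
  proof -
    have "h' ` carrier G = conj_by H t (h ` carrier G)"
      unfolding conj_by_def image_image by (intro image_cong) (auto simp: h')
    moreover have "h ` carrier G \<subseteq> carrier H" by auto
    ultimately have "conj_by H t Q \<subseteq> h' ` carrier G \<longleftrightarrow> Q \<subseteq> h ` carrier G"
      using image_subset_image_iff[OF inj Q] by (simp only: conj_by_def)
    moreover have "{g \<in> carrier G. h' g \<in> conj_by H t Q} = {g \<in> carrier G. h g \<in> Q}"
      unfolding conj_by_def
      by (intro Collect_cong conj_cong refl) (simp add: h' inj_on_image_mem_iff[OF inj _ Q])
    ultimately show ?thesis by (simp add: bmark_ext_def)
  qed
  show ?thesis
  proof (rule h'.burnside_ind_eqI)
    fix K assume K: "subgroup K H"
    have "(\<Sum>k \<in> carrier H. bmark_ext G h' A (conj_by H k K)) =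
        (\<Sum>k \<in> carrier H. bmark_ext G h' A (conj_by H (k \<otimes>\<^bsub>H\<^esub> t) K))"
      by (rule h.H.sum_mult_right[OF t, symmetric])
    also have "\<dots> = (\<Sum>k \<in> carrier H. bmark_ext G h A (conj_by H k K))"
      using t subgroup.subset[OF K] by (intro sum.cong refl) (simp add: h.H.conj_by_mult ext h.H.conj_by_closed)
    finally show "(\<Sum>k \<in> carrier H. bmark_ext G h' A (conj_by H k K)) =
        int (order G) * bmark (burnside_ind G H h A) K"
      using A K by (simp add: h.burnside_ind)
  qed (simp_all add: A h.burnside_ind)
qed

text \<open>For a bijective \<open>h\<close> the support condition always holds and, by invariance
  under conjugation, all summands are equal. Their number is the order by which the formula is
  scaled.\<close>

lemma burnside_ind_iso:
  assumes "finite_group_inj G H h" "finite_group_hom H G h'"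
    and surj: "h ` carrier G = carrier H" and h': "\<And>g. g \<in> carrier G \<Longrightarrow> h' (h g) = g"
    and A: "A \<in> carrier (burnside_ring G)"
  shows "burnside_ind G H h A = burnside_res H h' A"
proof -
  interpret h: finite_group_inj G H h by fact
  interpret h': finite_group_hom H G h' by fact
  have vimage: "{g \<in> carrier G. h g \<in> Q} = h' ` Q" if "Q \<subseteq> carrier H" for Q
  proof (intro equalityI subsetI)
    fix g assume "g \<in> {g \<in> carrier G. h g \<in> Q}"
    then show "g \<in> h' ` Q" by (intro image_eqI[of _ _ "h g"]) (simp_all add: h')
  next
    fix g assume "g \<in> h' ` Q"
    then obtain q where q: "q \<in> Q" "g = h' q" by (meson imageE)
    then have "q \<in> h ` carrier G" using that surj by auto
    then obtain g0 where "g0 \<in> carrier G" "q = h g0" by (rule imageE)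
    then show "g \<in> {g \<in> carrier G. h g \<in> Q}" using q h' by simp
  qed
  show ?thesis
  proof (rule h.burnside_ind_eqI)
    fix K assume K: "subgroup K H"
    have "bmark_ext G h A (conj_by H k K) = bmark A (h' ` K)" if k: "k \<in> carrier H" for k
      using k subgroup.subset[OF K] surj A
      by (simp add: bmark_ext_def vimage h.H.conj_by_closed h'.image_conj_by h.G.bmark_conj_by
          h'.subgroup_img_is_subgroup[OF K])
    moreover have "order H = order G"
      using card_image[OF h.inj] surj by (simp add: order_def)
    ultimately show "(\<Sum>k \<in> carrier H. bmark_ext G h A (conj_by H k K)) =
        int (order G) * bmark (burnside_res H h' A) K"
      using K A by (simp add: h'.burnside_res order_def)
  qed (simp_all add: A h'.burnside_res)
qed

section \<open>Coset sets as induced one-point sets\<close>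

lemma fin_gset_cosets:
  fixes G (structure)
  assumes "finite_group G" "subgroup S G"
  shows "fin_gset G (gset_cosets G S)"
proof -
  interpret finite_group G by fact
  have S: "S \<subseteq> carrier G" using assms subgroup.subset by blast
  have *: "lcosets S = (\<lambda>k. k <# S) ` carrier G" by (auto simp: LCOSETS_def)
  show ?thesis
    unfolding gset_cosets_def
    by (rule fin_gsetI)
      (auto simp: * finite_carrier lcos_m_assoc S lcos_mult_one is_group m_assoc)
qed

text \<open>The coset of \<open>k\<close> is fixed by \<open>K\<close> exactly if k^-1 K k lies in
  \<open>S\<close>, and the elements \<open>k\<close> with this property fill whole cosets of
  \<open>S\<close>.\<close>

lemma (in finite_group) mark_cosets:
  assumes S: "subgroup S G" and K: "K \<subseteq> carrier G"
  shows "int (card S) * mark (gset_cosets G S) K = int (card {k \<in> carrier G. conj_by G k K \<subseteq> S})"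
proof -
  interpret S: subgroup S G by fact
  let ?F = "fixpts (gset_cosets G S) K"
  have sub: "?F \<subseteq> lcosets S" by (auto simp: fixpts_def gset_cosets_def)
  have mem_iff: "y \<in> k <# S \<longleftrightarrow> inv k \<otimes> y \<in> S" if "k \<in> carrier G" "y \<in> carrier G" for k y
  proof
    assume "inv k \<otimes> y \<in> S"
    moreover have "y = k \<otimes> (inv k \<otimes> y)" using that by (simp add: m_assoc[symmetric])
    ultimately show "y \<in> k <# S" unfolding l_coset_def by blast
  next
    assume "y \<in> k <# S"
    then obtain s where "s \<in> S" "y = k \<otimes> s" by (auto simp: l_coset_def)
    then show "inv k \<otimes> y \<in> S" using that by (simp add: m_assoc[symmetric])
  qed
  have eq_iff: "y <# S = k <# S \<longleftrightarrow> inv k \<otimes> y \<in> S" if "k \<in> carrier G" "y \<in> carrier G" for k y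
    using that mem_iff[OF that] l_repr_independence[OF _ _ S, of y k] mem_iff[OF that(2,2)] by auto
  have fix_iff: "k <# S \<in> ?F \<longleftrightarrow> conj_by G k K \<subseteq> S" if k: "k \<in> carrier G" for k
  proof -
    have "k <# S \<in> ?F \<longleftrightarrow> (\<forall>x \<in> K. (x \<otimes> k) <# S = k <# S)"
      using k K by (auto simp: fixpts_def gset_cosets_def LCOSETS_def lcos_m_assoc S.subset subset_iff)
    also have "\<dots> \<longleftrightarrow> (\<forall>x \<in> K. inv k \<otimes> (x \<otimes> k) \<in> S)"
      using k K by (intro ball_cong refl eq_iff) auto
    also have "\<dots> \<longleftrightarrow> conj_by G k K \<subseteq> S"
      using k K by (auto simp: conj_by_def m_assoc subset_iff)
    finally show ?thesis .
  qed
  have "\<Union>?F = {k \<in> carrier G. conj_by G k K \<subseteq> S}"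
  proof (intro equalityI subsetI)
    fix k assume "k \<in> \<Union>?F"
    then obtain C where C: "C \<in> ?F" "k \<in> C" by blast
    then obtain j where j: "j \<in> carrier G" "C = j <# S" using sub by (auto simp: LCOSETS_def)
    then have "k \<in> carrier G" using C(2) l_coset_subset_G[OF S.subset] by blast
    moreover have "C = k <# S" using j C(2) l_repr_independence[OF _ _ S] by metis
    ultimately show "k \<in> {k \<in> carrier G. conj_by G k K \<subseteq> S}" using C(1) fix_iff by auto
  next
    fix k assume "k \<in> {k \<in> carrier G. conj_by G k K \<subseteq> S}"
    then show "k \<in> \<Union>?F" using fix_iff mem_iff[of k k] by auto
  qed
  moreover have "card S * card ?F = card (\<Union>?F)"
  proof (rule card_partition)
    show "finite (\<Union>?F)" using \<open>\<Union>?F = _\<close> finite_carrier by simp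
    then show "finite ?F" by (rule finite_UnionD)
    show "card C = card S" if "C \<in> ?F" for C
      using that sub l_card_cosets_equal[OF _ S.subset finite_carrier] by auto
    show "C \<inter> C' = {}" if "C \<in> ?F" "C' \<in> ?F" "C \<noteq> C'" for C C'
      using that sub lcos_disjoint[OF S] by blast
  qed
  ultimately have "card S * card ?F = card {k \<in> carrier G. conj_by G k K \<subseteq> S}" by simp
  then show ?thesis by (simp only: mark_def of_nat_mult[symmetric])
qed

text \<open>Inducing a one-point set gives the cosets of the image. No isomorphism is written down:
  the scaled marks of both sides count the \<open>k\<close> with k^-1 K k inside the image. This
  identifies the generators of A as transfers of 1.\<close>

lemma (in finite_group_inj) burnside_ind_one:
  "burnside_ind G H h \<one>\<^bsub>burnside_ring G\<^esub> = gclass H (gset_cosets H (h ` carrier G))"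
proof (rule burnside_ind_eqI)
  have S: "subgroup (h ` carrier G) H" by (rule img_is_subgroup)
  note fin = fin_gset_cosets[OF H.finite_group_axioms S]
  show "gclass H (gset_cosets H (h ` carrier G)) \<in> carrier (burnside_ring H)"
    using H.gclass fin by blast
  fix K assume K: "subgroup K H"
  have "(\<Sum>k \<in> carrier H. bmark_ext G h \<one>\<^bsub>burnside_ring G\<^esub> (conj_by H k K)) =
    (\<Sum>k \<in> carrier H. if conj_by H k K \<subseteq> h ` carrier G then 1 else 0)"
    by (intro sum.cong refl)
      (simp add: bmark_ext_def G.burnside_one subgroup_vimage H.subgroup_conj_by K)
  also have "\<dots> = int (card {k \<in> carrier H. conj_by H k K \<subseteq> h ` carrier G})"
    using H.finite_carrier by (simp add: sum.inter_filter[symmetric])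
  also have "\<dots> = int (order G) * bmark (gclass H (gset_cosets H (h ` carrier G))) K"
    using H.mark_cosets[OF S subgroup.subset[OF K]] H.gclass(2)[OF fin K] card_image[OF inj]
    by (simp add: order_def)
  finally show "(\<Sum>k \<in> carrier H. bmark_ext G h \<one>\<^bsub>burnside_ring G\<^esub> (conj_by H k K)) =
    int (order G) * bmark (gclass H (gset_cosets H (h ` carrier G))) K" .
qed (rule G.burnside_one)

section \<open>Double cosets and the double coset formula for marks\<close>

lemma (in group) double_coset_iff:
  "x \<in> A <#> (s <# B) \<longleftrightarrow> (\<exists>a \<in> A. \<exists>b \<in> B. x = a \<otimes> (s \<otimes> b))"
  by (auto simp: set_mult_def l_coset_def)

lemma (in group) double_cosets_partition:
  assumes "subgroup A G" "subgroup B G"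
  shows "\<Union>(double_cosets G A B) = carrier G"
    "\<And>D D'. D \<in> double_cosets G A B \<Longrightarrow> D' \<in> double_cosets G A B \<Longrightarrow> D \<noteq> D' \<Longrightarrow> D \<inter> D' = {}"
    "\<And>D s. D \<in> double_cosets G A B \<Longrightarrow> s \<in> D \<Longrightarrow> s \<in> carrier G \<and> D = A <#> (s <# B)"
proof -
  interpret A: subgroup A G by fact
  interpret B: subgroup B G by fact
  have sub: "A <#> (s <# B) \<subseteq> carrier G" if "s \<in> carrier G" for s
    using that by (auto simp: double_coset_iff)
  have self: "s \<in> A <#> (s <# B)" if "s \<in> carrier G" for s
    unfolding double_coset_iff using that by (intro bexI[of _ \<one>]) auto
  have mono: "A <#> (x <# B) \<subseteq> A <#> (s <# B)"
    if s: "s \<in> carrier G" and x: "x \<in> A <#> (s <# B)" for s x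
  proof
    fix y assume "y \<in> A <#> (x <# B)"
    then obtain a b a' b' where "a \<in> A" "b \<in> B" "a' \<in> A" "b' \<in> B"
      "y = a \<otimes> (a' \<otimes> (s \<otimes> b') \<otimes> b)" using x by (auto simp: double_coset_iff)
    then show "y \<in> A <#> (s <# B)"
      unfolding double_coset_iff using s
      by (intro bexI[of _ "a \<otimes> a'"] bexI[of _ "b' \<otimes> b"]) (auto simp: m_assoc)
  qed
  have eq: "A <#> (s <# B) = A <#> (x <# B)" if s: "s \<in> carrier G" and x: "x \<in> A <#> (s <# B)" for s x
  proof
    show "A <#> (x <# B) \<subseteq> A <#> (s <# B)" by (rule mono[OF s x])
    obtain a b where ab: "a \<in> A" "b \<in> B" "x = a \<otimes> (s \<otimes> b)" using x by (auto simp: double_coset_iff)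
    have "s = inv a \<otimes> (x \<otimes> inv b)"
      using ab s by (simp add: m_assoc) (simp add: m_assoc[symmetric])
    then have "s \<in> A <#> (x <# B)" unfolding double_coset_iff using ab by blast
    then show "A <#> (s <# B) \<subseteq> A <#> (x <# B)" using mono[of x s] x sub[OF s] by blast
  qed
  show "\<Union>(double_cosets G A B) = carrier G"
    using sub self by (auto simp: double_cosets_def)
  show "s \<in> carrier G \<and> D = A <#> (s <# B)" if D: "D \<in> double_cosets G A B" and sD: "s \<in> D" for D s
  proof -
    obtain s0 where s0: "s0 \<in> carrier G" "D = A <#> (s0 <# B)"
      using D by (auto simp: double_cosets_def)
    then show ?thesis using sD sub[OF s0(1)] eq[OF s0(1), of s] by auto
  qed
  then show "D \<inter> D' = {}"
    if "D \<in> double_cosets G A B" "D' \<in> double_cosets G A B" "D \<noteq> D'" for D D'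
    using that by blast
qed

text \<open>
  A pullback of \<open>h1\<close> and the \<open>s\<close>-conjugate of \<open>h2\<close>. The fibres of the map \<open>(g, b) \<mapsto> h1(g) s h2(b)\<close> onto
  a double coset are torsors under the pullback, so summing over the double coset amounts to summing
  over \<open>g\<close>, up to the orders of the groups involved.
\<close>

locale conj_pullback =
  h1: finite_group_inj G1 H h1 + h2: finite_group_inj G2 H h2 +
  p: finite_group_inj C G1 p + q: finite_group_inj C G2 q
  for G1 (structure) and G2 (structure) and H (structure) and C (structure) and h1 h2 p q +
  fixes s
  assumes s: "s \<in> carrier H"
    and comm: "c \<in> carrier C \<Longrightarrow> h1 (p c) \<otimes>\<^bsub>H\<^esub> s = s \<otimes>\<^bsub>H\<^esub> h2 (q c)"
    and pullback: "g \<in> carrier G1 \<Longrightarrow> b \<in> carrier G2 \<Longrightarrow> h1 g \<otimes>\<^bsub>H\<^esub> s = s \<otimes>\<^bsub>H\<^esub> h2 b \<Longrightarrow>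
      \<exists>c \<in> carrier C. p c = g \<and> q c = b"
begin

text \<open>As \<open>F\<close> is right invariant under the image of \<open>h2\<close>, the sum
  over \<open>g\<close> may be averaged over all pairs (g, b); then the pairs are grouped by the
  element of the double coset that they represent.\<close>

lemma sum_double_coset:
  fixes F :: "'c \<Rightarrow> int"
  assumes F: "\<And>k b. k \<in> carrier H \<Longrightarrow> b \<in> carrier G2 \<Longrightarrow> F (k \<otimes>\<^bsub>H\<^esub> h2 b) = F k"
  shows "int (order G2) * (\<Sum>g \<in> carrier G1. F (h1 g \<otimes>\<^bsub>H\<^esub> s)) =
    int (order C) * (\<Sum>k \<in> (h1 ` carrier G1) <#>\<^bsub>H\<^esub> (s <#\<^bsub>H\<^esub> (h2 ` carrier G2)). F k)"
proof -
  define \<phi> where "\<phi> = (\<lambda>(g, b). h1 g \<otimes>\<^bsub>H\<^esub> (s \<otimes>\<^bsub>H\<^esub> h2 b))"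
  let ?P = "carrier G1 \<times> carrier G2"
  have finP: "finite ?P" using h1.G.finite_carrier h2.G.finite_carrier by simp
  have img: "\<phi> ` ?P = (h1 ` carrier G1) <#>\<^bsub>H\<^esub> (s <#\<^bsub>H\<^esub> (h2 ` carrier G2))"
    unfolding \<phi>_def by (force simp: h1.H.double_coset_iff image_iff)
  have fibre: "card {x \<in> ?P. \<phi> x = d} = order C" if d: "d \<in> \<phi> ` ?P" for d
  proof -
    obtain g0 b0 where gb: "g0 \<in> carrier G1" "b0 \<in> carrier G2" "d = h1 g0 \<otimes>\<^bsub>H\<^esub> (s \<otimes>\<^bsub>H\<^esub> h2 b0)"
      using d by (auto simp: \<phi>_def)
    \<comment> \<open>An element \<open>c\<close> moves (g0, b0) inside its fibre: by
      \<open>comm\<close>, the image of \<open>p c\<close> passes across \<open>s\<close> and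
      cancels against that of \<open>q c\<close>.\<close>
    define \<psi> where "\<psi> c = (g0 \<otimes>\<^bsub>G1\<^esub> p c, inv\<^bsub>G2\<^esub> (q c) \<otimes>\<^bsub>G2\<^esub> b0)" for c
    have "inj_on \<psi> (carrier C)"
      using p.inj gb by (auto simp: \<psi>_def inj_on_def)
    moreover have "\<psi> ` carrier C = {x \<in> ?P. \<phi> x = d}"
    proof (intro equalityI subsetI)
      fix x assume "x \<in> \<psi> ` carrier C"
      then obtain c where c: "c \<in> carrier C" "x = \<psi> c" by blast
      have "\<phi> (\<psi> c) = h1 g0 \<otimes>\<^bsub>H\<^esub> (h1 (p c) \<otimes>\<^bsub>H\<^esub> s \<otimes>\<^bsub>H\<^esub> inv\<^bsub>H\<^esub> h2 (q c) \<otimes>\<^bsub>H\<^esub> h2 b0)"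
        using c gb s by (simp add: \<phi>_def \<psi>_def h1.H.m_assoc)
      also have "h1 (p c) \<otimes>\<^bsub>H\<^esub> s \<otimes>\<^bsub>H\<^esub> inv\<^bsub>H\<^esub> h2 (q c) = s"
        using c s by (simp add: comm h1.H.m_assoc)
      finally show "x \<in> {x \<in> ?P. \<phi> x = d}" using c gb by (simp add: \<psi>_def)
    next
      fix x assume "x \<in> {x \<in> ?P. \<phi> x = d}"
      then obtain g b where x: "x = (g, b)" "g \<in> carrier G1" "b \<in> carrier G2"
        "h1 g \<otimes>\<^bsub>H\<^esub> (s \<otimes>\<^bsub>H\<^esub> h2 b) = h1 g0 \<otimes>\<^bsub>H\<^esub> (s \<otimes>\<^bsub>H\<^esub> h2 b0)"
        using gb by (auto simp: \<phi>_def)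
      \<comment> \<open>Two pairs in one fibre differ by g0^-1 g and b0 b^-1; cancelling in the
        equation of the fibre shows that these two satisfy the pullback condition.\<close>
      have "h1 (inv\<^bsub>G1\<^esub> g0 \<otimes>\<^bsub>G1\<^esub> g) \<otimes>\<^bsub>H\<^esub> s =
        inv\<^bsub>H\<^esub> h1 g0 \<otimes>\<^bsub>H\<^esub> (h1 g \<otimes>\<^bsub>H\<^esub> (s \<otimes>\<^bsub>H\<^esub> h2 b)) \<otimes>\<^bsub>H\<^esub> inv\<^bsub>H\<^esub> h2 b"
        using x(2,3) gb(1,2) s by (simp add: h1.H.m_assoc)
      also have "\<dots> = s \<otimes>\<^bsub>H\<^esub> h2 (b0 \<otimes>\<^bsub>G2\<^esub> inv\<^bsub>G2\<^esub> b)"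
        unfolding x(4) using x(2,3) gb s by (simp add: h1.H.m_assoc) (simp add: h1.H.m_assoc[symmetric])
      finally obtain c where c: "c \<in> carrier C" "p c = inv\<^bsub>G1\<^esub> g0 \<otimes>\<^bsub>G1\<^esub> g" "q c = b0 \<otimes>\<^bsub>G2\<^esub> inv\<^bsub>G2\<^esub> b"
        using pullback[of "inv\<^bsub>G1\<^esub> g0 \<otimes>\<^bsub>G1\<^esub> g" "b0 \<otimes>\<^bsub>G2\<^esub> inv\<^bsub>G2\<^esub> b"] x gb by auto
      have "x = \<psi> c"
        using x(1-3) gb c by (simp add: \<psi>_def h1.G.m_assoc[symmetric] h2.G.inv_mult_group h2.G.m_assoc)
      then show "x \<in> \<psi> ` carrier C" using c by blast
    qed
    ultimately show ?thesis unfolding order_def using card_image by metis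
  qed
  have "int (order G2) * (\<Sum>g \<in> carrier G1. F (h1 g \<otimes>\<^bsub>H\<^esub> s)) = (\<Sum>g \<in> carrier G1. \<Sum>b \<in> carrier G2. F (\<phi> (g, b)))"
    using s by (simp add: sum_distrib_left order_def \<phi>_def h1.H.m_assoc[symmetric] F)
  also have "\<dots> = (\<Sum>x \<in> ?P. F (\<phi> x))" by (simp add: sum.cartesian_product split_def)
  also have "\<dots> = (\<Sum>d \<in> \<phi> ` ?P. \<Sum>x \<in> {x \<in> ?P. \<phi> x = d}. F (\<phi> x))" by (rule sum.image_gen[OF finP])
  also have "\<dots> = (\<Sum>d \<in> \<phi> ` ?P. int (order C) * F d)"
    using fibre by (intro sum.cong refl) simp
  finally show ?thesis by (simp add: sum_distrib_left img)
qed

text \<open>An element \<open>g\<close> of \<open>K\<close> has s^-1 h1(g) s = h2(b) exactly if it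
  is \<open>p c\<close> with \<open>q c\<close> = b. Hence both the support conditions and the
  subgroups at which \<open>A\<close> is evaluated agree.\<close>

lemma bmark_ext_res:
  assumes A: "A \<in> carrier (burnside_ring G2)" and K: "subgroup K G1"
  shows "bmark_ext C p (burnside_res C q A) K = bmark_ext G2 h2 A (conj_by H s (h1 ` K))"
proof -
  have Ksub: "K \<subseteq> carrier G1" using K by (rule subgroup.subset)
  have iff: "inv\<^bsub>H\<^esub> s \<otimes>\<^bsub>H\<^esub> h1 g \<otimes>\<^bsub>H\<^esub> s = h2 b \<longleftrightarrow> (\<exists>c \<in> carrier C. p c = g \<and> q c = b)"
    if "g \<in> carrier G1" "b \<in> carrier G2" for g b
  proof -
    have "inv\<^bsub>H\<^esub> s \<otimes>\<^bsub>H\<^esub> h1 g \<otimes>\<^bsub>H\<^esub> s = h2 b \<longleftrightarrow> h1 g \<otimes>\<^bsub>H\<^esub> s = s \<otimes>\<^bsub>H\<^esub> h2 b"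
      using that s by (simp add: h1.H.m_assoc h1.H.inv_solve_left')
    then show ?thesis using pullback[OF that] comm by auto
  qed
  have "conj_by H s (h1 ` K) \<subseteq> h2 ` carrier G2 \<longleftrightarrow>
      (\<forall>g \<in> K. \<exists>b \<in> carrier G2. inv\<^bsub>H\<^esub> s \<otimes>\<^bsub>H\<^esub> h1 g \<otimes>\<^bsub>H\<^esub> s = h2 b)"
    by (auto simp: conj_by_def image_iff)
  also have "\<dots> \<longleftrightarrow> (\<forall>g \<in> K. \<exists>b \<in> carrier G2. \<exists>c \<in> carrier C. p c = g \<and> q c = b)"
    using Ksub by (intro ball_cong bex_cong refl iff) auto
  also have "\<dots> \<longleftrightarrow> K \<subseteq> p ` carrier C" by (auto simp: image_iff subset_iff) (metis q.hom_closed)+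
  finally have cond: "conj_by H s (h1 ` K) \<subseteq> h2 ` carrier G2 \<longleftrightarrow> K \<subseteq> p ` carrier C" .
  have "b \<in> q ` {c \<in> carrier C. p c \<in> K} \<longleftrightarrow> b \<in> {b \<in> carrier G2. h2 b \<in> conj_by H s (h1 ` K)}" for b
  proof -
    have "b \<in> {b \<in> carrier G2. h2 b \<in> conj_by H s (h1 ` K)} \<longleftrightarrow>
      b \<in> carrier G2 \<and> (\<exists>g \<in> K. inv\<^bsub>H\<^esub> s \<otimes>\<^bsub>H\<^esub> h1 g \<otimes>\<^bsub>H\<^esub> s = h2 b)"
      by (auto simp: conj_by_def image_iff) metis
    also have "\<dots> \<longleftrightarrow> b \<in> carrier G2 \<and> (\<exists>g \<in> K. \<exists>c \<in> carrier C. p c = g \<and> q c = b)"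
      using Ksub by (intro conj_cong bex_cong refl iff) auto
    also have "\<dots> \<longleftrightarrow> b \<in> q ` {c \<in> carrier C. p c \<in> K}" by auto
    finally show ?thesis by blast
  qed
  then have "q ` {c \<in> carrier C. p c \<in> K} = {b \<in> carrier G2. h2 b \<in> conj_by H s (h1 ` K)}" by blast
  then show ?thesis
    using A q.burnside_res(2)[OF A p.subgroup_vimage[OF K]] by (simp add: bmark_ext_def cond)
qed

lemma bmark_ind_res:
  assumes A: "A \<in> carrier (burnside_ring G2)" and K: "subgroup K G1"
  shows "int (order G2) * bmark (burnside_ind C G1 p (burnside_res C q A)) K =
    (\<Sum>k \<in> (h1 ` carrier G1) <#>\<^bsub>H\<^esub> (s <#\<^bsub>H\<^esub> (h2 ` carrier G2)). bmark_ext G2 h2 A (conj_by H k (h1 ` K)))"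
proof -
  define F where "F k = bmark_ext G2 h2 A (conj_by H k (h1 ` K))" for k
  have hK: "subgroup (h1 ` K) H" using K by (rule h1.subgroup_img_is_subgroup)
  have Ksub: "K \<subseteq> carrier G1" using K by (rule subgroup.subset)
  have F: "F (k \<otimes>\<^bsub>H\<^esub> h2 b) = F k" if "k \<in> carrier H" "b \<in> carrier G2" for k b
    using that A by (simp add: F_def h1.H.conj_by_mult subgroup.subset[OF hK] h2.bmark_ext_conj_by
        h1.H.subgroup_conj_by hK)
  have "int (order C) * bmark (burnside_ind C G1 p (burnside_res C q A)) K =
      (\<Sum>g \<in> carrier G1. bmark_ext C p (burnside_res C q A) (conj_by G1 g K))"
    by (rule p.burnside_ind(2)[OF q.burnside_res(1)[OF A] K])
  also have "\<dots> = (\<Sum>g \<in> carrier G1. F (h1 g \<otimes>\<^bsub>H\<^esub> s))"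
    using s subgroup.subset[OF hK] Ksub
    by (intro sum.cong refl) (simp add: bmark_ext_res[OF A] h1.G.subgroup_conj_by K F_def
        h1.H.conj_by_mult h1.image_conj_by)
  finally have "int (order C) * (int (order G2) * bmark (burnside_ind C G1 p (burnside_res C q A)) K) =
      int (order G2) * (\<Sum>g \<in> carrier G1. F (h1 g \<otimes>\<^bsub>H\<^esub> s))"
    by (simp add: mult.left_commute)
  also have "\<dots> = int (order C) *
      (\<Sum>k \<in> (h1 ` carrier G1) <#>\<^bsub>H\<^esub> (s <#\<^bsub>H\<^esub> (h2 ` carrier G2)). F k)"
    by (rule sum_double_coset[of F, OF F])
  finally have "int (order G2) * bmark (burnside_ind C G1 p (burnside_res C q A)) K =
      (\<Sum>k \<in> (h1 ` carrier G1) <#>\<^bsub>H\<^esub> (s <#\<^bsub>H\<^esub> (h2 ` carrier G2)). F k)"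
    using p.order_pos by simp
  then show ?thesis by (simp add: F_def)
qed

end

text \<open>The induction sum runs over the whole group \<open>H\<close>; it is split along the
  partition into double cosets, and each part is evaluated by \<open>bmark_ind_res\<close>. The
  pullback for each double coset is left abstract, to be instantiated by the group of a
  partition.\<close>

lemma bmark_res_ind_double_coset:
  assumes "finite_group_inj G1 H h1" "finite_group_inj G2 H h2"
    and pb: "\<And>D. D \<in> double_cosets H (h1 ` carrier G1) (h2 ` carrier G2) \<Longrightarrow>
      \<sigma> D \<in> D \<and> conj_pullback G1 G2 H (C D) h1 h2 (p D) (q D) (\<sigma> D)"
    and A: "A \<in> carrier (burnside_ring G2)" and K: "subgroup K G1"
  shows "bmark (burnside_res G1 h1 (burnside_ind G2 H h2 A)) K =
    (\<Sum>D \<in> double_cosets H (h1 ` carrier G1) (h2 ` carrier G2).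
      bmark (burnside_ind (C D) G1 (p D) (burnside_res (C D) (q D) A)) K)"
proof -
  interpret h1: finite_group_inj G1 H h1 by fact
  interpret h2: finite_group_inj G2 H h2 by fact
  let ?DC = "double_cosets H (h1 ` carrier G1) (h2 ` carrier G2)"
  let ?F = "\<lambda>k. bmark_ext G2 h2 A (conj_by H k (h1 ` K))"
  note part = h1.H.double_cosets_partition[OF h1.img_is_subgroup h2.img_is_subgroup]
  have hK: "subgroup (h1 ` K) H" using K by (rule h1.subgroup_img_is_subgroup)
  have "int (order G2) * bmark (burnside_res G1 h1 (burnside_ind G2 H h2 A)) K = (\<Sum>k \<in> carrier H. ?F k)"
    using h2.burnside_ind[OF A] hK h1.burnside_res(2)[OF _ K] by simp
  also have "\<dots> = (\<Sum>D \<in> ?DC. \<Sum>k \<in> D. ?F k)"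
  proof -
    have "finite D" if "D \<in> ?DC" for D
      using Union_upper[OF that] finite_subset[OF _ h1.H.finite_carrier] part(1) by simp
    then show ?thesis
      unfolding part(1)[symmetric] using part(2) by (intro sum.Union_disjoint[unfolded comp_def]) auto
  qed
  also have "\<dots> = (\<Sum>D \<in> ?DC. int (order G2) * bmark (burnside_ind (C D) G1 (p D) (burnside_res (C D) (q D) A)) K)"
  proof (intro sum.cong refl)
    fix D assume D: "D \<in> ?DC"
    then interpret conj_pullback G1 G2 H "C D" h1 h2 "p D" "q D" "\<sigma> D" using pb by blast
    show "(\<Sum>k \<in> D. ?F k) = int (order G2) * bmark (burnside_ind (C D) G1 (p D) (burnside_res (C D) (q D) A)) K"
      using bmark_ind_res[OF A K] part(3)[OF D, of "\<sigma> D"] pb[OF D] by simp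
  qed
  finally show ?thesis using h2.order_pos by (simp add: sum_distrib_left[symmetric])
qed

text \<open>Elements of the group of a disjoint union are permutations, not pairs. The product
  decomposition is therefore expressed by two projections that are jointly bijective.\<close>

locale group_product =
  left: finite_group_hom P G1 l + right: finite_group_hom P G2 r
  for P (structure) and G1 (structure) and G2 (structure) and l r +
  assumes bij: "bij_betw (\<lambda>x. (l x, r x)) (carrier P) (carrier G1 \<times> carrier G2)"
begin

lemma pair_eqI: "x \<in> carrier P \<Longrightarrow> y \<in> carrier P \<Longrightarrow> l x = l y \<Longrightarrow> r x = r y \<Longrightarrow> x = y"
  using bij by (auto simp: bij_betw_def inj_on_def)

lemma pair_surj:
  assumes "a \<in> carrier G1" "b \<in> carrier G2"
  obtains x where "x \<in> carrier P" "l x = a" "r x = b"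
proof -
  have "(a, b) \<in> (\<lambda>x. (l x, r x)) ` carrier P" using bij assms by (simp add: bij_betw_def)
  then show ?thesis using that by auto
qed

end

text \<open>External products are products of classes pulled back along the two projections. The
  induction sum over \<open>Q\<close> becomes a double sum over \<open>H1\<close> and
  \<open>H2\<close> whose summand splits, and \<open>order P\<close> factors accordingly.\<close>

lemma burnside_ind_product:
  assumes "group_product P G1 G2 l r" "group_product Q H1 H2 l' r'"
    "finite_group_inj G1 H1 f" "finite_group_inj G2 H2 g" "finite_group_inj P Q h"
    and hl: "\<And>x. x \<in> carrier P \<Longrightarrow> l' (h x) = f (l x)"
    and hr: "\<And>x. x \<in> carrier P \<Longrightarrow> r' (h x) = g (r x)"
    and A: "A \<in> carrier (burnside_ring G1)" and B: "B \<in> carrier (burnside_ring G2)"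
  shows "burnside_ind P Q h (burnside_res P l A \<otimes>\<^bsub>burnside_ring P\<^esub> burnside_res P r B) =
    burnside_res Q l' (burnside_ind G1 H1 f A) \<otimes>\<^bsub>burnside_ring Q\<^esub>
    burnside_res Q r' (burnside_ind G2 H2 g B)"
proof -
  interpret P: group_product P G1 G2 l r by fact
  interpret Q: group_product Q H1 H2 l' r' by fact
  interpret f: finite_group_inj G1 H1 f by fact
  interpret g: finite_group_inj G2 H2 g by fact
  interpret h: finite_group_inj P Q h by fact
  let ?AB = "burnside_res P l A \<otimes>\<^bsub>burnside_ring P\<^esub> burnside_res P r B"
  \<comment> \<open>\<open>Y\<close> need not be the product of its projections; pulled-back classes
    see only its two images.\<close>
  have ext: "bmark_ext P h ?AB Y = bmark_ext G1 f A (l' ` Y) * bmark_ext G2 g B (r' ` Y)"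
    if Y: "subgroup Y Q" for Y
  proof (cases "Y \<subseteq> h ` carrier P")
    case False
    \<comment> \<open>If both projections of \<open>Y\<close> lay in the images of \<open>f\<close>
      and \<open>g\<close>, preimages of the two coordinates of any y in \<open>Y\<close> would
      combine to a preimage of y under \<open>h\<close>.\<close>
    have "\<not> (l' ` Y \<subseteq> f ` carrier G1 \<and> r' ` Y \<subseteq> g ` carrier G2)"
    proof
      assume *: "l' ` Y \<subseteq> f ` carrier G1 \<and> r' ` Y \<subseteq> g ` carrier G2"
      have "Y \<subseteq> h ` carrier P"
      proof
        fix y assume y: "y \<in> Y"
        then have lr: "l' y \<in> f ` carrier G1" "r' y \<in> g ` carrier G2" using * by auto
        obtain a where a: "a \<in> carrier G1" "l' y = f a" using lr(1) by (rule imageE)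
        obtain b where b: "b \<in> carrier G2" "r' y = g b" using lr(2) by (rule imageE)
        obtain x where x: "x \<in> carrier P" "l x = a" "r x = b"
          by (rule P.pair_surj[OF a(1) b(1)])
        have "y = h x"
          by (rule Q.pair_eqI)
            (use y subgroup.subset[OF Y] x(1) in \<open>auto simp: hl hr x(2,3) a(2) b(2)\<close>)
        then show "y \<in> h ` carrier P" using x by blast
      qed
      with False show False by simp
    qed
    then show ?thesis using False by (auto simp: bmark_ext_def)
  next
    case True
    have lY: "l' ` Y \<subseteq> f ` carrier G1" "r' ` Y \<subseteq> g ` carrier G2"
    proof -
      have "l' (h x) \<in> f ` carrier G1" "r' (h x) \<in> g ` carrier G2" if "x \<in> carrier P" for x
        using that by (simp_all add: hl hr)
      then show "l' ` Y \<subseteq> f ` carrier G1" "r' ` Y \<subseteq> g ` carrier G2" using True by blast+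
    qed
    have "l ` {x \<in> carrier P. h x \<in> Y} = {a \<in> carrier G1. f a \<in> l' ` Y}"
    proof (intro equalityI subsetI)
      fix a assume "a \<in> {a \<in> carrier G1. f a \<in> l' ` Y}"
      then obtain y where a: "a \<in> carrier G1" "y \<in> Y" "f a = l' y" by auto
      then obtain x where x: "x \<in> carrier P" "y = h x" using True by (meson imageE subsetD)
      then have "a = l x" using a hl f.inj by (auto dest: inj_onD)
      then show "a \<in> l ` {x \<in> carrier P. h x \<in> Y}" using x a by blast
    qed (auto simp: hl[symmetric])
    moreover have "r ` {x \<in> carrier P. h x \<in> Y} = {b \<in> carrier G2. g b \<in> r' ` Y}"
    proof (intro equalityI subsetI)
      fix b assume "b \<in> {b \<in> carrier G2. g b \<in> r' ` Y}"
      then obtain y where b: "b \<in> carrier G2" "y \<in> Y" "g b = r' y" by auto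
      then obtain x where x: "x \<in> carrier P" "y = h x" using True by (meson imageE subsetD)
      then have "b = r x" using b hr g.inj by (auto dest: inj_onD)
      then show "b \<in> r ` {x \<in> carrier P. h x \<in> Y}" using x b by blast
    qed (auto simp: hr[symmetric])
    ultimately show ?thesis
      using True lY A B h.subgroup_vimage[OF Y]
      by (simp add: bmark_ext_def P.left.G.burnside_mult P.left.burnside_res P.right.burnside_res)
  qed
  have oP: "order P = order G1 * order G2"
    using bij_betw_same_card[OF P.bij] by (simp add: order_def card_cartesian_product)
  show ?thesis
  proof (rule h.burnside_ind_eqI)
    fix K assume K: "subgroup K Q"
    have Ksub: "K \<subseteq> carrier Q" using K by (rule subgroup.subset)
    have "(\<Sum>k \<in> carrier Q. bmark_ext P h ?AB (conj_by Q k K)) =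
      (\<Sum>k \<in> carrier Q. (\<lambda>(k1, k2). bmark_ext G1 f A (conj_by H1 k1 (l' ` K)) *
        bmark_ext G2 g B (conj_by H2 k2 (r' ` K))) (l' k, r' k))"
      by (intro sum.cong refl) (simp add: ext K Q.left.G.subgroup_conj_by Ksub
          Q.left.image_conj_by Q.right.image_conj_by)
    also have "\<dots> = (\<Sum>(k1, k2) \<in> carrier H1 \<times> carrier H2. bmark_ext G1 f A (conj_by H1 k1 (l' ` K)) *
        bmark_ext G2 g B (conj_by H2 k2 (r' ` K)))"
      by (rule sum.reindex_bij_betw[OF Q.bij])
    also have "\<dots> = (\<Sum>k1 \<in> carrier H1. bmark_ext G1 f A (conj_by H1 k1 (l' ` K))) *
        (\<Sum>k2 \<in> carrier H2. bmark_ext G2 g B (conj_by H2 k2 (r' ` K)))"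
      by (simp add: sum_product sum.cartesian_product)
    also have "\<dots> = int (order P) * bmark (burnside_res Q l' (burnside_ind G1 H1 f A) \<otimes>\<^bsub>burnside_ring Q\<^esub>
        burnside_res Q r' (burnside_ind G2 H2 g B)) K"
      using K A B by (simp add: f.burnside_ind(2)[symmetric] g.burnside_ind(2)[symmetric] oP
          Q.left.subgroup_img_is_subgroup Q.right.subgroup_img_is_subgroup Q.left.G.burnside_mult
          Q.left.burnside_res Q.right.burnside_res f.burnside_ind(1) g.burnside_ind(1))
    finally show "(\<Sum>k \<in> carrier Q. bmark_ext P h ?AB (conj_by Q k K)) =
      int (order P) * bmark (burnside_res Q l' (burnside_ind G1 H1 f A) \<otimes>\<^bsub>burnside_ring Q\<^esub>
        burnside_res Q r' (burnside_ind G2 H2 g B)) K" .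
  qed (use A B in \<open>simp_all add: Q.left.G.burnside_mult P.left.G.burnside_mult
      Q.left.burnside_res Q.right.burnside_res P.left.burnside_res P.right.burnside_res
      f.burnside_ind g.burnside_ind\<close>)
qed

section \<open>The groups \<open>\<Sigma>\<^sub>\<Lambda>\<close>\<close>

lemma equiv_rel: "equiv (pts \<Lambda>) (rel \<Lambda>)"
  by transfer auto

lemma finite_pts: "finite (pts \<Lambda>)"
  by transfer auto

lemma ptn_eqI: "pts \<Lambda> = pts \<Omega> \<Longrightarrow> rel \<Lambda> = rel \<Omega> \<Longrightarrow> \<Lambda> = \<Omega>"
  by transfer (auto simp: prod_eq_iff)

lemma rel_pts: "(x, y) \<in> rel \<Lambda> \<Longrightarrow> x \<in> pts \<Lambda> \<and> y \<in> pts \<Lambda>"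
  using equiv_type[OF equiv_rel] by blast

lemma rel_refl: "x \<in> pts \<Lambda> \<Longrightarrow> (x, x) \<in> rel \<Lambda>"
  using equiv_rel by (meson equivE refl_onD)

lemma rel_sym: "(x, y) \<in> rel \<Lambda> \<Longrightarrow> (y, x) \<in> rel \<Lambda>"
  using equiv_rel by (meson equivE symE)

lemma rel_trans: "(x, y) \<in> rel \<Lambda> \<Longrightarrow> (y, z) \<in> rel \<Lambda> \<Longrightarrow> (x, z) \<in> rel \<Lambda>"
  using equiv_rel by (meson equivE transE)

text \<open>Blocks are finite, so an injection that maps a block into itself maps it onto itself.
  Preservation of blocks can thus be tested pointwise.\<close>

lemma Sigma_iff:
  "\<sigma> \<in> carrier (Sigma_grp \<Lambda>) \<longleftrightarrow> \<sigma> permutes pts \<Lambda> \<and> (\<forall>x \<in> pts \<Lambda>. (x, \<sigma> x) \<in> rel \<Lambda>)"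
proof (intro iffI conjI ballI)
  assume \<sigma>: "\<sigma> \<in> carrier (Sigma_grp \<Lambda>)"
  then show "\<sigma> permutes pts \<Lambda>" by (simp add: Sigma_grp_def)
  fix x assume x: "x \<in> pts \<Lambda>"
  then have "\<sigma> ` (rel \<Lambda> `` {x}) = rel \<Lambda> `` {x}"
    using \<sigma> quotientI[OF x, of "rel \<Lambda>"] by (simp add: Sigma_grp_def)
  moreover have "\<sigma> x \<in> \<sigma> ` (rel \<Lambda> `` {x})" using rel_refl[OF x] by blast
  ultimately show "(x, \<sigma> x) \<in> rel \<Lambda>" by simp
next
  assume \<sigma>: "\<sigma> permutes pts \<Lambda> \<and> (\<forall>x \<in> pts \<Lambda>. (x, \<sigma> x) \<in> rel \<Lambda>)"
  have "\<sigma> ` B = B" if B: "B \<in> pts \<Lambda> // rel \<Lambda>" for B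
  proof (rule endo_inj_surj)
    have sub: "B \<subseteq> pts \<Lambda>" using B equiv_rel in_quotient_imp_subset by blast
    then show "finite B" using finite_pts finite_subset by blast
    show "inj_on \<sigma> B" using \<sigma> permutes_inj_on by blast
    show "\<sigma> ` B \<subseteq> B"
      using B sub \<sigma> by (auto intro: in_quotient_imp_closed[OF equiv_rel])
  qed
  then show "\<sigma> \<in> carrier (Sigma_grp \<Lambda>)" using \<sigma> by (simp add: Sigma_grp_def)
qed

lemma Sigma_permutes: "\<sigma> \<in> carrier (Sigma_grp \<Lambda>) \<Longrightarrow> \<sigma> permutes pts \<Lambda>"
  and Sigma_rel: "\<sigma> \<in> carrier (Sigma_grp \<Lambda>) \<Longrightarrow> x \<in> pts \<Lambda> \<Longrightarrow> (x, \<sigma> x) \<in> rel \<Lambda>"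
  and Sigma_closed: "\<sigma> \<in> carrier (Sigma_grp \<Lambda>) \<Longrightarrow> x \<in> pts \<Lambda> \<Longrightarrow> \<sigma> x \<in> pts \<Lambda>"
  by (auto simp: Sigma_iff dest: rel_pts)

lemma Sigma_mult [simp]: "\<sigma> \<otimes>\<^bsub>Sigma_grp \<Lambda>\<^esub> \<tau> = \<sigma> \<circ> \<tau>"
  by (simp add: Sigma_grp_def)

lemma Sigma_one [simp]: "\<one>\<^bsub>Sigma_grp \<Lambda>\<^esub> = id"
  by (simp add: Sigma_grp_def)

lemma Sigma_inv_closed:
  assumes "\<sigma> \<in> carrier (Sigma_grp \<Lambda>)"
  shows "inv_into UNIV \<sigma> \<in> carrier (Sigma_grp \<Lambda>)"
proof -
  note p = Sigma_permutes[OF assms]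
  have "(x, inv_into UNIV \<sigma> x) \<in> rel \<Lambda>" if "x \<in> pts \<Lambda>" for x
    using Sigma_rel[OF assms, of "inv_into UNIV \<sigma> x"] permutes_inverses(1)[OF p, of x]
      permutes_in_image[OF permutes_inv[OF p]] that by (auto intro: rel_sym)
  then show ?thesis by (simp add: Sigma_iff permutes_inv[OF p])
qed

lemma finite_group_Sigma: "finite_group (Sigma_grp \<Lambda>)"
proof (intro finite_group.intro groupI finite_group_axioms.intro)
  show "finite (carrier (Sigma_grp \<Lambda>))"
    by (rule finite_subset[OF _ finite_permutations[OF finite_pts, of \<Lambda>]]) (auto simp: Sigma_iff)
  show "\<sigma> \<otimes>\<^bsub>Sigma_grp \<Lambda>\<^esub> \<tau> \<in> carrier (Sigma_grp \<Lambda>)"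
    if "\<sigma> \<in> carrier (Sigma_grp \<Lambda>)" "\<tau> \<in> carrier (Sigma_grp \<Lambda>)" for \<sigma> \<tau>
    using that Sigma_closed[OF that(2)] by (auto simp: Sigma_iff permutes_compose intro: rel_trans)
  show "\<one>\<^bsub>Sigma_grp \<Lambda>\<^esub> \<in> carrier (Sigma_grp \<Lambda>)"
    by (simp add: Sigma_iff rel_refl permutes_id[unfolded id_def] id_def)
  show "\<exists>\<tau> \<in> carrier (Sigma_grp \<Lambda>). \<tau> \<otimes>\<^bsub>Sigma_grp \<Lambda>\<^esub> \<sigma> = \<one>\<^bsub>Sigma_grp \<Lambda>\<^esub>"
    if "\<sigma> \<in> carrier (Sigma_grp \<Lambda>)" for \<sigma>
    using Sigma_inv_closed[OF that] permutes_inv_o(2)[OF Sigma_permutes[OF that]] by auto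
qed auto

interpretation Sigma: finite_group "Sigma_grp \<Lambda>" for \<Lambda>
  by (rule finite_group_Sigma)

lemma Sigma_inv:
  assumes "\<sigma> \<in> carrier (Sigma_grp \<Lambda>)"
  shows "inv\<^bsub>Sigma_grp \<Lambda>\<^esub> \<sigma> = inv_into UNIV \<sigma>"
  by (rule Sigma.inv_equality)
    (use assms Sigma_inv_closed permutes_inv_o(2)[OF Sigma_permutes[OF assms]] in auto)

lemma morphismD:
  assumes "morphism \<Lambda> \<Omega> f"
  shows "bij_betw f (pts \<Lambda>) (pts \<Omega>)" "inj_on f (pts \<Lambda>)" "f ` pts \<Lambda> = pts \<Omega>"
    "x \<in> pts \<Lambda> \<Longrightarrow> f x \<in> pts \<Omega>" "(x, y) \<in> rel \<Lambda> \<Longrightarrow> (f x, f y) \<in> rel \<Omega>"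
  using assms by (auto simp: morphism_def bij_betw_def)

lemma morphism_comp: "morphism \<Gamma> \<Lambda> f \<Longrightarrow> morphism \<Lambda> \<Omega> g \<Longrightarrow> morphism \<Gamma> \<Omega> (g \<circ> f)"
  by (auto simp: morphism_def intro: bij_betw_trans)

lemma refines_iff: "refines \<Lambda> \<Omega> \<longleftrightarrow> pts \<Lambda> = pts \<Omega> \<and> rel \<Lambda> \<subseteq> rel \<Omega>"
  by (auto simp: refines_def morphism_def)

lemma morphism_id: "refines \<Lambda> \<Omega> \<Longrightarrow> morphism \<Lambda> \<Omega> id"
  by (simp add: refines_def)

lemma refines_refl: "refines \<Lambda> \<Lambda>"
  by (simp add: refines_iff)

lemma Sigma_map_apply:
  "morphism \<Lambda> \<Omega> f \<Longrightarrow> x \<in> pts \<Lambda> \<Longrightarrow> Sigma_map \<Lambda> \<Omega> f \<sigma> (f x) = f (\<sigma> x)"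
  by (simp add: Sigma_map_def morphismD inv_into_f_f)

lemma Sigma_map_outside: "y \<notin> pts \<Omega> \<Longrightarrow> Sigma_map \<Lambda> \<Omega> f \<sigma> y = y"
  by (simp add: Sigma_map_def)

text \<open>Since \<open>f\<close> is onto the points of \<open>\<Omega>\<close>, the conjugate of
  \<open>\<sigma>\<close> is determined by its commutation with \<open>f\<close> and by being the
  identity elsewhere. Identities between induced homomorphisms are checked in this form, without
  inverses of \<open>f\<close>.\<close>

lemma Sigma_map_eqI:
  assumes f: "morphism \<Lambda> \<Omega> f" and "\<And>x. x \<in> pts \<Lambda> \<Longrightarrow> \<tau> (f x) = f (\<sigma> x)"
    "\<And>y. y \<notin> pts \<Omega> \<Longrightarrow> \<tau> y = y"
  shows "Sigma_map \<Lambda> \<Omega> f \<sigma> = \<tau>"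
proof
  fix y
  show "Sigma_map \<Lambda> \<Omega> f \<sigma> y = \<tau> y"
  proof (cases "y \<in> pts \<Omega>")
    case True
    then obtain x where "x \<in> pts \<Lambda>" "y = f x" using morphismD(3)[OF f] by blast
    then show ?thesis using assms(2) by (simp add: Sigma_map_apply[OF f])
  qed (simp add: assms(3) Sigma_map_outside)
qed

lemma Sigma_map_inj:
  assumes f: "morphism \<Lambda> \<Omega> f"
  shows "finite_group_inj (Sigma_grp \<Lambda>) (Sigma_grp \<Omega>) (Sigma_map \<Lambda> \<Omega> f)"
proof -
  note fD = morphismD[OF f]
  have "Sigma_map \<Lambda> \<Omega> f \<in> hom (Sigma_grp \<Lambda>) (Sigma_grp \<Omega>)"
  proof (rule homI)
    fix \<sigma> assume \<sigma>: "\<sigma> \<in> carrier (Sigma_grp \<Lambda>)"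
    have "bij_betw (f \<circ> \<sigma> \<circ> inv_into (pts \<Lambda>) f) (pts \<Omega>) (pts \<Omega>)"
      using fD(1) permutes_imp_bij[OF Sigma_permutes[OF \<sigma>]] bij_betw_inv_into[OF fD(1)]
      by (auto intro!: bij_betw_trans)
    then have "bij_betw (Sigma_map \<Lambda> \<Omega> f \<sigma>) (pts \<Omega>) (pts \<Omega>)"
      by (rule bij_betw_cong[THEN iffD1, rotated]) (simp add: Sigma_map_def)
    then have "Sigma_map \<Lambda> \<Omega> f \<sigma> permutes pts \<Omega>"
      by (rule bij_imp_permutes) (rule Sigma_map_outside)
    moreover have "(y, Sigma_map \<Lambda> \<Omega> f \<sigma> y) \<in> rel \<Omega>" if y: "y \<in> pts \<Omega>" for y
    proof -
      obtain x where x: "x \<in> pts \<Lambda>" "y = f x" using y fD(3) by blast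
      then show ?thesis using fD(5) Sigma_rel[OF \<sigma>] by (simp add: Sigma_map_apply[OF f])
    qed
    ultimately show "Sigma_map \<Lambda> \<Omega> f \<sigma> \<in> carrier (Sigma_grp \<Omega>)" by (simp add: Sigma_iff)
    fix \<tau> assume \<tau>: "\<tau> \<in> carrier (Sigma_grp \<Lambda>)"
    have "Sigma_map \<Lambda> \<Omega> f (\<sigma> \<circ> \<tau>) = Sigma_map \<Lambda> \<Omega> f \<sigma> \<circ> Sigma_map \<Lambda> \<Omega> f \<tau>"
      by (rule Sigma_map_eqI[OF f]) (simp_all add: Sigma_map_apply[OF f] Sigma_closed[OF \<tau>] Sigma_map_outside)
    then show "Sigma_map \<Lambda> \<Omega> f (\<sigma> \<otimes>\<^bsub>Sigma_grp \<Lambda>\<^esub> \<tau>) =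
      Sigma_map \<Lambda> \<Omega> f \<sigma> \<otimes>\<^bsub>Sigma_grp \<Omega>\<^esub> Sigma_map \<Lambda> \<Omega> f \<tau>" by simp
  qed
  moreover have "inj_on (Sigma_map \<Lambda> \<Omega> f) (carrier (Sigma_grp \<Lambda>))"
  proof (rule inj_onI, rule ext)
    fix \<sigma> \<tau> x
    assume *: "\<sigma> \<in> carrier (Sigma_grp \<Lambda>)" "\<tau> \<in> carrier (Sigma_grp \<Lambda>)"
      "Sigma_map \<Lambda> \<Omega> f \<sigma> = Sigma_map \<Lambda> \<Omega> f \<tau>"
    show "\<sigma> x = \<tau> x"
    proof (cases "x \<in> pts \<Lambda>")
      case True
      then have "f (\<sigma> x) = f (\<tau> x)" using *(3) Sigma_map_apply[OF f True] by metis
      then show ?thesis using fD(2) True Sigma_closed *(1,2) by (metis inj_onD)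
    next
      case False
      then show ?thesis using *(1,2)[THEN Sigma_permutes] by (simp add: permutes_not_in)
    qed
  qed
  ultimately show ?thesis
    by (intro finite_group_inj.intro finite_group_hom.intro finite_group_hom_axioms.intro
        finite_group_inj_axioms.intro finite_group_Sigma)
qed

lemmas Sigma_map_hom = Sigma_map_inj[THEN finite_group_inj.axioms(1)]

lemma Sigma_map_id:
  assumes "refines \<Lambda> \<Omega>" "\<sigma> \<in> carrier (Sigma_grp \<Lambda>)"
  shows "Sigma_map \<Lambda> \<Omega> id \<sigma> = \<sigma>"
  by (rule Sigma_map_eqI[OF morphism_id[OF assms(1)]])
    (use assms permutes_not_in[OF Sigma_permutes[OF assms(2)]] in \<open>auto simp: refines_iff\<close>)

lemma Sigma_map_comp:
  assumes f: "morphism \<Gamma> \<Lambda> f" and g: "morphism \<Lambda> \<Omega> g"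
  shows "Sigma_map \<Gamma> \<Omega> (g \<circ> f) \<sigma> = Sigma_map \<Lambda> \<Omega> g (Sigma_map \<Gamma> \<Lambda> f \<sigma>)"
  by (rule Sigma_map_eqI[OF morphism_comp[OF f g]])
    (simp_all add: Sigma_map_apply[OF f] Sigma_map_apply[OF g] Sigma_map_outside morphismD(4)[OF f])

lemma Sigma_map_inv_into:
  assumes "isomorphism \<Lambda> \<Omega> f" and \<sigma>: "\<sigma> \<in> carrier (Sigma_grp \<Lambda>)"
  shows "Sigma_map \<Omega> \<Lambda> (inv_into (pts \<Lambda>) f) (Sigma_map \<Lambda> \<Omega> f \<sigma>) = \<sigma>"
proof -
  have f: "morphism \<Lambda> \<Omega> f" and f': "morphism \<Omega> \<Lambda> (inv_into (pts \<Lambda>) f)"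
    using assms by (auto simp: isomorphism_def)
  show ?thesis
  proof (rule Sigma_map_eqI[OF f'])
    fix y assume y: "y \<in> pts \<Omega>"
    obtain x where x: "x \<in> pts \<Lambda>" "y = f x" using morphismD(3)[OF f] y by blast
    then show "\<sigma> (inv_into (pts \<Lambda>) f y) = inv_into (pts \<Lambda>) f (Sigma_map \<Lambda> \<Omega> f \<sigma> y)"
      by (simp add: Sigma_map_apply[OF f] inv_into_f_f[OF morphismD(2)[OF f]] Sigma_closed[OF \<sigma>])
  qed (rule permutes_not_in[OF Sigma_permutes[OF \<sigma>]])
qed

lemma isomorphism_inv_into:
  assumes "isomorphism \<Lambda> \<Omega> f"
  shows "isomorphism \<Omega> \<Lambda> (inv_into (pts \<Lambda>) f)"
proof -
  have f: "morphism \<Lambda> \<Omega> f" and f': "morphism \<Omega> \<Lambda> (inv_into (pts \<Lambda>) f)"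
    using assms by (auto simp: isomorphism_def)
  have eq: "inv_into (pts \<Omega>) (inv_into (pts \<Lambda>) f) x = f x" if "x \<in> pts \<Lambda>" for x
    using that by (simp add: inv_into_inv_into_eq[OF morphismD(1)[OF f]])
  have "morphism \<Lambda> \<Omega> (inv_into (pts \<Omega>) (inv_into (pts \<Lambda>) f))"
    unfolding morphism_def
  proof (intro conjI allI impI)
    show "bij_betw (inv_into (pts \<Omega>) (inv_into (pts \<Lambda>) f)) (pts \<Lambda>) (pts \<Omega>)"
      by (rule bij_betw_cong[THEN iffD2, OF _ morphismD(1)[OF f]]) (rule eq)
    show "(inv_into (pts \<Omega>) (inv_into (pts \<Lambda>) f) x, inv_into (pts \<Omega>) (inv_into (pts \<Lambda>) f) x') \<in> rel \<Omega>"
      if "(x, x') \<in> rel \<Lambda>" for x x'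
      using that rel_pts[OF that] morphismD(5)[OF f] by (simp add: eq)
  qed
  then show ?thesis using f' by (simp add: isomorphism_def)
qed

text \<open>The inverse morphism gives an injection in the other direction, and both groups are
  finite.\<close>

lemma Sigma_map_surj:
  assumes "isomorphism \<Lambda> \<Omega> f"
  shows "Sigma_map \<Lambda> \<Omega> f ` carrier (Sigma_grp \<Lambda>) = carrier (Sigma_grp \<Omega>)"
proof -
  have f: "morphism \<Lambda> \<Omega> f" and f': "morphism \<Omega> \<Lambda> (inv_into (pts \<Lambda>) f)"
    using assms by (auto simp: isomorphism_def)
  interpret f: finite_group_inj "Sigma_grp \<Lambda>" "Sigma_grp \<Omega>" "Sigma_map \<Lambda> \<Omega> f"
    by (rule Sigma_map_inj[OF f])
  interpret f': finite_group_inj "Sigma_grp \<Omega>" "Sigma_grp \<Lambda>" "Sigma_map \<Omega> \<Lambda> (inv_into (pts \<Lambda>) f)"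
    by (rule Sigma_map_inj[OF f'])
  have "card (carrier (Sigma_grp \<Omega>)) \<le> card (carrier (Sigma_grp \<Lambda>))"
    by (rule card_inj_on_le[OF f'.inj]) (auto simp: Sigma.finite_carrier)
  then show ?thesis
    by (intro card_seteq) (auto simp: Sigma.finite_carrier card_image[OF f.inj])
qed

text \<open>The conjugating element is t = f g^-1. It preserves the blocks of
  \<open>\<Omega>\<close> exactly because \<open>f x\<close> and \<open>g x\<close> are always
  equivalent.\<close>

lemma two_iso_conj:
  assumes f: "morphism \<Lambda> \<Omega> f" and g: "morphism \<Lambda> \<Omega> g" and fg: "two_iso \<Lambda> \<Omega> f g"
  shows "\<exists>t \<in> carrier (Sigma_grp \<Omega>). \<forall>\<sigma> \<in> carrier (Sigma_grp \<Lambda>). Sigma_map \<Lambda> \<Omega> g \<sigma> =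
      inv\<^bsub>Sigma_grp \<Omega>\<^esub> t \<otimes>\<^bsub>Sigma_grp \<Omega>\<^esub> Sigma_map \<Lambda> \<Omega> f \<sigma> \<otimes>\<^bsub>Sigma_grp \<Omega>\<^esub> t"
proof -
  define t where "t y = (if y \<in> pts \<Omega> then f (inv_into (pts \<Lambda>) g y) else y)" for y
  have tg: "t (g x) = f x" if "x \<in> pts \<Lambda>" for x
    using that by (simp add: t_def morphismD[OF g] inv_into_f_f)
  have "bij_betw (f \<circ> inv_into (pts \<Lambda>) g) (pts \<Omega>) (pts \<Omega>)"
    using morphismD(1)[OF f] bij_betw_inv_into[OF morphismD(1)[OF g]] by (rule bij_betw_trans[rotated])
  then have "bij_betw t (pts \<Omega>) (pts \<Omega>)"
    by (rule bij_betw_cong[THEN iffD1, rotated]) (simp add: t_def)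
  then have tp: "t permutes pts \<Omega>" by (rule bij_imp_permutes) (simp add: t_def)
  have "(y, t y) \<in> rel \<Omega>" if y: "y \<in> pts \<Omega>" for y
  proof -
    obtain x where x: "x \<in> pts \<Lambda>" "y = g x" using morphismD(3)[OF g] y by blast
    then show ?thesis using fg tg by (auto simp: two_iso_def intro: rel_sym)
  qed
  with tp have t: "t \<in> carrier (Sigma_grp \<Omega>)" by (simp add: Sigma_iff)
  have "Sigma_map \<Lambda> \<Omega> g \<sigma> = inv_into UNIV t \<circ> Sigma_map \<Lambda> \<Omega> f \<sigma> \<circ> t"
    if \<sigma>: "\<sigma> \<in> carrier (Sigma_grp \<Lambda>)" for \<sigma>
  proof (rule Sigma_map_eqI[OF g])
    fix x assume x: "x \<in> pts \<Lambda>"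
    show "(inv_into UNIV t \<circ> Sigma_map \<Lambda> \<Omega> f \<sigma> \<circ> t) (g x) = g (\<sigma> x)"
      using x tg[OF x] tg[OF Sigma_closed[OF \<sigma> x]]
      by (simp add: Sigma_map_apply[OF f] permutes_inv_eq[OF tp])
  next
    fix y assume "y \<notin> pts \<Omega>"
    then show "(inv_into UNIV t \<circ> Sigma_map \<Lambda> \<Omega> f \<sigma> \<circ> t) y = y"
      by (simp add: Sigma_map_outside permutes_not_in[OF tp] permutes_not_in[OF permutes_inv[OF tp]])
  qed
  then show ?thesis using t by (intro bexI[OF _ t]) (simp add: Sigma_inv[OF t])
qed

section \<open>Meets, transports and disjoint unions of partitions\<close>

lemma pts_meet [simp]: "pts (ptn_meet \<Gamma> \<Lambda>) = pts \<Gamma> \<inter> pts \<Lambda>"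
  and rel_meet [simp]: "rel (ptn_meet \<Gamma> \<Lambda>) = rel \<Gamma> \<inter> rel \<Lambda>"
  by (transfer, auto)+

lemma pts_transport [simp]: "pts (transport \<sigma> \<Lambda>) = \<sigma> ` pts \<Lambda>"
  by transfer auto

lemma rel_transport:
  assumes "inj_on \<sigma> (pts \<Lambda>)"
  shows "rel (transport \<sigma> \<Lambda>) = map_prod \<sigma> \<sigma> ` rel \<Lambda>"
proof -
  have "rel (transport \<sigma> \<Lambda>) = {(y, y'). y \<in> \<sigma> ` pts \<Lambda> \<and> y' \<in> \<sigma> ` pts \<Lambda> \<and>
      (inv_into (pts \<Lambda>) \<sigma> y, inv_into (pts \<Lambda>) \<sigma> y') \<in> rel \<Lambda>}"
    by transfer auto
  also have "\<dots> = map_prod \<sigma> \<sigma> ` rel \<Lambda>"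
    using assms rel_pts[of _ _ \<Lambda>] by (auto simp: inv_into_f_f image_iff)
  finally show ?thesis .
qed

lemma isomorphism_transport:
  assumes "inj_on \<sigma> (pts \<Lambda>)"
  shows "isomorphism \<Lambda> (transport \<sigma> \<Lambda>) \<sigma>"
  unfolding isomorphism_def morphism_def
  using assms rel_pts[of _ _ \<Lambda>]
  by (auto simp: rel_transport bij_betw_def inv_into_f_f inj_on_inv_into)

lemma refines_transport:
  assumes f: "morphism \<Lambda> \<Omega> f" and "refines \<Gamma> \<Lambda>"
  shows "refines (transport f \<Gamma>) \<Omega>" "inj_on f (pts \<Gamma>)"
  using assms(2) morphismD[OF f] by (auto simp: refines_iff rel_transport)

text \<open>A bijection commutes with intersections, so \<open>\<sigma>\<close> carries the meet on
  the side of \<open>\<Lambda>\<close> to the meet on the side of \<open>\<Gamma>\<close>. Hence the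
  middle transfer in the double coset formula is along an isomorphism.\<close>

lemma transport_meet:
  assumes "refines \<Gamma> \<Omega>" "refines \<Lambda> \<Omega>" and \<sigma>: "\<sigma> \<in> carrier (Sigma_grp \<Omega>)"
  defines "\<Delta> \<equiv> ptn_meet (transport (inv_into UNIV \<sigma>) \<Gamma>) \<Lambda>" and "\<Delta>' \<equiv> ptn_meet \<Gamma> (transport \<sigma> \<Lambda>)"
  shows "isomorphism \<Delta> \<Delta>' \<sigma>" "refines \<Delta> \<Lambda>" "refines \<Delta>' \<Gamma>" "transport \<sigma> \<Delta> = \<Delta>'"
proof -
  have pts: "pts \<Gamma> = pts \<Omega>" "pts \<Lambda> = pts \<Omega>" using assms by (auto simp: refines_iff)
  note p = Sigma_permutes[OF \<sigma>]
  note inj = permutes_inj[OF p] permutes_inj[OF permutes_inv[OF p]]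
  have img: "\<sigma> ` pts \<Omega> = pts \<Omega>" "inv_into UNIV \<sigma> ` pts \<Omega> = pts \<Omega>"
    using permutes_image[OF p] permutes_image[OF permutes_inv[OF p]] by auto
  have inj_on: "inj_on \<sigma> S" "inj_on (inv_into UNIV \<sigma>) S" for S
    using inj inj_on_subset by blast+
  show "refines \<Delta> \<Lambda>" "refines \<Delta>' \<Gamma>"
    by (auto simp: refines_iff \<Delta>_def \<Delta>'_def pts img)
  have cancel: "map_prod \<sigma> \<sigma> ` map_prod (inv_into UNIV \<sigma>) (inv_into UNIV \<sigma>) ` r = r" for r
    by (simp add: image_image permutes_inverses(1)[OF p] map_prod_def split_def)
  have "rel \<Delta>' = map_prod \<sigma> \<sigma> ` rel \<Delta>"
    by (simp add: \<Delta>_def \<Delta>'_def rel_transport inj_on image_Int prod.inj_map inj cancel)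
  then show "transport \<sigma> \<Delta> = \<Delta>'"
    by (intro ptn_eqI) (simp_all add: rel_transport inj_on, simp add: \<Delta>_def \<Delta>'_def pts img)
  then show "isomorphism \<Delta> \<Delta>' \<sigma>" using isomorphism_transport[OF inj_on(1), of \<Delta>] by simp
qed

lemma isomorphismI:
  assumes "bij_betw f (pts \<Lambda>) (pts \<Omega>)"
    and "\<And>x y. x \<in> pts \<Lambda> \<Longrightarrow> y \<in> pts \<Lambda> \<Longrightarrow> (f x, f y) \<in> rel \<Omega> \<longleftrightarrow> (x, y) \<in> rel \<Lambda>"
  shows "isomorphism \<Lambda> \<Omega> f"
  unfolding isomorphism_def morphism_def
proof (intro conjI allI impI)
  show "(f x, f y) \<in> rel \<Omega>" if "(x, y) \<in> rel \<Lambda>" for x y using that assms(2) rel_pts[OF that] by simp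
  show "bij_betw (inv_into (pts \<Lambda>) f) (pts \<Omega>) (pts \<Lambda>)" by (rule bij_betw_inv_into[OF assms(1)])
  fix y y' assume "(y, y') \<in> rel \<Omega>"
  moreover from this have "y \<in> f ` pts \<Lambda>" "y' \<in> f ` pts \<Lambda>"
    using rel_pts[of y y' \<Omega>] assms(1) by (auto simp: bij_betw_def)
  then obtain x x' where "x \<in> pts \<Lambda>" "x' \<in> pts \<Lambda>" "y = f x" "y' = f x'" by (elim imageE)
  ultimately show "(inv_into (pts \<Lambda>) f y, inv_into (pts \<Lambda>) f y') \<in> rel \<Lambda>"
    using assms by (simp add: bij_betw_inv_into_left)
qed (rule assms(1))

lemma pts_sum [simp]: "pts (sum_ptn \<Lambda> \<Omega>) = InL ` pts \<Lambda> \<union> InR ` pts \<Omega>"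
  and rel_sum: "rel (sum_ptn \<Lambda> \<Omega>) = map_prod InL InL ` rel \<Lambda> \<union> map_prod InR InR ` rel \<Omega>"
  by (transfer, auto)+

lemma rel_sum_iff [simp]:
  "(InL x, InL x') \<in> rel (sum_ptn \<Lambda> \<Omega>) \<longleftrightarrow> (x, x') \<in> rel \<Lambda>"
  "(InR y, InR y') \<in> rel (sum_ptn \<Lambda> \<Omega>) \<longleftrightarrow> (y, y') \<in> rel \<Omega>"
  "(InL x, InR y) \<notin> rel (sum_ptn \<Lambda> \<Omega>)" "(InR y, InL x) \<notin> rel (sum_ptn \<Lambda> \<Omega>)"
  by (auto simp: rel_sum)

lemma empty_ptn_simps [simp]: "pts empty_ptn = {}" "rel empty_ptn = {}"
  by (transfer, auto)+

lemma isomorphism_unR: "isomorphism (sum_ptn empty_ptn \<Lambda>) \<Lambda> unR"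
  by (rule isomorphismI) (auto simp: bij_betw_def inj_on_def image_image)

lemma isomorphism_unL: "isomorphism (sum_ptn \<Lambda> empty_ptn) \<Lambda> unL"
  by (rule isomorphismI) (auto simp: bij_betw_def inj_on_def image_image)

lemma isomorphism_swap: "isomorphism (sum_ptn \<Lambda> \<Omega>) (sum_ptn \<Omega> \<Lambda>) swap_map"
  by (rule isomorphismI) (auto simp: bij_betw_def inj_on_def image_image image_Un)

lemma isomorphism_assoc:
  "isomorphism (sum_ptn (sum_ptn \<Lambda> \<Omega>) \<Gamma>) (sum_ptn \<Lambda> (sum_ptn \<Omega> \<Gamma>)) assoc_map"
  by (rule isomorphismI) (auto simp: bij_betw_def inj_on_def image_image image_Un Un_assoc)

lemma morphism_sum:
  assumes "morphism \<Lambda> \<Lambda>' f" "morphism \<Omega> \<Omega>' g"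
  shows "morphism (sum_ptn \<Lambda> \<Omega>) (sum_ptn \<Lambda>' \<Omega>') (sum_map f g)"
proof -
  note f = morphismD[OF assms(1)] and g = morphismD[OF assms(2)]
  have "sum_map f g ` (InL ` pts \<Lambda> \<union> InR ` pts \<Omega>) = InL ` pts \<Lambda>' \<union> InR ` pts \<Omega>'"
    by (simp add: image_Un image_image f(3)[symmetric] g(3)[symmetric])
  moreover have "inj_on (sum_map f g) (InL ` pts \<Lambda> \<union> InR ` pts \<Omega>)"
    by (auto intro!: inj_onI dest: inj_onD[OF f(2)] inj_onD[OF g(2)])
  ultimately show ?thesis
    using f(5) g(5) by (auto simp: morphism_def bij_betw_def rel_sum[of \<Lambda> \<Omega>])
qed

lemma sum_map_id: "sum_map id id = id"
proof
  show "sum_map id id x = id x" for x by (cases x) auto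
qed

lemma refines_sum: "refines \<Gamma> \<Lambda> \<Longrightarrow> refines \<Delta> \<Omega> \<Longrightarrow> refines (sum_ptn \<Gamma> \<Delta>) (sum_ptn \<Lambda> \<Omega>)"
  by (auto simp: refines_iff rel_sum)

text \<open>Blocks of a disjoint union lie in one summand, and points outside the partition are
  fixed, so the equations hold for all \<open>x\<close> and \<open>y\<close> and not only for points
  of the partition.\<close>

lemma Sigma_sum_apply:
  assumes "\<sigma> \<in> carrier (Sigma_grp (sum_ptn \<Lambda> \<Omega>))"
  shows "\<sigma> (InL x) = InL (left_part \<sigma> x)" "\<sigma> (InR y) = InR (right_part \<sigma> y)" "\<sigma> (Atom u) = Atom u"
proof -
  note p = Sigma_permutes[OF assms]
  have "(InL x, \<sigma> (InL x)) \<in> rel (sum_ptn \<Lambda> \<Omega>) \<or> \<sigma> (InL x) = InL x"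
    using Sigma_rel[OF assms, of "InL x"] permutes_not_in[OF p, of "InL x"] by auto
  then show "\<sigma> (InL x) = InL (left_part \<sigma> x)" by (auto simp: left_part_def rel_sum)
  have "(InR y, \<sigma> (InR y)) \<in> rel (sum_ptn \<Lambda> \<Omega>) \<or> \<sigma> (InR y) = InR y"
    using Sigma_rel[OF assms, of "InR y"] permutes_not_in[OF p, of "InR y"] by auto
  then show "\<sigma> (InR y) = InR (right_part \<sigma> y)" by (auto simp: right_part_def rel_sum)
  show "\<sigma> (Atom u) = Atom u" by (rule permutes_not_in[OF p]) auto
qed

text \<open>A block-preserving bijection moves each point inside its block, so as a morphism into
  \<open>\<Omega>\<close> it is 2-isomorphic to the identity. This is the source of equal transfers
  for conjugate refinements.\<close>

lemma morphism_Sigma: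
  assumes "refines \<Gamma> \<Omega>" and \<sigma>: "\<sigma> \<in> carrier (Sigma_grp \<Omega>)"
  shows "morphism \<Gamma> \<Omega> \<sigma>" "two_iso \<Gamma> \<Omega> \<sigma> id"
proof -
  have "(\<sigma> x, \<sigma> x') \<in> rel \<Omega>" if "(x, x') \<in> rel \<Gamma>" for x x'
  proof -
    have x: "(x, x') \<in> rel \<Omega>" using that assms(1) by (auto simp: refines_iff)
    then have "x \<in> pts \<Omega>" "x' \<in> pts \<Omega>" using rel_pts[OF x] by auto
    then show ?thesis using Sigma_rel[OF \<sigma>] x rel_sym rel_trans by metis
  qed
  then show "morphism \<Gamma> \<Omega> \<sigma>"
    using permutes_imp_bij[OF Sigma_permutes[OF \<sigma>]] assms(1) by (simp add: morphism_def refines_iff)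
  show "two_iso \<Gamma> \<Omega> \<sigma> id"
    using Sigma_rel[OF \<sigma>] assms(1) by (auto simp: two_iso_def refines_iff intro: rel_sym)
qed

text \<open>The inverse of the pair of projections is \<open>sum_map\<close>, which is the identity
  on atoms just as every element of the group is.\<close>

lemma Sigma_sum_product:
  "group_product (Sigma_grp (sum_ptn \<Lambda> \<Omega>)) (Sigma_grp \<Lambda>) (Sigma_grp \<Omega>) left_part right_part"
proof -
  let ?S = "Sigma_grp (sum_ptn \<Lambda> \<Omega>)"
  have perm: "left_part \<sigma> permutes pts \<Lambda>" "right_part \<sigma> permutes pts \<Omega>" if \<sigma>: "\<sigma> \<in> carrier ?S" for \<sigma>
  proof -
    note app = Sigma_sum_apply[OF \<sigma>] and p = Sigma_permutes[OF \<sigma>]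
    have inj: "inj_on (left_part \<sigma>) (pts \<Lambda>)" "inj_on (right_part \<sigma>) (pts \<Omega>)"
    proof -
      have l: "x = y" if "left_part \<sigma> x = left_part \<sigma> y" for x y
        using injD[OF permutes_inj[OF p], of "InL x" "InL y"] that by (simp add: app)
      have r: "x = y" if "right_part \<sigma> x = right_part \<sigma> y" for x y
        using injD[OF permutes_inj[OF p], of "InR x" "InR y"] that by (simp add: app)
      show "inj_on (left_part \<sigma>) (pts \<Lambda>)" by (rule inj_onI) (rule l)
      show "inj_on (right_part \<sigma>) (pts \<Omega>)" by (rule inj_onI) (rule r)
    qed
    have "left_part \<sigma> ` pts \<Lambda> \<subseteq> pts \<Lambda>" "right_part \<sigma> ` pts \<Omega> \<subseteq> pts \<Omega>"
    proof -
      have "left_part \<sigma> x \<in> pts \<Lambda>" if "x \<in> pts \<Lambda>" for x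
        using Sigma_closed[OF \<sigma>, of "InL x"] that by (auto simp: app)
      moreover have "right_part \<sigma> x \<in> pts \<Omega>" if "x \<in> pts \<Omega>" for x
        using Sigma_closed[OF \<sigma>, of "InR x"] that by (auto simp: app)
      ultimately show "left_part \<sigma> ` pts \<Lambda> \<subseteq> pts \<Lambda>" "right_part \<sigma> ` pts \<Omega> \<subseteq> pts \<Omega>" by auto
    qed
    then have "bij_betw (left_part \<sigma>) (pts \<Lambda>) (pts \<Lambda>)" "bij_betw (right_part \<sigma>) (pts \<Omega>) (pts \<Omega>)"
      using inj by (simp_all add: bij_betw_def endo_inj_surj finite_pts)
    moreover have "left_part \<sigma> x = x" if "x \<notin> pts \<Lambda>" for x
      using permutes_not_in[OF p, of "InL x"] that by (simp add: left_part_def image_iff)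
    moreover have "right_part \<sigma> x = x" if "x \<notin> pts \<Omega>" for x
      using permutes_not_in[OF p, of "InR x"] that by (simp add: right_part_def image_iff)
    ultimately show "left_part \<sigma> permutes pts \<Lambda>" "right_part \<sigma> permutes pts \<Omega>"
      by (auto intro: bij_imp_permutes)
  qed
  have closed: "left_part \<sigma> \<in> carrier (Sigma_grp \<Lambda>)" "right_part \<sigma> \<in> carrier (Sigma_grp \<Omega>)"
    if \<sigma>: "\<sigma> \<in> carrier ?S" for \<sigma>
  proof -
    have "(x, left_part \<sigma> x) \<in> rel \<Lambda>" if "x \<in> pts \<Lambda>" for x
      using Sigma_rel[OF \<sigma>, of "InL x"] that by (simp add: Sigma_sum_apply[OF \<sigma>])
    moreover have "(y, right_part \<sigma> y) \<in> rel \<Omega>" if "y \<in> pts \<Omega>" for y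
      using Sigma_rel[OF \<sigma>, of "InR y"] that by (simp add: Sigma_sum_apply[OF \<sigma>])
    ultimately show "left_part \<sigma> \<in> carrier (Sigma_grp \<Lambda>)" "right_part \<sigma> \<in> carrier (Sigma_grp \<Omega>)"
      using perm[OF \<sigma>] by (simp_all add: Sigma_iff)
  qed
  have "left_part (\<sigma> \<circ> \<tau>) = left_part \<sigma> \<circ> left_part \<tau>"
    "right_part (\<sigma> \<circ> \<tau>) = right_part \<sigma> \<circ> right_part \<tau>"
    if "\<sigma> \<in> carrier ?S" "\<tau> \<in> carrier ?S" for \<sigma> \<tau>
    using Sigma_sum_apply[OF that(1)] Sigma_sum_apply[OF that(2)]
    by (simp_all add: fun_eq_iff left_part_def[of "\<sigma> \<circ> \<tau>"] right_part_def[of "\<sigma> \<circ> \<tau>"])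
  then have "left_part \<in> hom ?S (Sigma_grp \<Lambda>)" "right_part \<in> hom ?S (Sigma_grp \<Omega>)"
    by (auto intro!: homI simp: closed)
  moreover have "bij_betw (\<lambda>\<sigma>. (left_part \<sigma>, right_part \<sigma>)) (carrier ?S)
      (carrier (Sigma_grp \<Lambda>) \<times> carrier (Sigma_grp \<Omega>))"
  proof (rule bij_betwI[where g="\<lambda>(a, b). sum_map a b"])
    show "(\<lambda>(a, b). sum_map a b) \<in> carrier (Sigma_grp \<Lambda>) \<times> carrier (Sigma_grp \<Omega>) \<rightarrow> carrier ?S"
    proof clarify
      fix a b assume a: "a \<in> carrier (Sigma_grp \<Lambda>)" and b: "b \<in> carrier (Sigma_grp \<Omega>)"
      have m: "morphism \<Lambda> \<Lambda> a" "morphism \<Omega> \<Omega> b"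
        using morphism_Sigma[OF refines_refl] a b by blast+
      have "bij_betw (sum_map a b) (pts (sum_ptn \<Lambda> \<Omega>)) (pts (sum_ptn \<Lambda> \<Omega>))"
        by (rule morphismD(1)[OF morphism_sum[OF m]])
      then have "sum_map a b permutes pts (sum_ptn \<Lambda> \<Omega>)"
      proof (rule bij_imp_permutes)
        show "sum_map a b x = x" if "x \<notin> pts (sum_ptn \<Lambda> \<Omega>)" for x
          using that permutes_not_in[OF Sigma_permutes[OF a]] permutes_not_in[OF Sigma_permutes[OF b]]
          by (cases x) auto
      qed
      then show "sum_map a b \<in> carrier ?S"
        using Sigma_rel[OF a] Sigma_rel[OF b] by (auto simp: Sigma_iff)
    qed
    show "(\<lambda>(a, b). sum_map a b) (left_part \<sigma>, right_part \<sigma>) = \<sigma>" if "\<sigma> \<in> carrier ?S" for \<sigma>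
    proof
      show "(\<lambda>(a, b). sum_map a b) (left_part \<sigma>, right_part \<sigma>) x = \<sigma> x" for x
        using Sigma_sum_apply[OF that] by (cases x) auto
    qed
  qed (auto simp: closed left_part_def right_part_def)
  ultimately show ?thesis
    by (intro group_product.intro group_product_axioms.intro finite_group_hom.intro
        finite_group_hom_axioms.intro finite_group_Sigma)
qed

interpretation Sum: group_product "Sigma_grp (sum_ptn \<Lambda> \<Omega>)" "Sigma_grp \<Lambda>" "Sigma_grp \<Omega>" left_part right_part
  for \<Lambda> \<Omega>
  by (rule Sigma_sum_product)

lemma parts_Sigma_map_sum:
  assumes f: "morphism \<Lambda> \<Lambda>' f" and g: "morphism \<Omega> \<Omega>' g"
    and \<sigma>: "\<sigma> \<in> carrier (Sigma_grp (sum_ptn \<Lambda> \<Omega>))"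
  shows "left_part (Sigma_map (sum_ptn \<Lambda> \<Omega>) (sum_ptn \<Lambda>' \<Omega>') (sum_map f g) \<sigma>) =
      Sigma_map \<Lambda> \<Lambda>' f (left_part \<sigma>)"
    "right_part (Sigma_map (sum_ptn \<Lambda> \<Omega>) (sum_ptn \<Lambda>' \<Omega>') (sum_map f g) \<sigma>) =
      Sigma_map \<Omega> \<Omega>' g (right_part \<sigma>)"
proof -
  let ?\<tau> = "Sigma_map (sum_ptn \<Lambda> \<Omega>) (sum_ptn \<Lambda>' \<Omega>') (sum_map f g) \<sigma>"
  note app = Sigma_map_apply[OF morphism_sum[OF f g], where \<sigma>=\<sigma>]
  have "left_part ?\<tau> (f x) = f (left_part \<sigma> x)" if "x \<in> pts \<Lambda>" for x
    using that app[of "InL x"] by (simp add: left_part_def[of ?\<tau>] Sigma_sum_apply(1)[OF \<sigma>])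
  then show "left_part ?\<tau> = Sigma_map \<Lambda> \<Lambda>' f (left_part \<sigma>)"
    by (intro sym[OF Sigma_map_eqI[OF f]]) (simp_all add: left_part_def[of ?\<tau>] Sigma_map_outside image_iff)
  have "right_part ?\<tau> (g x) = g (right_part \<sigma> x)" if "x \<in> pts \<Omega>" for x
    using that app[of "InR x"] by (simp add: right_part_def[of ?\<tau>] Sigma_sum_apply(2)[OF \<sigma>])
  then show "right_part ?\<tau> = Sigma_map \<Omega> \<Omega>' g (right_part \<sigma>)"
    by (intro sym[OF Sigma_map_eqI[OF g]]) (simp_all add: right_part_def[of ?\<tau>] Sigma_map_outside image_iff)
qed

lemma isomorphism_morphism: "isomorphism \<Lambda> \<Omega> f \<Longrightarrow> morphism \<Lambda> \<Omega> f"
  by (simp add: isomorphism_def)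

lemma Sigma_map_unR:
  assumes \<sigma>: "\<sigma> \<in> carrier (Sigma_grp (sum_ptn empty_ptn \<Lambda>))"
  shows "Sigma_map (sum_ptn empty_ptn \<Lambda>) \<Lambda> unR \<sigma> = right_part \<sigma>"
  by (rule Sigma_map_eqI[OF isomorphism_morphism[OF isomorphism_unR]])
    (auto simp: Sigma_sum_apply[OF \<sigma>] permutes_not_in[OF Sigma_permutes[OF Sum.right.hom_closed[OF \<sigma>]]])

lemma Sigma_map_unL:
  assumes \<sigma>: "\<sigma> \<in> carrier (Sigma_grp (sum_ptn \<Lambda> empty_ptn))"
  shows "Sigma_map (sum_ptn \<Lambda> empty_ptn) \<Lambda> unL \<sigma> = left_part \<sigma>"
  by (rule Sigma_map_eqI[OF isomorphism_morphism[OF isomorphism_unL]])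
    (auto simp: Sigma_sum_apply[OF \<sigma>] permutes_not_in[OF Sigma_permutes[OF Sum.left.hom_closed[OF \<sigma>]]])

lemma parts_Sigma_map_swap:
  assumes \<sigma>: "\<sigma> \<in> carrier (Sigma_grp (sum_ptn \<Lambda> \<Omega>))"
  shows "left_part (Sigma_map (sum_ptn \<Lambda> \<Omega>) (sum_ptn \<Omega> \<Lambda>) swap_map \<sigma>) = right_part \<sigma>" (is "left_part ?s = _")
    "right_part (Sigma_map (sum_ptn \<Lambda> \<Omega>) (sum_ptn \<Omega> \<Lambda>) swap_map \<sigma>) = left_part \<sigma>"
proof -
  note m = isomorphism_morphism[OF isomorphism_swap, of \<Lambda> \<Omega>]
  have eq: "?s = sum_map (right_part \<sigma>) (left_part \<sigma>)"
  proof (rule Sigma_map_eqI[OF m])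
    show "sum_map (right_part \<sigma>) (left_part \<sigma>) (swap_map x) = swap_map (\<sigma> x)" for x
      by (cases x) (auto simp: Sigma_sum_apply[OF \<sigma>])
    show "sum_map (right_part \<sigma>) (left_part \<sigma>) y = y" if "y \<notin> pts (sum_ptn \<Omega> \<Lambda>)" for y
      using that permutes_not_in[OF Sigma_permutes[OF Sum.left.hom_closed[OF \<sigma>]]]
        permutes_not_in[OF Sigma_permutes[OF Sum.right.hom_closed[OF \<sigma>]]]
      by (cases y) auto
  qed
  show "left_part ?s = right_part \<sigma>" "right_part ?s = left_part \<sigma>"
    unfolding eq by (auto simp: left_part_def right_part_def)
qed

lemma parts_Sigma_map_assoc:
  assumes \<sigma>: "\<sigma> \<in> carrier (Sigma_grp (sum_ptn (sum_ptn \<Lambda> \<Omega>) \<Gamma>))"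
  defines "\<tau> \<equiv> Sigma_map (sum_ptn (sum_ptn \<Lambda> \<Omega>) \<Gamma>) (sum_ptn \<Lambda> (sum_ptn \<Omega> \<Gamma>)) assoc_map \<sigma>"
  shows "left_part \<tau> = left_part (left_part \<sigma>)"
    "left_part (right_part \<tau>) = right_part (left_part \<sigma>)"
    "right_part (right_part \<tau>) = right_part \<sigma>"
proof -
  note m = isomorphism_morphism[OF isomorphism_assoc, of \<Lambda> \<Omega> \<Gamma>]
  note \<sigma>l = Sum.left.hom_closed[OF \<sigma>]
  define a b c where "a = left_part (left_part \<sigma>)" and "b = right_part (left_part \<sigma>)"
    and "c = right_part \<sigma>"
  note not_in = Sum.left.hom_closed[OF \<sigma>l, THEN Sigma_permutes, THEN permutes_not_in, folded a_def]
    Sum.right.hom_closed[OF \<sigma>l, THEN Sigma_permutes, THEN permutes_not_in, folded b_def]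
    Sum.right.hom_closed[OF \<sigma>, THEN Sigma_permutes, THEN permutes_not_in, folded c_def]
  note apps = Sigma_sum_apply[OF \<sigma>, folded c_def] Sigma_sum_apply[OF \<sigma>l, folded a_def b_def]
  have eq: "\<tau> = sum_map a (sum_map b c)"
    unfolding \<tau>_def
  proof (rule Sigma_map_eqI[OF m])
    show "sum_map a (sum_map b c) (assoc_map x) = assoc_map (\<sigma> x)"
      if "x \<in> pts (sum_ptn (sum_ptn \<Lambda> \<Omega>) \<Gamma>)" for x
      using that by (auto simp: apps)
    show "sum_map a (sum_map b c) y = y" if "y \<notin> pts (sum_ptn \<Lambda> (sum_ptn \<Omega> \<Gamma>))" for y
    proof (cases y)
      case (InR z)
      then show ?thesis using that not_in by (cases z) (auto simp: image_iff)
    qed (use that not_in in auto)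
  qed
  show "left_part \<tau> = a" "left_part (right_part \<tau>) = b" "right_part (right_part \<tau>) = c"
    unfolding eq by (auto simp: left_part_def right_part_def)
qed

section \<open>The partition ring of full Burnside rings\<close>

abbreviation Burn :: "'a ptn \<Rightarrow> ('a \<Rightarrow> 'a) burnside ring" where
  "Burn \<Lambda> \<equiv> burnside_ring (Sigma_grp \<Lambda>)"

abbreviation Burn_res :: "'a ptn \<Rightarrow> 'b ptn \<Rightarrow> ('a \<Rightarrow> 'b) \<Rightarrow> ('b \<Rightarrow> 'b) burnside \<Rightarrow> ('a \<Rightarrow> 'a) burnside" where
  "Burn_res \<Lambda> \<Omega> f \<equiv> burnside_res (Sigma_grp \<Lambda>) (Sigma_map \<Lambda> \<Omega> f)"

abbreviation Burn_tr :: "'a ptn \<Rightarrow> 'b ptn \<Rightarrow> ('a \<Rightarrow> 'b) \<Rightarrow> ('a \<Rightarrow> 'a) burnside \<Rightarrow> ('b \<Rightarrow> 'b) burnside" where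
  "Burn_tr \<Lambda> \<Omega> f \<equiv> burnside_ind (Sigma_grp \<Lambda>) (Sigma_grp \<Omega>) (Sigma_map \<Lambda> \<Omega> f)"

lemmas Burn_res_eqI = finite_group_hom.burnside_res_eqI[OF Sigma_map_hom]
  and Burn_res_closed = finite_group_hom.burnside_res(1)[OF Sigma_map_hom]
  and bmark_Burn_res = finite_group_hom.burnside_res(2)[OF Sigma_map_hom]
  and Burn_res_ring_hom = finite_group_hom.burnside_res_ring_hom[OF Sigma_map_hom]
  and Burn_tr_closed = finite_group_inj.burnside_ind(1)[OF Sigma_map_inj]
  and Burn_tr_add = finite_group_inj.burnside_ind_add[OF Sigma_map_inj]

interpretation Burn: cring "Burn \<Lambda>" for \<Lambda>
  by (rule Sigma.cring_burnside_ring)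

lemma (in finite_group) bmark_hom:
  assumes "subgroup K G"
  shows "(\<lambda>A. bmark A K) \<in> hom (add_monoid (burnside_ring G)) integer_group"
  by (rule homI) (simp_all add: burnside_add assms)

lemma (in finite_group) bmark_add_pow:
  fixes n :: int
  assumes "A \<in> carrier (burnside_ring G)" "subgroup K G"
  shows "bmark ([n] \<cdot>\<^bsub>burnside_ring G\<^esub> A) K = n * bmark A K"
proof -
  interpret cring "burnside_ring G" by (rule cring_burnside_ring)
  show ?thesis
    using hom_int_pow[OF bmark_hom[OF assms(2)], of A n] assms(1) a_group
    by (simp add: add_pow_def)
qed

lemma (in finite_group) bmark_finsum:
  assumes "f \<in> S \<rightarrow> carrier (burnside_ring G)" "subgroup K G"
  shows "bmark (\<Oplus>\<^bsub>burnside_ring G\<^esub> x \<in> S. f x) K = (\<Sum>x \<in> S. bmark (f x) K)"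
proof -
  interpret cring "burnside_ring G" by (rule cring_burnside_ring)
  show ?thesis
    using assms(1)
  proof (induction S rule: infinite_finite_induct)
    case (infinite S)
    then show ?case using assms(2) by (simp add: add.finprod_infinite burnside_zero)
  next
    case (insert x S)
    then have f: "f \<in> S \<rightarrow> carrier (burnside_ring G)" "f x \<in> carrier (burnside_ring G)" by auto
    then show ?case
      using insert assms(2) finsum_closed[OF f(1)] by (simp add: finsum_insert burnside_add)
  qed (simp add: burnside_zero assms(2))
qed

lemma Burn_tr_id:
  assumes "refines \<Lambda> \<Omega>"
  shows "Burn_tr \<Lambda> \<Omega> id \<one>\<^bsub>Burn \<Lambda>\<^esub> =
    gclass (Sigma_grp \<Omega>) (gset_cosets (Sigma_grp \<Omega>) (carrier (Sigma_grp \<Lambda>)))"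
  using finite_group_inj.burnside_ind_one[OF Sigma_map_inj[OF morphism_id[OF assms]]]
  by (simp add: Sigma_map_id[OF assms] cong: image_cong)

lemma Burn_res_comp:
  assumes "morphism \<Gamma> \<Lambda> f" "morphism \<Lambda> \<Omega> g" "A \<in> carrier (Burn \<Omega>)"
  shows "Burn_res \<Gamma> \<Omega> (g \<circ> f) A = Burn_res \<Gamma> \<Lambda> f (Burn_res \<Lambda> \<Omega> g A)"
  using assms morphism_comp[OF assms(1,2)]
  by (intro burnside_res_comp[where L="Sigma_grp \<Omega>"] Sigma_map_hom) (simp_all add: Sigma_map_comp)

lemma Burn_tr_comp:
  assumes "morphism \<Gamma> \<Lambda> f" "morphism \<Lambda> \<Omega> g" "A \<in> carrier (Burn \<Gamma>)"
  shows "Burn_tr \<Gamma> \<Omega> (g \<circ> f) A = Burn_tr \<Lambda> \<Omega> g (Burn_tr \<Gamma> \<Lambda> f A)"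
  using assms morphism_comp[OF assms(1,2)]
  by (intro burnside_ind_comp Sigma_map_inj) (simp_all add: Sigma_map_comp)

lemma Burn_tr_iso:
  assumes "isomorphism \<Lambda> \<Omega> f" "A \<in> carrier (Burn \<Lambda>)"
  shows "Burn_tr \<Lambda> \<Omega> f A = Burn_res \<Omega> \<Lambda> (inv_into (pts \<Lambda>) f) A"
  using assms isomorphism_inv_into[OF assms(1)]
  by (intro burnside_ind_iso Sigma_map_inj Sigma_map_hom)
    (simp_all add: isomorphism_morphism Sigma_map_surj Sigma_map_inv_into)

text \<open>For isomorphisms an equation about a transfer is turned into one about a restriction,
  whose marks need no summation. It serves the identity and the associativity, symmetry and unit
  isomorphisms.\<close>

lemma Burn_tr_eqI:
  assumes f: "isomorphism \<Lambda> \<Omega> f" and A: "A \<in> carrier (Burn \<Omega>)" and "Burn_res \<Lambda> \<Omega> f A = B"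
  shows "Burn_tr \<Lambda> \<Omega> f B = A"
proof -
  let ?g = "inv_into (pts \<Lambda>) f"
  have m: "morphism \<Lambda> \<Omega> f" "morphism \<Omega> \<Lambda> ?g" using f by (auto simp: isomorphism_def)
  have B: "B \<in> carrier (Burn \<Lambda>)" using assms m Burn_res_closed by blast
  have eq: "Sigma_map \<Lambda> \<Omega> f (Sigma_map \<Omega> \<Lambda> ?g \<sigma>) = \<sigma>" if "\<sigma> \<in> carrier (Sigma_grp \<Omega>)" for \<sigma>
  proof -
    obtain \<tau> where "\<tau> \<in> carrier (Sigma_grp \<Lambda>)" "\<sigma> = Sigma_map \<Lambda> \<Omega> f \<tau>"
      using \<open>\<sigma> \<in> _\<close> Sigma_map_surj[OF f] by blast
    then show ?thesis by (simp add: Sigma_map_inv_into[OF f])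
  qed
  have "Burn_res \<Omega> \<Lambda> ?g B = A"
  proof (rule Burn_res_eqI[OF m(2) B A])
    fix K assume K: "subgroup K (Sigma_grp \<Omega>)"
    interpret g: finite_group_inj "Sigma_grp \<Omega>" "Sigma_grp \<Lambda>" "Sigma_map \<Omega> \<Lambda> ?g"
      by (rule Sigma_map_inj[OF m(2)])
    have "Sigma_map \<Lambda> \<Omega> f ` Sigma_map \<Omega> \<Lambda> ?g ` K = K"
    proof -
      have "Sigma_map \<Lambda> \<Omega> f ` Sigma_map \<Omega> \<Lambda> ?g ` K = (\<lambda>\<sigma>. \<sigma>) ` K"
        unfolding image_image using eq subgroup.subset[OF K] by (intro image_cong) auto
      then show ?thesis by simp
    qed
    then show "bmark B (Sigma_map \<Omega> \<Lambda> ?g ` K) = bmark A K"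
      using assms(3) A bmark_Burn_res[OF m(1) A g.subgroup_img_is_subgroup[OF K]] by simp
  qed
  then show ?thesis using Burn_tr_iso[OF f B] by simp
qed

lemma Burn_two_iso:
  assumes "morphism \<Lambda> \<Omega> f" "morphism \<Lambda> \<Omega> g" "two_iso \<Lambda> \<Omega> f g"
  shows "A \<in> carrier (Burn \<Omega>) \<Longrightarrow> Burn_res \<Lambda> \<Omega> f A = Burn_res \<Lambda> \<Omega> g A"
    "B \<in> carrier (Burn \<Lambda>) \<Longrightarrow> Burn_tr \<Lambda> \<Omega> f B = Burn_tr \<Lambda> \<Omega> g B"
proof -
  obtain t where t: "t \<in> carrier (Sigma_grp \<Omega>)"
    "\<And>\<sigma>. \<sigma> \<in> carrier (Sigma_grp \<Lambda>) \<Longrightarrow> Sigma_map \<Lambda> \<Omega> g \<sigma> =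
      inv\<^bsub>Sigma_grp \<Omega>\<^esub> t \<otimes>\<^bsub>Sigma_grp \<Omega>\<^esub> Sigma_map \<Lambda> \<Omega> f \<sigma> \<otimes>\<^bsub>Sigma_grp \<Omega>\<^esub> t"
    using two_iso_conj[OF assms] by blast
  show "A \<in> carrier (Burn \<Omega>) \<Longrightarrow> Burn_res \<Lambda> \<Omega> f A = Burn_res \<Lambda> \<Omega> g A"
    by (rule burnside_res_conj[OF Sigma_map_hom[OF assms(1)] Sigma_map_hom[OF assms(2)] t, symmetric])
  show "B \<in> carrier (Burn \<Lambda>) \<Longrightarrow> Burn_tr \<Lambda> \<Omega> f B = Burn_tr \<Lambda> \<Omega> g B"
    by (rule burnside_ind_conj[OF Sigma_map_inj[OF assms(1)] Sigma_map_inj[OF assms(2)] t, symmetric])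
qed

text \<open>The group of the meet of \<Gamma> with the transport of \<Lambda> is the intersection of
  the group of \<Gamma> with the conjugate by \<sigma> of the group of \<Lambda>. This is the
  pullback asked for by \<open>conj_pullback\<close>, with the inclusion and conjugation by the
  inverse of \<sigma> as its two projections.\<close>

lemma Burn_double_coset:
  assumes \<Gamma>: "refines \<Gamma> \<Omega>" and \<Lambda>: "refines \<Lambda> \<Omega>" and A: "A \<in> carrier (Burn \<Lambda>)"
    and \<sigma>: "\<forall>D \<in> double_cosets (Sigma_grp \<Omega>) (carrier (Sigma_grp \<Gamma>)) (carrier (Sigma_grp \<Lambda>)). \<sigma> D \<in> D"
  shows "Burn_res \<Gamma> \<Omega> id (Burn_tr \<Lambda> \<Omega> id A) =
      (\<Oplus>\<^bsub>Burn \<Gamma>\<^esub> D \<in> double_cosets (Sigma_grp \<Omega>) (carrier (Sigma_grp \<Gamma>)) (carrier (Sigma_grp \<Lambda>)).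
         Burn_tr (ptn_meet \<Gamma> (transport (\<sigma> D) \<Lambda>)) \<Gamma> id
          (Burn_tr (ptn_meet (transport (inv_into UNIV (\<sigma> D)) \<Gamma>) \<Lambda>) (ptn_meet \<Gamma> (transport (\<sigma> D) \<Lambda>)) (\<sigma> D)
            (Burn_res (ptn_meet (transport (inv_into UNIV (\<sigma> D)) \<Gamma>) \<Lambda>) \<Lambda> id A)))"
proof -
  let ?DC = "double_cosets (Sigma_grp \<Omega>) (carrier (Sigma_grp \<Gamma>)) (carrier (Sigma_grp \<Lambda>))"
  \<comment> \<open>Here \<open>g D\<close> inverts the representative \<open>\<sigma> D\<close> on
    the points of the partition.\<close>
  define \<Delta> \<Delta>' g where "\<Delta> D = ptn_meet (transport (inv_into UNIV (\<sigma> D)) \<Gamma>) \<Lambda>"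
    and "\<Delta>' D = ptn_meet \<Gamma> (transport (\<sigma> D) \<Lambda>)" and "g D = inv_into (pts (\<Delta> D)) (\<sigma> D)" for D
  note m\<Gamma> = morphism_id[OF \<Gamma>] and m\<Lambda> = morphism_id[OF \<Lambda>]
  interpret h1: finite_group_inj "Sigma_grp \<Gamma>" "Sigma_grp \<Omega>" "Sigma_map \<Gamma> \<Omega> id"
    by (rule Sigma_map_inj[OF m\<Gamma>])
  interpret h2: finite_group_inj "Sigma_grp \<Lambda>" "Sigma_grp \<Omega>" "Sigma_map \<Lambda> \<Omega> id"
    by (rule Sigma_map_inj[OF m\<Lambda>])
  have img: "Sigma_map \<Gamma> \<Omega> id ` carrier (Sigma_grp \<Gamma>) = carrier (Sigma_grp \<Gamma>)"
    "Sigma_map \<Lambda> \<Omega> id ` carrier (Sigma_grp \<Lambda>) = carrier (Sigma_grp \<Lambda>)"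
    by (simp_all add: Sigma_map_id[OF \<Gamma>] Sigma_map_id[OF \<Lambda>] cong: image_cong)
  note sub = h1.img_is_subgroup[unfolded img] h2.img_is_subgroup[unfolded img]
  have \<sigma>_in: "\<sigma> D \<in> carrier (Sigma_grp \<Omega>)" if "D \<in> ?DC" for D
    using Sigma.double_cosets_partition(3)[OF sub that] \<sigma> that by blast
  note tm = transport_meet[OF \<Gamma> \<Lambda> \<sigma>_in, folded \<Delta>_def \<Delta>'_def]
  have g: "morphism (\<Delta>' D) (\<Delta> D) (g D)" "morphism (\<Delta>' D) \<Lambda> (g D)" if "D \<in> ?DC" for D
  proof -
    show *: "morphism (\<Delta>' D) (\<Delta> D) (g D)" using tm(1)[OF that] by (simp add: isomorphism_def g_def)
    show "morphism (\<Delta>' D) \<Lambda> (g D)" using morphism_comp[OF * morphism_id[OF tm(2)[OF that]]] by simp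
  qed
  \<comment> \<open>The middle transfer is along an isomorphism, hence a restriction along
    \<open>g D\<close>; it merges with the restriction next to it, which leaves one restriction
    followed by one transfer.\<close>
  have term_eq: "Burn_tr (\<Delta>' D) \<Gamma> id (Burn_tr (\<Delta> D) (\<Delta>' D) (\<sigma> D) (Burn_res (\<Delta> D) \<Lambda> id A)) =
      Burn_tr (\<Delta>' D) \<Gamma> id (Burn_res (\<Delta>' D) \<Lambda> (g D) A)" if D: "D \<in> ?DC" for D
    using Burn_tr_iso[OF tm(1)[OF D] Burn_res_closed[OF morphism_id[OF tm(2)[OF D]] A]]
      Burn_res_comp[OF g(1)[OF D] morphism_id[OF tm(2)[OF D]] A] by (simp add: g_def)
  have closed: "Burn_tr (\<Delta>' D) \<Gamma> id (Burn_res (\<Delta>' D) \<Lambda> (g D) A) \<in> carrier (Burn \<Gamma>)" if "D \<in> ?DC" for D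
    using A g(2)[OF that] morphism_id[OF tm(3)[OF that]] by (intro Burn_tr_closed Burn_res_closed)
  have pb: "conj_pullback (Sigma_grp \<Gamma>) (Sigma_grp \<Lambda>) (Sigma_grp \<Omega>) (Sigma_grp (\<Delta>' D))
      (Sigma_map \<Gamma> \<Omega> id) (Sigma_map \<Lambda> \<Omega> id) (Sigma_map (\<Delta>' D) \<Gamma> id) (Sigma_map (\<Delta>' D) \<Lambda> (g D)) (\<sigma> D)"
    if D: "D \<in> ?DC" for D
  proof -
    note s = \<sigma>_in[OF D] and p = Sigma_permutes[OF \<sigma>_in[OF D]]
    have pts: "pts \<Gamma> = pts \<Omega>" "pts \<Lambda> = pts \<Omega>" "pts (\<Delta>' D) = pts \<Omega>" "pts (\<Delta> D) = pts \<Omega>"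
      using \<Gamma> \<Lambda> tm(2,3)[OF D] by (auto simp: refines_iff)
    have gx: "g D (\<sigma> D x) = x" if "x \<in> pts \<Omega>" for x
      using that permutes_inj_on[OF p] by (simp add: g_def pts inv_into_f_f)
    have "inj_on (\<sigma> D) (pts \<Lambda>)" by (rule permutes_inj_on[OF p])
    then have rel\<Delta>': "rel (\<Delta>' D) = rel \<Gamma> \<inter> map_prod (\<sigma> D) (\<sigma> D) ` rel \<Lambda>"
      by (simp add: \<Delta>'_def rel_transport)
    have comm: "c \<circ> \<sigma> D = \<sigma> D \<circ> Sigma_map (\<Delta>' D) \<Lambda> (g D) c" if c: "c \<in> carrier (Sigma_grp (\<Delta>' D))" for c
    proof
      fix x
      show "(c \<circ> \<sigma> D) x = (\<sigma> D \<circ> Sigma_map (\<Delta>' D) \<Lambda> (g D) c) x"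
      proof (cases "x \<in> pts \<Omega>")
        case True
        then have "\<sigma> D x \<in> pts (\<Delta>' D)" by (simp add: pts Sigma_closed[OF s])
        then have "Sigma_map (\<Delta>' D) \<Lambda> (g D) c x = g D (c (\<sigma> D x))" "c (\<sigma> D x) \<in> pts \<Omega>"
          using Sigma_map_apply[OF g(2)[OF D], of "\<sigma> D x" c] gx[OF True] Sigma_closed[OF c] by (simp_all add: pts)
        moreover obtain z where "z \<in> pts \<Omega>" "c (\<sigma> D x) = \<sigma> D z"
          using \<open>c (\<sigma> D x) \<in> pts \<Omega>\<close> permutes_image[OF p] by blast
        ultimately show ?thesis by (simp add: gx)
      next
        case False
        then show ?thesis
          using permutes_not_in[OF p] permutes_not_in[OF Sigma_permutes[OF c]]
          by (simp add: Sigma_map_outside pts)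
      qed
    qed
    have id\<Delta>: "Sigma_map (\<Delta>' D) \<Gamma> id c = c" if "c \<in> carrier (Sigma_grp (\<Delta>' D))" for c
      by (rule Sigma_map_id[OF tm(3)[OF D] that])
    have c_in: "c \<in> carrier (Sigma_grp \<Gamma>)" if "c \<in> carrier (Sigma_grp (\<Delta>' D))" for c
      using finite_group_hom.hom[OF Sigma_map_hom[OF morphism_id[OF tm(3)[OF D]]]] id\<Delta>[OF that] that
      by (metis hom_in_carrier)
    have q_in: "Sigma_map (\<Delta>' D) \<Lambda> (g D) c \<in> carrier (Sigma_grp \<Lambda>)" if "c \<in> carrier (Sigma_grp (\<Delta>' D))" for c
      using finite_group_hom.hom[OF Sigma_map_hom[OF g(2)[OF D]]] that by (rule hom_in_carrier)
    show ?thesis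
    proof (intro conj_pullback.intro conj_pullback_axioms.intro Sigma_map_inj m\<Gamma> m\<Lambda> g(2)[OF D]
        morphism_id[OF tm(3)[OF D]] s)
      fix c assume c: "c \<in> carrier (Sigma_grp (\<Delta>' D))"
      show "Sigma_map \<Gamma> \<Omega> id (Sigma_map (\<Delta>' D) \<Gamma> id c) \<otimes>\<^bsub>Sigma_grp \<Omega>\<^esub> \<sigma> D =
          \<sigma> D \<otimes>\<^bsub>Sigma_grp \<Omega>\<^esub> Sigma_map \<Lambda> \<Omega> id (Sigma_map (\<Delta>' D) \<Lambda> (g D) c)"
        using comm[OF c] by (simp add: id\<Delta>[OF c] Sigma_map_id[OF \<Gamma> c_in[OF c]] Sigma_map_id[OF \<Lambda> q_in[OF c]])
    next
      fix a b assume a: "a \<in> carrier (Sigma_grp \<Gamma>)" and b: "b \<in> carrier (Sigma_grp \<Lambda>)"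
        and "Sigma_map \<Gamma> \<Omega> id a \<otimes>\<^bsub>Sigma_grp \<Omega>\<^esub> \<sigma> D = \<sigma> D \<otimes>\<^bsub>Sigma_grp \<Omega>\<^esub> Sigma_map \<Lambda> \<Omega> id b"
      then have ab: "a \<circ> \<sigma> D = \<sigma> D \<circ> b" by (simp add: Sigma_map_id[OF \<Gamma>] Sigma_map_id[OF \<Lambda>])
      \<comment> \<open>The equation \<open>ab\<close> says that \<open>a\<close> is conjugate to
        \<open>b\<close>, so \<open>a\<close> preserves the transported blocks of \<Lambda> besides
        those of \<Gamma>, hence the blocks of the meet.\<close>
      have "(x, a x) \<in> rel (\<Delta>' D)" if "x \<in> pts \<Omega>" for x
      proof -
        obtain z where z: "z \<in> pts \<Omega>" "x = \<sigma> D z" using \<open>x \<in> _\<close> permutes_image[OF p] by blast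
        then have "a x = \<sigma> D (b z)" using fun_cong[OF ab, of z] by simp
        then have "(x, a x) = map_prod (\<sigma> D) (\<sigma> D) (z, b z)" using z by simp
        then have "(x, a x) \<in> map_prod (\<sigma> D) (\<sigma> D) ` rel \<Lambda>" using Sigma_rel[OF b, of z] z pts by blast
        then show ?thesis using Sigma_rel[OF a, of x] that pts by (simp add: rel\<Delta>')
      qed
      then have c: "a \<in> carrier (Sigma_grp (\<Delta>' D))" using Sigma_permutes[OF a] by (simp add: Sigma_iff pts)
      have "\<sigma> D \<circ> Sigma_map (\<Delta>' D) \<Lambda> (g D) a = \<sigma> D \<circ> b" using comm[OF c] ab by simp
      then have "Sigma_map (\<Delta>' D) \<Lambda> (g D) a = b" using permutes_inj[OF p] by (simp add: fun_eq_iff inj_eq)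
      then show "\<exists>c \<in> carrier (Sigma_grp (\<Delta>' D)). Sigma_map (\<Delta>' D) \<Gamma> id c = a \<and> Sigma_map (\<Delta>' D) \<Lambda> (g D) c = b"
        using c id\<Delta> by blast
    qed
  qed
  have "Burn_res \<Gamma> \<Omega> id (Burn_tr \<Lambda> \<Omega> id A) =
      (\<Oplus>\<^bsub>Burn \<Gamma>\<^esub> D \<in> ?DC. Burn_tr (\<Delta>' D) \<Gamma> id (Burn_res (\<Delta>' D) \<Lambda> (g D) A))"
  proof (rule Sigma.burnside_eqI)
    show "Burn_res \<Gamma> \<Omega> id (Burn_tr \<Lambda> \<Omega> id A) \<in> carrier (Burn \<Gamma>)"
      by (intro Burn_res_closed Burn_tr_closed m\<Gamma> m\<Lambda> A)
    show "(\<Oplus>\<^bsub>Burn \<Gamma>\<^esub> D \<in> ?DC. Burn_tr (\<Delta>' D) \<Gamma> id (Burn_res (\<Delta>' D) \<Lambda> (g D) A)) \<in> carrier (Burn \<Gamma>)"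
      using closed by (intro Burn.finsum_closed) auto
    fix K assume K: "subgroup K (Sigma_grp \<Gamma>)"
    have "bmark (Burn_res \<Gamma> \<Omega> id (Burn_tr \<Lambda> \<Omega> id A)) K =
        (\<Sum>D \<in> ?DC. bmark (Burn_tr (\<Delta>' D) \<Gamma> id (Burn_res (\<Delta>' D) \<Lambda> (g D) A)) K)"
      using bmark_res_ind_double_coset[OF Sigma_map_inj[OF m\<Gamma>] Sigma_map_inj[OF m\<Lambda>], unfolded img,
          where C="\<lambda>D. Sigma_grp (\<Delta>' D)" and \<sigma>=\<sigma>, OF _ A K] pb \<sigma> by simp
    then show "bmark (Burn_res \<Gamma> \<Omega> id (Burn_tr \<Lambda> \<Omega> id A)) K =
        bmark (\<Oplus>\<^bsub>Burn \<Gamma>\<^esub> D \<in> ?DC. Burn_tr (\<Delta>' D) \<Gamma> id (Burn_res (\<Delta>' D) \<Lambda> (g D) A)) K"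
      using closed by (simp add: Sigma.bmark_finsum K Pi_iff)
  qed
  also have "\<dots> = (\<Oplus>\<^bsub>Burn \<Gamma>\<^esub> D \<in> ?DC.
      Burn_tr (\<Delta>' D) \<Gamma> id (Burn_tr (\<Delta> D) (\<Delta>' D) (\<sigma> D) (Burn_res (\<Delta> D) \<Lambda> id A)))"
    using closed by (intro Burn.add.finprod_cong') (auto simp: term_eq)
  finally show ?thesis by (simp add: \<Delta>_def \<Delta>'_def)
qed

section \<open>External products and the generators of A\<close>

lemma burnside_ext:
  assumes A: "A \<in> carrier (Burn \<Lambda>)" and B: "B \<in> carrier (Burn \<Omega>)"
  shows "burnside_ext \<Lambda> \<Omega> A B \<in> carrier (Burn (sum_ptn \<Lambda> \<Omega>))"
    "subgroup K (Sigma_grp (sum_ptn \<Lambda> \<Omega>)) \<Longrightarrow>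
      bmark (burnside_ext \<Lambda> \<Omega> A B) K = bmark A (left_part ` K) * bmark B (right_part ` K)"
proof -
  have eq: "burnside_ext \<Lambda> \<Omega> A B = (\<Union>p \<in> A \<times> B. gdiff (Sigma_grp (sum_ptn \<Lambda> \<Omega>))
      (gset_sum (gset_ext (fst (fst p)) (fst (snd p))) (gset_ext (snd (fst p)) (snd (snd p))))
      (gset_sum (gset_ext (fst (fst p)) (snd (snd p))) (gset_ext (snd (fst p)) (fst (snd p)))))"
    by (auto simp: burnside_ext_def) force
  have ne: "A \<times> B \<noteq> {}" using A B Sigma.burnside_ring_ne by blast
  note AB = Sigma.burnside_ringD[OF A] Sigma.burnside_ringD[OF B]
  have fin: "fin_gset (Sigma_grp (sum_ptn \<Lambda> \<Omega>)) (gset_ext V W)"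
    if "fin_gset (Sigma_grp \<Lambda>) V" "fin_gset (Sigma_grp \<Omega>) W" for V :: "('a point \<Rightarrow> 'a point, nat) gset"
      and W :: "('a point \<Rightarrow> 'a point, nat) gset"
    unfolding gset_ext_def
    by (intro fin_gset_prod fin_gset_res[OF _ Sum.left.hom] fin_gset_res[OF _ Sum.right.hom] that
        Sigma.is_group)
  have mark: "mark (gset_ext V W) K = mark V (left_part ` K) * mark W (right_part ` K)"
    for V :: "('a point \<Rightarrow> 'a point, nat) gset" and W :: "('a point \<Rightarrow> 'a point, nat) gset" and K
    by (simp add: gset_ext_def mark_prod mark_res)
  have "burnside_ext \<Lambda> \<Omega> A B \<in> carrier (Burn (sum_ptn \<Lambda> \<Omega>)) \<and>
    (\<forall>K. subgroup K (Sigma_grp (sum_ptn \<Lambda> \<Omega>)) \<longrightarrow>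
      bmark (burnside_ext \<Lambda> \<Omega> A B) K = bmark A (left_part ` K) * bmark B (right_part ` K))"
    unfolding eq
    by (rule Sigma.UN_gdiff[OF ne])
      (auto simp: AB(1,2,5,6) fin fin_gset_sum mark_sum[of "Sigma_grp (sum_ptn \<Lambda> \<Omega>)"] mark
        AB(4)[OF _ Sum.left.subgroup_img_is_subgroup] AB(8)[OF _ Sum.right.subgroup_img_is_subgroup]
        algebra_simps)
  then show "burnside_ext \<Lambda> \<Omega> A B \<in> carrier (Burn (sum_ptn \<Lambda> \<Omega>))"
    "subgroup K (Sigma_grp (sum_ptn \<Lambda> \<Omega>)) \<Longrightarrow>
      bmark (burnside_ext \<Lambda> \<Omega> A B) K = bmark A (left_part ` K) * bmark B (right_part ` K)" by auto
qed

text \<open>Puts external products into the form to which \<open>burnside_ind_product\<close>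
  applies.\<close>

lemma burnside_ext_eq:
  assumes "A \<in> carrier (Burn \<Lambda>)" "B \<in> carrier (Burn \<Omega>)"
  shows "burnside_ext \<Lambda> \<Omega> A B = burnside_res (Sigma_grp (sum_ptn \<Lambda> \<Omega>)) left_part A
    \<otimes>\<^bsub>Burn (sum_ptn \<Lambda> \<Omega>)\<^esub> burnside_res (Sigma_grp (sum_ptn \<Lambda> \<Omega>)) right_part B"
  by (rule Sigma.burnside_eqI[where \<Lambda>="sum_ptn \<Lambda> \<Omega>"])
    (use assms in \<open>simp_all add: burnside_ext Sigma.burnside_mult Sum.left.burnside_res Sum.right.burnside_res\<close>)

text \<open>Describes A by transfers of units instead of coset classes, a description that makes
  sense in any partition ring and lets A be treated as a generated part.\<close>

lemma A_val_carrier: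
  "carrier (A_val \<Lambda>) = generate (add_monoid (Burn \<Lambda>)) {Burn_tr \<Gamma> \<Lambda> id \<one>\<^bsub>Burn \<Gamma>\<^esub> | \<Gamma>. refines \<Gamma> \<Lambda>}"
proof -
  have "{gclass (Sigma_grp \<Lambda>) (gset_cosets (Sigma_grp \<Lambda>) (carrier (Sigma_grp \<Gamma>))) | \<Gamma>. refines \<Gamma> \<Lambda>} =
      {Burn_tr \<Gamma> \<Lambda> id \<one>\<^bsub>Burn \<Gamma>\<^esub> | \<Gamma>. refines \<Gamma> \<Lambda>}"
    by (intro Collect_cong ex_cong1) (metis Burn_tr_id)
  then show ?thesis by (simp add: A_val_def)
qed

lemma A_val_eq: "A_val \<Lambda> = Burn \<Lambda>\<lparr>carrier := carrier (A_val \<Lambda>)\<rparr>"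
  by (simp add: A_val_def)

lemma subgroup_A_val: "subgroup (carrier (A_val \<Lambda>)) (add_monoid (Burn \<Lambda>))"
  unfolding A_val_carrier
  by (rule Burn.add.generate_is_subgroup) (auto intro: Burn_tr_closed morphism_id)

text \<open>The unit is itself a generator, from the trivial refinement of \<open>\<Lambda>\<close>
  by itself.\<close>

lemma A_val_one: "\<one>\<^bsub>Burn \<Lambda>\<^esub> \<in> carrier (A_val \<Lambda>)"
proof -
  have "Burn_tr \<Lambda> \<Lambda> id \<one>\<^bsub>Burn \<Lambda>\<^esub> = \<one>\<^bsub>Burn \<Lambda>\<^esub>"
  proof (rule Burn_tr_eqI)
    show "isomorphism \<Lambda> \<Lambda> id" by (rule isomorphismI) auto
    show "Burn_res \<Lambda> \<Lambda> id \<one>\<^bsub>Burn \<Lambda>\<^esub> = \<one>\<^bsub>Burn \<Lambda>\<^esub>"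
      using Burn_res_ring_hom[OF morphism_id[OF refines_refl]] by (rule ring_hom_one)
  qed simp
  then show ?thesis
    unfolding A_val_carrier using refines_refl by (metis (mono_tags, lifting) generate.incl mem_Collect_eq)
qed

lemma one_A_val: "\<one>\<^bsub>A_val \<Lambda>\<^esub> = \<one>\<^bsub>Burn \<Lambda>\<^esub>"
  by (simp add: A_val_def)

lemma A_val_add_pow:
  fixes n :: int
  assumes "a \<in> carrier (A_val \<Lambda>)"
  shows "[n] \<cdot>\<^bsub>A_val \<Lambda>\<^esub> a = [n] \<cdot>\<^bsub>Burn \<Lambda>\<^esub> a"
proof -
  have "add_monoid (A_val \<Lambda>) = (add_monoid (Burn \<Lambda>))\<lparr>carrier := carrier (A_val \<Lambda>)\<rparr>"
    by (simp add: A_val_def)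
  then show ?thesis
    using Burn.add.int_pow_consistent[OF subgroup_A_val assms] by (simp add: add_pow_def)
qed

text \<open>The ambient partition ring. Only the values are enlarged, to full Burnside rings, so its
  axioms can be checked without asking whether restrictions or products of generators are again
  combinations of generators.\<close>

definition burnside_functor :: "('u, ('u point \<Rightarrow> 'u point) burnside) lax_pfunctor" where
  "burnside_functor = A_ring\<lparr>pf_val := \<lambda>\<Lambda>. Burn \<Lambda>\<rparr>"

lemma burnside_functor_simps [simp]:
  fixes \<Lambda> \<Omega> :: "'u point ptn"
  shows
  "pf_val burnside_functor \<Lambda> = Burn \<Lambda>"
  "pf_res burnside_functor \<Lambda> \<Omega> f = Burn_res \<Lambda> \<Omega> f"
  "pf_tr burnside_functor \<Lambda> \<Omega> f = Burn_tr \<Lambda> \<Omega> f"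
  "pf_unit burnside_functor n = [n] \<cdot>\<^bsub>Burn empty_ptn\<^esub> \<one>\<^bsub>Burn empty_ptn\<^esub>"
  "pf_ext burnside_functor = burnside_ext"
  by (simp_all add: burnside_functor_def A_ring_def one_A_val A_val_add_pow A_val_one)

lemma partition_functor_burnside: "partition_functor burnside_functor"
proof (rule partition_functor.intro, unfold burnside_functor_simps)
  show "abelian_group (Burn \<Lambda>)" for \<Lambda> :: "'a point ptn" by (rule Burn.abelian_group_axioms)
  show "Burn_res \<Lambda> \<Omega> f \<in> hom (add_monoid (Burn \<Omega>)) (add_monoid (Burn \<Lambda>))"
    if "morphism \<Lambda> \<Omega> f" for \<Lambda> \<Omega> :: "'a point ptn" and f
    using Burn_res_ring_hom[OF that] by (auto simp: ring_hom_def hom_def)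
  show "Burn_tr \<Lambda> \<Omega> f \<in> hom (add_monoid (Burn \<Lambda>)) (add_monoid (Burn \<Omega>))"
    if "morphism \<Lambda> \<Omega> f" for \<Lambda> \<Omega> :: "'a point ptn" and f
    using Burn_tr_closed[OF that] Burn_tr_add[OF that] by (intro homI) simp_all
  have id: "Burn_res \<Lambda> \<Lambda> id A = A" if A: "A \<in> carrier (Burn \<Lambda>)" for \<Lambda> :: "'a point ptn" and A
  proof (rule Burn_res_eqI[OF morphism_id[OF refines_refl] A A])
    fix K assume K: "subgroup K (Sigma_grp \<Lambda>)"
    then have "Sigma_map \<Lambda> \<Lambda> id ` K = (\<lambda>\<sigma>. \<sigma>) ` K"
      using subsetD[OF subgroup.subset[OF K]] by (intro image_cong) (simp_all add: Sigma_map_id refines_refl)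
    then show "bmark A (Sigma_map \<Lambda> \<Lambda> id ` K) = bmark A K" by simp
  qed
  then show "Burn_res \<Lambda> \<Lambda> id A = A" if "A \<in> carrier (Burn \<Lambda>)" for \<Lambda> :: "'a point ptn" and A
    using that .
  show "Burn_tr \<Lambda> \<Lambda> id A = A" if "A \<in> carrier (Burn \<Lambda>)" for \<Lambda> :: "'a point ptn" and A
    by (rule Burn_tr_eqI) (use id that in \<open>auto intro: isomorphismI\<close>)
qed (simp_all only: Burn_res_comp Burn_tr_comp Burn_two_iso Burn_tr_iso Burn_double_coset)

lemma burnside_ext_hom:
  assumes "A \<in> carrier (Burn \<Lambda>)" "A' \<in> carrier (Burn \<Lambda>)" "B \<in> carrier (Burn \<Omega>)" "B' \<in> carrier (Burn \<Omega>)"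
  shows "burnside_ext \<Lambda> \<Omega> (A \<oplus>\<^bsub>Burn \<Lambda>\<^esub> A') B =
      burnside_ext \<Lambda> \<Omega> A B \<oplus>\<^bsub>Burn (sum_ptn \<Lambda> \<Omega>)\<^esub> burnside_ext \<Lambda> \<Omega> A' B"
    "burnside_ext \<Lambda> \<Omega> A (B \<oplus>\<^bsub>Burn \<Omega>\<^esub> B') =
      burnside_ext \<Lambda> \<Omega> A B \<oplus>\<^bsub>Burn (sum_ptn \<Lambda> \<Omega>)\<^esub> burnside_ext \<Lambda> \<Omega> A B'"
    "burnside_ext \<Lambda> \<Omega> (A \<otimes>\<^bsub>Burn \<Lambda>\<^esub> A') (B \<otimes>\<^bsub>Burn \<Omega>\<^esub> B') =
      burnside_ext \<Lambda> \<Omega> A B \<otimes>\<^bsub>Burn (sum_ptn \<Lambda> \<Omega>)\<^esub> burnside_ext \<Lambda> \<Omega> A' B'"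
proof -
  note eqI = Sigma.burnside_eqI[where \<Lambda>="sum_ptn \<Lambda> \<Omega>"]
    and marks = assms burnside_ext Sigma.burnside_add Sigma.burnside_mult
      Sum.left.subgroup_img_is_subgroup Sum.right.subgroup_img_is_subgroup algebra_simps
  show "burnside_ext \<Lambda> \<Omega> (A \<oplus>\<^bsub>Burn \<Lambda>\<^esub> A') B =
      burnside_ext \<Lambda> \<Omega> A B \<oplus>\<^bsub>Burn (sum_ptn \<Lambda> \<Omega>)\<^esub> burnside_ext \<Lambda> \<Omega> A' B"
    by (rule eqI) (simp_all add: marks)
  show "burnside_ext \<Lambda> \<Omega> A (B \<oplus>\<^bsub>Burn \<Omega>\<^esub> B') =
      burnside_ext \<Lambda> \<Omega> A B \<oplus>\<^bsub>Burn (sum_ptn \<Lambda> \<Omega>)\<^esub> burnside_ext \<Lambda> \<Omega> A B'"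
    by (rule eqI) (simp_all add: marks)
  show "burnside_ext \<Lambda> \<Omega> (A \<otimes>\<^bsub>Burn \<Lambda>\<^esub> A') (B \<otimes>\<^bsub>Burn \<Omega>\<^esub> B') =
      burnside_ext \<Lambda> \<Omega> A B \<otimes>\<^bsub>Burn (sum_ptn \<Lambda> \<Omega>)\<^esub> burnside_ext \<Lambda> \<Omega> A' B'"
    by (rule eqI) (simp_all add: marks)
qed

lemma burnside_ext_one: "burnside_ext \<Lambda> \<Omega> \<one>\<^bsub>Burn \<Lambda>\<^esub> \<one>\<^bsub>Burn \<Omega>\<^esub> = \<one>\<^bsub>Burn (sum_ptn \<Lambda> \<Omega>)\<^esub>"
  by (rule Sigma.burnside_eqI[where \<Lambda>="sum_ptn \<Lambda> \<Omega>"])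
    (simp_all add: burnside_ext Sigma.burnside_one Sum.left.subgroup_img_is_subgroup
      Sum.right.subgroup_img_is_subgroup)

lemma burnside_ext_res:
  assumes f: "morphism \<Lambda> \<Lambda>' f" and g: "morphism \<Omega> \<Omega>' g"
    and A: "A \<in> carrier (Burn \<Lambda>')" and B: "B \<in> carrier (Burn \<Omega>')"
  shows "Burn_res (sum_ptn \<Lambda> \<Omega>) (sum_ptn \<Lambda>' \<Omega>') (sum_map f g) (burnside_ext \<Lambda>' \<Omega>' A B) =
    burnside_ext \<Lambda> \<Omega> (Burn_res \<Lambda> \<Lambda>' f A) (Burn_res \<Omega> \<Omega>' g B)"
proof (rule Burn_res_eqI[OF morphism_sum[OF f g]])
  interpret h: finite_group_inj "Sigma_grp (sum_ptn \<Lambda> \<Omega>)" "Sigma_grp (sum_ptn \<Lambda>' \<Omega>')"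
    "Sigma_map (sum_ptn \<Lambda> \<Omega>) (sum_ptn \<Lambda>' \<Omega>') (sum_map f g)"
    by (rule Sigma_map_inj[OF morphism_sum[OF f g]])
  fix K assume K: "subgroup K (Sigma_grp (sum_ptn \<Lambda> \<Omega>))"
  then have "left_part ` Sigma_map (sum_ptn \<Lambda> \<Omega>) (sum_ptn \<Lambda>' \<Omega>') (sum_map f g) ` K =
      Sigma_map \<Lambda> \<Lambda>' f ` left_part ` K"
    "right_part ` Sigma_map (sum_ptn \<Lambda> \<Omega>) (sum_ptn \<Lambda>' \<Omega>') (sum_map f g) ` K =
      Sigma_map \<Omega> \<Omega>' g ` right_part ` K"
    using subgroup.subset[OF K]
    by (auto simp: image_image subset_iff parts_Sigma_map_sum[OF f g] intro!: image_cong)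
  then show "bmark (burnside_ext \<Lambda>' \<Omega>' A B) (Sigma_map (sum_ptn \<Lambda> \<Omega>) (sum_ptn \<Lambda>' \<Omega>') (sum_map f g) ` K) =
      bmark (burnside_ext \<Lambda> \<Omega> (Burn_res \<Lambda> \<Lambda>' f A) (Burn_res \<Omega> \<Omega>' g B)) K"
    using A B K by (simp add: burnside_ext h.subgroup_img_is_subgroup Burn_res_closed f g
        bmark_Burn_res Sum.left.subgroup_img_is_subgroup Sum.right.subgroup_img_is_subgroup)
qed (simp_all add: burnside_ext A B Burn_res_closed f g)

lemma burnside_ext_tr:
  assumes f: "morphism \<Lambda> \<Lambda>' f" and g: "morphism \<Omega> \<Omega>' g"
    and A: "A \<in> carrier (Burn \<Lambda>)" and B: "B \<in> carrier (Burn \<Omega>)"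
  shows "Burn_tr (sum_ptn \<Lambda> \<Omega>) (sum_ptn \<Lambda>' \<Omega>') (sum_map f g) (burnside_ext \<Lambda> \<Omega> A B) =
    burnside_ext \<Lambda>' \<Omega>' (Burn_tr \<Lambda> \<Lambda>' f A) (Burn_tr \<Omega> \<Omega>' g B)"
  unfolding burnside_ext_eq[OF A B] burnside_ext_eq[OF Burn_tr_closed[OF f A] Burn_tr_closed[OF g B]]
  by (rule burnside_ind_product[OF Sigma_sum_product Sigma_sum_product])
    (simp_all add: Sigma_map_inj f g morphism_sum parts_Sigma_map_sum A B)

text \<open>After passing to restriction along \<open>assoc_map\<close>, both sides evaluate the
  three classes at the same three projections of \<open>K\<close>.\<close>

lemma burnside_ext_assoc:
  assumes A: "A \<in> carrier (Burn \<Lambda>)" and B: "B \<in> carrier (Burn \<Omega>)" and C: "C \<in> carrier (Burn \<Gamma>)"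
  shows "Burn_tr (sum_ptn (sum_ptn \<Lambda> \<Omega>) \<Gamma>) (sum_ptn \<Lambda> (sum_ptn \<Omega> \<Gamma>)) assoc_map
      (burnside_ext (sum_ptn \<Lambda> \<Omega>) \<Gamma> (burnside_ext \<Lambda> \<Omega> A B) C) =
    burnside_ext \<Lambda> (sum_ptn \<Omega> \<Gamma>) A (burnside_ext \<Omega> \<Gamma> B C)"
proof (rule Burn_tr_eqI[OF isomorphism_assoc])
  let ?S = "sum_ptn (sum_ptn \<Lambda> \<Omega>) \<Gamma>" and ?T = "sum_ptn \<Lambda> (sum_ptn \<Omega> \<Gamma>)"
  note m = isomorphism_morphism[OF isomorphism_assoc, of \<Lambda> \<Omega> \<Gamma>]
  interpret h: finite_group_inj "Sigma_grp ?S" "Sigma_grp ?T" "Sigma_map ?S ?T assoc_map"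
    by (rule Sigma_map_inj[OF m])
  show "Burn_res ?S ?T assoc_map (burnside_ext \<Lambda> (sum_ptn \<Omega> \<Gamma>) A (burnside_ext \<Omega> \<Gamma> B C)) =
      burnside_ext (sum_ptn \<Lambda> \<Omega>) \<Gamma> (burnside_ext \<Lambda> \<Omega> A B) C"
  proof (rule Burn_res_eqI[OF m])
    fix K assume K: "subgroup K (Sigma_grp ?S)"
    then have eqs: "left_part ` Sigma_map ?S ?T assoc_map ` K = left_part ` left_part ` K"
      "left_part ` right_part ` Sigma_map ?S ?T assoc_map ` K = right_part ` left_part ` K"
      "right_part ` right_part ` Sigma_map ?S ?T assoc_map ` K = right_part ` K"
      using subgroup.subset[OF K]
      by (auto simp: image_image subset_iff parts_Sigma_map_assoc intro!: image_cong)
    show "bmark (burnside_ext \<Lambda> (sum_ptn \<Omega> \<Gamma>) A (burnside_ext \<Omega> \<Gamma> B C)) (Sigma_map ?S ?T assoc_map ` K) =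
        bmark (burnside_ext (sum_ptn \<Lambda> \<Omega>) \<Gamma> (burnside_ext \<Lambda> \<Omega> A B) C) K"
      using A B C K Sum.right.subgroup_img_is_subgroup[OF h.subgroup_img_is_subgroup[OF K]]
        Sum.left.subgroup_img_is_subgroup[OF K]
      by (simp add: burnside_ext h.subgroup_img_is_subgroup eqs)
  qed (simp_all add: burnside_ext A B C)
qed (simp add: burnside_ext A B C)

lemma burnside_ext_swap:
  assumes A: "A \<in> carrier (Burn \<Lambda>)" and B: "B \<in> carrier (Burn \<Omega>)"
  shows "Burn_tr (sum_ptn \<Lambda> \<Omega>) (sum_ptn \<Omega> \<Lambda>) swap_map (burnside_ext \<Lambda> \<Omega> A B) = burnside_ext \<Omega> \<Lambda> B A"
proof (rule Burn_tr_eqI[OF isomorphism_swap])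
  let ?S = "sum_ptn \<Lambda> \<Omega>" and ?T = "sum_ptn \<Omega> \<Lambda>"
  note m = isomorphism_morphism[OF isomorphism_swap, of \<Lambda> \<Omega>]
  interpret h: finite_group_inj "Sigma_grp ?S" "Sigma_grp ?T" "Sigma_map ?S ?T swap_map"
    by (rule Sigma_map_inj[OF m])
  show "Burn_res ?S ?T swap_map (burnside_ext \<Omega> \<Lambda> B A) = burnside_ext \<Lambda> \<Omega> A B"
  proof (rule Burn_res_eqI[OF m])
    fix K assume K: "subgroup K (Sigma_grp ?S)"
    then have eqs: "left_part ` Sigma_map ?S ?T swap_map ` K = right_part ` K"
      "right_part ` Sigma_map ?S ?T swap_map ` K = left_part ` K"
      using subgroup.subset[OF K]
      by (auto simp: image_image subset_iff parts_Sigma_map_swap intro!: image_cong)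
    show "bmark (burnside_ext \<Omega> \<Lambda> B A) (Sigma_map ?S ?T swap_map ` K) = bmark (burnside_ext \<Lambda> \<Omega> A B) K"
      using A B K by (simp add: burnside_ext h.subgroup_img_is_subgroup eqs)
  qed (simp_all add: burnside_ext A B)
qed (simp add: burnside_ext A B)

lemma burnside_ext_unit:
  fixes n :: int
  assumes A: "A \<in> carrier (Burn \<Lambda>)"
  shows "Burn_tr (sum_ptn empty_ptn \<Lambda>) \<Lambda> unR
      (burnside_ext empty_ptn \<Lambda> ([n] \<cdot>\<^bsub>Burn empty_ptn\<^esub> \<one>\<^bsub>Burn empty_ptn\<^esub>) A) = [n] \<cdot>\<^bsub>Burn \<Lambda>\<^esub> A"
    "Burn_tr (sum_ptn \<Lambda> empty_ptn) \<Lambda> unL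
      (burnside_ext \<Lambda> empty_ptn A ([n] \<cdot>\<^bsub>Burn empty_ptn\<^esub> \<one>\<^bsub>Burn empty_ptn\<^esub>)) = [n] \<cdot>\<^bsub>Burn \<Lambda>\<^esub> A"
proof -
  have pow: "[n] \<cdot>\<^bsub>Burn \<Omega>\<^esub> B \<in> carrier (Burn \<Omega>)" if "B \<in> carrier (Burn \<Omega>)" for \<Omega> :: "'a point ptn" and B
    using Burn.add.int_pow_closed[OF that] by simp
  note one = pow[OF Burn.one_closed]
  show "Burn_tr (sum_ptn empty_ptn \<Lambda>) \<Lambda> unR
      (burnside_ext empty_ptn \<Lambda> ([n] \<cdot>\<^bsub>Burn empty_ptn\<^esub> \<one>\<^bsub>Burn empty_ptn\<^esub>) A) = [n] \<cdot>\<^bsub>Burn \<Lambda>\<^esub> A"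
  proof (rule Burn_tr_eqI[OF isomorphism_unR pow[OF A]],
      rule Burn_res_eqI[OF isomorphism_morphism[OF isomorphism_unR] pow[OF A] burnside_ext(1)[OF one A]])
    fix K assume K: "subgroup K (Sigma_grp (sum_ptn empty_ptn \<Lambda>))"
    then have "Sigma_map (sum_ptn empty_ptn \<Lambda>) \<Lambda> unR ` K = right_part ` K"
      using subsetD[OF subgroup.subset[OF K]] by (intro image_cong) (simp_all add: Sigma_map_unR)
    then show "bmark ([n] \<cdot>\<^bsub>Burn \<Lambda>\<^esub> A) (Sigma_map (sum_ptn empty_ptn \<Lambda>) \<Lambda> unR ` K) =
      bmark (burnside_ext empty_ptn \<Lambda> ([n] \<cdot>\<^bsub>Burn empty_ptn\<^esub> \<one>\<^bsub>Burn empty_ptn\<^esub>) A) K"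
      using A K by (simp add: burnside_ext one Sigma.bmark_add_pow Sigma.burnside_one
          Sum.left.subgroup_img_is_subgroup Sum.right.subgroup_img_is_subgroup)
  qed
  show "Burn_tr (sum_ptn \<Lambda> empty_ptn) \<Lambda> unL
      (burnside_ext \<Lambda> empty_ptn A ([n] \<cdot>\<^bsub>Burn empty_ptn\<^esub> \<one>\<^bsub>Burn empty_ptn\<^esub>)) = [n] \<cdot>\<^bsub>Burn \<Lambda>\<^esub> A"
  proof (rule Burn_tr_eqI[OF isomorphism_unL pow[OF A]],
      rule Burn_res_eqI[OF isomorphism_morphism[OF isomorphism_unL] pow[OF A] burnside_ext(1)[OF A one]])
    fix K assume K: "subgroup K (Sigma_grp (sum_ptn \<Lambda> empty_ptn))"
    then have "Sigma_map (sum_ptn \<Lambda> empty_ptn) \<Lambda> unL ` K = left_part ` K"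
      using subsetD[OF subgroup.subset[OF K]] by (intro image_cong) (simp_all add: Sigma_map_unL)
    then show "bmark ([n] \<cdot>\<^bsub>Burn \<Lambda>\<^esub> A) (Sigma_map (sum_ptn \<Lambda> empty_ptn) \<Lambda> unL ` K) =
      bmark (burnside_ext \<Lambda> empty_ptn A ([n] \<cdot>\<^bsub>Burn empty_ptn\<^esub> \<one>\<^bsub>Burn empty_ptn\<^esub>)) K"
      using A K by (simp add: burnside_ext one Sigma.bmark_add_pow Sigma.burnside_one
          Sum.left.subgroup_img_is_subgroup Sum.right.subgroup_img_is_subgroup)
  qed
qed

theorem partition_ring_burnside:
  "partition_ring (burnside_functor :: ('u, ('u point \<Rightarrow> 'u point) burnside) lax_pfunctor)"
proof (intro partition_ring.intro lax_symmetric_monoidal_partition_functor.intro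
    lax_symmetric_monoidal_partition_functor_axioms.intro partition_ring_axioms.intro
    partition_functor_burnside, unfold burnside_functor_simps)
  show "(\<lambda>n. [n] \<cdot>\<^bsub>Burn empty_ptn\<^esub> \<one>\<^bsub>Burn empty_ptn\<^esub>)
      \<in> hom integer_group (add_monoid (Burn (empty_ptn :: 'u point ptn)))"
    by (rule Burn.add.hom_integer_group_pow[OF Burn.one_closed])
  show "Burn_tr \<Lambda> \<Omega> f (Burn_res \<Lambda> \<Omega> f a \<otimes>\<^bsub>Burn \<Lambda>\<^esub> b) = a \<otimes>\<^bsub>Burn \<Omega>\<^esub> Burn_tr \<Lambda> \<Omega> f b"
    if "morphism \<Lambda> \<Omega> f" "a \<in> carrier (Burn \<Omega>)" "b \<in> carrier (Burn \<Lambda>)"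
    for \<Lambda> \<Omega> :: "'u point ptn" and f a b
    by (rule finite_group_inj.frobenius_reciprocity[OF Sigma_map_inj[OF that(1)] that(2,3)])
qed (simp_all only: burnside_ext(1) burnside_ext_hom burnside_ext_one burnside_ext_res burnside_ext_tr burnside_ext_assoc
    burnside_ext_unit burnside_ext_swap Burn.cring_axioms Burn_res_ring_hom)

section \<open>Elements generated by transfers of units\<close>

lemma (in partition_functor) tr_res_closed:
  assumes "morphism \<Lambda> \<Omega> f"
  shows "a \<in> carrier (pf_val M \<Lambda>) \<Longrightarrow> pf_tr M \<Lambda> \<Omega> f a \<in> carrier (pf_val M \<Omega>)"
    "a \<in> carrier (pf_val M \<Omega>) \<Longrightarrow> pf_res M \<Lambda> \<Omega> f a \<in> carrier (pf_val M \<Lambda>)"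
  using tr_hom[OF assms] res_hom[OF assms] by (auto simp: hom_def)

lemma (in partition_functor) res_iso:
  assumes f: "isomorphism \<Lambda> \<Omega> f" and a: "a \<in> carrier (pf_val M \<Omega>)"
  shows "pf_res M \<Lambda> \<Omega> f a = pf_tr M \<Omega> \<Lambda> (inv_into (pts \<Lambda>) f) a"
proof -
  let ?g = "inv_into (pts \<Lambda>) f"
  have g: "isomorphism \<Omega> \<Lambda> ?g" by (rule isomorphism_inv_into[OF f])
  have m: "morphism \<Lambda> \<Omega> f" "morphism \<Lambda> \<Omega> (inv_into (pts \<Omega>) ?g)"
    using f isomorphism_inv_into[OF g] by (simp_all add: isomorphism_morphism)
  \<comment> \<open>Inverting twice gives back \<open>f\<close> only on the points of
    \<open>\<Lambda>\<close>; the two functions are 2-isomorphic, and that suffices for equal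
    restrictions.\<close>
  have "two_iso \<Lambda> \<Omega> (inv_into (pts \<Omega>) ?g) f"
    using morphismD[OF m(1)] by (simp add: two_iso_def inv_into_inv_into_eq rel_refl)
  then show ?thesis using tr_iso[OF g a] res_two_iso[OF m(2,1) _ a] by simp
qed

context partition_ring begin

lemma one_closed: "\<one>\<^bsub>pf_val R \<Lambda>\<^esub> \<in> carrier (pf_val R \<Lambda>)"
  using val_ring by (simp add: cring_def ring.ring_simprules)

lemma tr_iso_one: "isomorphism \<Lambda> \<Omega> f \<Longrightarrow> pf_tr R \<Lambda> \<Omega> f \<one>\<^bsub>pf_val R \<Lambda>\<^esub> = \<one>\<^bsub>pf_val R \<Omega>\<^esub>"
  by (simp add: tr_iso one_closed isomorphism_inv_into isomorphism_morphism ring_hom_one[OF res_ring_hom])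

text \<open>The composite with the refinement factors as an isomorphism onto the transported
  partition followed by a refinement, and isomorphisms send 1 to 1.\<close>

lemma tr_tr_one:
  assumes f: "morphism \<Lambda> \<Omega> f" and \<Gamma>: "refines \<Gamma> \<Lambda>"
  shows "pf_tr R \<Lambda> \<Omega> f (pf_tr R \<Gamma> \<Lambda> id \<one>\<^bsub>pf_val R \<Gamma>\<^esub>) =
    pf_tr R (transport f \<Gamma>) \<Omega> id \<one>\<^bsub>pf_val R (transport f \<Gamma>)\<^esub>"
proof -
  note r = refines_transport[OF f \<Gamma>]
  note iso = isomorphism_transport[OF r(2)]
  have "pf_tr R \<Lambda> \<Omega> f (pf_tr R \<Gamma> \<Lambda> id \<one>\<^bsub>pf_val R \<Gamma>\<^esub>) = pf_tr R \<Gamma> \<Omega> (id \<circ> f) \<one>\<^bsub>pf_val R \<Gamma>\<^esub>"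
    using tr_comp[OF morphism_id[OF \<Gamma>] f one_closed] by simp
  also have "\<dots> = pf_tr R (transport f \<Gamma>) \<Omega> id (pf_tr R \<Gamma> (transport f \<Gamma>) f \<one>\<^bsub>pf_val R \<Gamma>\<^esub>)"
    by (rule tr_comp[OF isomorphism_morphism[OF iso] morphism_id[OF r(1)] one_closed])
  finally show ?thesis by (simp add: tr_iso_one[OF iso])
qed

text \<open>Moving \<Gamma> by an element of the group of \<Omega> changes its morphism to \<Omega>
  only by a 2-isomorphism. So conjugate refinements have the same transfer of 1 in every partition
  ring, as must be the case if A maps to it.\<close>

lemma tr_transport_one:
  assumes \<Gamma>: "refines \<Gamma> \<Omega>" and \<sigma>: "\<sigma> \<in> carrier (Sigma_grp \<Omega>)"
  shows "pf_tr R (transport \<sigma> \<Gamma>) \<Omega> id \<one>\<^bsub>pf_val R (transport \<sigma> \<Gamma>)\<^esub> = pf_tr R \<Gamma> \<Omega> id \<one>\<^bsub>pf_val R \<Gamma>\<^esub>"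
proof -
  have "pf_tr R (transport \<sigma> \<Gamma>) \<Omega> id \<one>\<^bsub>pf_val R (transport \<sigma> \<Gamma>)\<^esub> =
      pf_tr R \<Omega> \<Omega> \<sigma> (pf_tr R \<Gamma> \<Omega> id \<one>\<^bsub>pf_val R \<Gamma>\<^esub>)"
    by (rule tr_tr_one[OF morphism_Sigma(1)[OF refines_refl \<sigma>] \<Gamma>, symmetric])
  also have "\<dots> = pf_tr R \<Gamma> \<Omega> \<sigma> \<one>\<^bsub>pf_val R \<Gamma>\<^esub>"
    using tr_comp[OF morphism_id[OF \<Gamma>] morphism_Sigma(1)[OF refines_refl \<sigma>] one_closed] by simp
  also have "\<dots> = pf_tr R \<Gamma> \<Omega> id \<one>\<^bsub>pf_val R \<Gamma>\<^esub>"
    by (rule tr_two_iso[OF morphism_Sigma(1)[OF \<Gamma> \<sigma>] morphism_id[OF \<Gamma>] morphism_Sigma(2)[OF \<Gamma> \<sigma>] one_closed])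
  finally show ?thesis .
qed

text \<open>
  With \<open>u\<close> the image of 1 under the unit map, both \<open>ext 1 u\<close> and \<open>ext u u = ext u 1 \<sqdot> ext 1 u\<close> are
  determined by the unit laws.
\<close>

lemma pf_unit_eq: "pf_unit R n = [n] \<cdot>\<^bsub>pf_val R empty_ptn\<^esub> \<one>\<^bsub>pf_val R empty_ptn\<^esub>"
proof -
  let ?E = "empty_ptn :: 'a point ptn"
  let ?S = "sum_ptn ?E ?E"
  interpret E: cring "pf_val R ?E" by (rule val_ring)
  interpret S: cring "pf_val R ?S" by (rule val_ring)
  define u where "u = pf_unit R 1"
  have u: "u \<in> carrier (pf_val R ?E)" using unit_hom by (auto simp: u_def hom_def)
  \<comment> \<open>Transfer along an isomorphism is injective: the inverse followed by
    2-isomorphism invariance undoes it.\<close>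
  have inj: "a = b"
    if iso: "isomorphism ?S ?E f" and "pf_tr R ?S ?E f a = pf_tr R ?S ?E f b"
      and a: "a \<in> carrier (pf_val R ?S)" and b: "b \<in> carrier (pf_val R ?S)" for f a b
  proof -
    let ?g = "inv_into (pts ?S) f"
    have m: "morphism ?S ?E f" "morphism ?E ?S ?g"
      using iso isomorphism_inv_into[OF iso] by (auto dest: isomorphism_morphism)
    have "pf_tr R ?S ?S (?g \<circ> f) c = c" if c: "c \<in> carrier (pf_val R ?S)" for c
    proof -
      have "pf_tr R ?S ?S (?g \<circ> f) c = pf_tr R ?S ?S id c"
        using morphismD(2)[OF m(1)]
        by (intro tr_two_iso[OF morphism_comp[OF m] morphism_id[OF refines_refl] _ c])
          (simp add: two_iso_def rel_refl)
      then show ?thesis using tr_id[OF c] by simp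
    qed
    then have "a = pf_tr R ?E ?S ?g (pf_tr R ?S ?E f a)" "b = pf_tr R ?E ?S ?g (pf_tr R ?S ?E f b)"
      using tr_comp[OF m a] tr_comp[OF m b] a b by simp_all
    then show ?thesis using that(2) by simp
  qed
  have one: "[(1 :: int)] \<cdot>\<^bsub>pf_val R ?E\<^esub> a = a" if "a \<in> carrier (pf_val R ?E)" for a
    using E.add.int_pow_1[OF that] by simp
  have left: "pf_tr R ?S ?E unR (pf_ext R ?E ?E u a) = a"
    and right: "pf_tr R ?S ?E unL (pf_ext R ?E ?E a u) = a" if "a \<in> carrier (pf_val R ?E)" for a
    using ext_unit_left[OF that, of 1] ext_unit_right[OF that, of 1] one[OF that] by (simp_all add: u_def)
  \<comment> \<open>The left unit law and the compatibility of isomorphisms with 1 give both sides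
    the same transfer along \<open>unR\<close>.\<close>
  have ext_1: "pf_ext R ?E ?E u \<one>\<^bsub>pf_val R ?E\<^esub> = \<one>\<^bsub>pf_val R ?S\<^esub>"
    by (rule inj[OF isomorphism_unR]) (simp_all add: left tr_iso_one[OF isomorphism_unR] u ext_closed)
  have "pf_ext R ?E ?E u u = pf_ext R ?E ?E (\<one>\<^bsub>pf_val R ?E\<^esub> \<otimes>\<^bsub>pf_val R ?E\<^esub> u) (u \<otimes>\<^bsub>pf_val R ?E\<^esub> \<one>\<^bsub>pf_val R ?E\<^esub>)"
    using u by simp
  also have "\<dots> = pf_ext R ?E ?E \<one>\<^bsub>pf_val R ?E\<^esub> u \<otimes>\<^bsub>pf_val R ?S\<^esub> pf_ext R ?E ?E u \<one>\<^bsub>pf_val R ?E\<^esub>"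
    by (rule ext_mult) (simp_all add: u)
  also have "\<dots> = pf_ext R ?E ?E \<one>\<^bsub>pf_val R ?E\<^esub> u" using u by (simp add: ext_1 ext_closed)
  finally have "pf_tr R ?S ?E unL (pf_ext R ?E ?E u u) =
      pf_tr R ?S ?E unL (pf_ext R ?E ?E \<one>\<^bsub>pf_val R ?E\<^esub> u)"
    by (rule arg_cong)
  \<comment> \<open>The right unit law evaluates the two sides to \<open>u\<close> and to 1.\<close>
  then have "u = \<one>\<^bsub>pf_val R ?E\<^esub>" unfolding right[OF u] right[OF E.one_closed] .
  moreover have "pf_unit R n = [n] \<cdot>\<^bsub>pf_val R ?E\<^esub> u"
  proof -
    have "pf_unit R (1 [^]\<^bsub>integer_group\<^esub> n) = [n] \<cdot>\<^bsub>pf_val R ?E\<^esub> u"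
      using hom_int_pow[OF unit_hom, of 1 n] E.a_group by (simp add: add_pow_def u_def)
    then show ?thesis by simp
  qed
  ultimately show ?thesis by simp
qed

end

text \<open>
  The subgroup of \<open>S(\<Lambda>) \<times> R(\<Lambda>)\<close> generated by the pairs of transfers of the units. It is the graph of the
  only candidate for a map \<open>S \<rightarrow> R\<close>; for \<open>S = R\<close> it is the diagonal of the partition ring
  generated by transfers of units.
\<close>

locale partition_ring_pair = S: partition_ring S + R: partition_ring R
  for S :: "('u, 'm, 'y) lax_pfunctor_scheme" and R :: "('u, 'n, 'z) lax_pfunctor_scheme"
begin

inductive_set corr :: "'u point ptn \<Rightarrow> ('m \<times> 'n) set" for \<Lambda> where
  gen: "refines \<Gamma> \<Lambda> \<Longrightarrow>
    (pf_tr S \<Gamma> \<Lambda> id \<one>\<^bsub>pf_val S \<Gamma>\<^esub>, pf_tr R \<Gamma> \<Lambda> id \<one>\<^bsub>pf_val R \<Gamma>\<^esub>) \<in> corr \<Lambda>"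
| zero: "(\<zero>\<^bsub>pf_val S \<Lambda>\<^esub>, \<zero>\<^bsub>pf_val R \<Lambda>\<^esub>) \<in> corr \<Lambda>"
| neg: "(a, b) \<in> corr \<Lambda> \<Longrightarrow> (\<ominus>\<^bsub>pf_val S \<Lambda>\<^esub> a, \<ominus>\<^bsub>pf_val R \<Lambda>\<^esub> b) \<in> corr \<Lambda>"
| add: "(a, b) \<in> corr \<Lambda> \<Longrightarrow> (a', b') \<in> corr \<Lambda> \<Longrightarrow>
    (a \<oplus>\<^bsub>pf_val S \<Lambda>\<^esub> a', b \<oplus>\<^bsub>pf_val R \<Lambda>\<^esub> b') \<in> corr \<Lambda>"

interpretation Sv: cring "pf_val S \<Lambda>" for \<Lambda> by (rule S.val_ring)
interpretation Rv: cring "pf_val R \<Lambda>" for \<Lambda> by (rule R.val_ring)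

lemma corr_closed: "(a, b) \<in> corr \<Lambda> \<Longrightarrow> a \<in> carrier (pf_val S \<Lambda>) \<and> b \<in> carrier (pf_val R \<Lambda>)"
  by (induction rule: corr.induct) (simp_all add: S.tr_res_closed R.tr_res_closed morphism_id)

lemma corr_one: "(\<one>\<^bsub>pf_val S \<Lambda>\<^esub>, \<one>\<^bsub>pf_val R \<Lambda>\<^esub>) \<in> corr \<Lambda>"
  using corr.gen[OF refines_refl, of \<Lambda>] by (simp add: S.tr_id R.tr_id)

text \<open>A pair of additive maps preserves \<open>corr\<close> as soon as it sends generating
  pairs into \<open>corr\<close>. The closure under restriction along a refinement, transfers and
  both kinds of products is reduced to generators in this way.\<close>

lemma corr_hom:
  assumes F: "F \<in> hom (add_monoid (pf_val S \<Lambda>)) (add_monoid (pf_val S \<Omega>))"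
    and G: "G \<in> hom (add_monoid (pf_val R \<Lambda>)) (add_monoid (pf_val R \<Omega>))"
    and gens: "\<And>\<Gamma>. refines \<Gamma> \<Lambda> \<Longrightarrow>
      (F (pf_tr S \<Gamma> \<Lambda> id \<one>\<^bsub>pf_val S \<Gamma>\<^esub>), G (pf_tr R \<Gamma> \<Lambda> id \<one>\<^bsub>pf_val R \<Gamma>\<^esub>)) \<in> corr \<Omega>"
    and "(a, b) \<in> corr \<Lambda>"
  shows "(F a, G b) \<in> corr \<Omega>"
proof -
  interpret F: group_hom "add_monoid (pf_val S \<Lambda>)" "add_monoid (pf_val S \<Omega>)" F
    using F Sv.a_group by (simp add: group_hom_def group_hom_axioms_def)
  interpret G: group_hom "add_monoid (pf_val R \<Lambda>)" "add_monoid (pf_val R \<Omega>)" G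
    using G Rv.a_group by (simp add: group_hom_def group_hom_axioms_def)
  show ?thesis
    using assms(4)
  proof (induction rule: corr.induct)
    case zero
    then show ?case using F.hom_one G.hom_one corr.zero by simp
  next
    case (neg a b)
    then have "F (\<ominus>\<^bsub>pf_val S \<Lambda>\<^esub> a) = \<ominus>\<^bsub>pf_val S \<Omega>\<^esub> F a" "G (\<ominus>\<^bsub>pf_val R \<Lambda>\<^esub> b) = \<ominus>\<^bsub>pf_val R \<Omega>\<^esub> G b"
      using F.hom_inv G.hom_inv corr_closed by (simp_all add: a_inv_def)
    then show ?case using corr.neg[OF neg.IH] by simp
  next
    case (add a b a' b')
    then have "F (a \<oplus>\<^bsub>pf_val S \<Lambda>\<^esub> a') = F a \<oplus>\<^bsub>pf_val S \<Omega>\<^esub> F a'" "G (b \<oplus>\<^bsub>pf_val R \<Lambda>\<^esub> b') = G b \<oplus>\<^bsub>pf_val R \<Omega>\<^esub> G b'"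
      using F.hom_mult G.hom_mult corr_closed by simp_all
    then show ?case using corr.add[OF add.IH] by simp
  qed (rule gens)
qed

lemma corr_tr:
  assumes f: "morphism \<Lambda> \<Omega> f" and "(a, b) \<in> corr \<Lambda>"
  shows "(pf_tr S \<Lambda> \<Omega> f a, pf_tr R \<Lambda> \<Omega> f b) \<in> corr \<Omega>"
  by (rule corr_hom[OF S.tr_hom[OF f] R.tr_hom[OF f] _ assms(2)])
    (simp add: S.tr_tr_one[OF f] R.tr_tr_one[OF f] corr.gen refines_transport[OF f])

lemma corr_finsum:
  assumes "\<And>x. x \<in> I \<Longrightarrow> (f x, g x) \<in> corr \<Lambda>"
  shows "((\<Oplus>\<^bsub>pf_val S \<Lambda>\<^esub> x \<in> I. f x), (\<Oplus>\<^bsub>pf_val R \<Lambda>\<^esub> x \<in> I. g x)) \<in> corr \<Lambda>"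
  using assms
proof (induction I rule: infinite_finite_induct)
  case (infinite I)
  then show ?case by (simp add: Sv.add.finprod_infinite Rv.add.finprod_infinite corr.zero)
next
  case (insert x I)
  then have "f \<in> I \<rightarrow> carrier (pf_val S \<Lambda>)" "f x \<in> carrier (pf_val S \<Lambda>)"
    "g \<in> I \<rightarrow> carrier (pf_val R \<Lambda>)" "g x \<in> carrier (pf_val R \<Lambda>)"
    using corr_closed by auto
  then show ?case using insert by (simp add: Sv.finsum_insert Rv.finsum_insert corr.add)
qed (simp add: corr.zero)

lemma corr_res_id:
  assumes \<Gamma>: "refines \<Gamma> \<Omega>" and "(a, b) \<in> corr \<Omega>"
  shows "(pf_res S \<Gamma> \<Omega> id a, pf_res R \<Gamma> \<Omega> id b) \<in> corr \<Gamma>"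
proof (rule corr_hom[OF S.res_hom[OF morphism_id[OF \<Gamma>]] R.res_hom[OF morphism_id[OF \<Gamma>]] _ assms(2)])
  fix \<Lambda> assume \<Lambda>: "refines \<Lambda> \<Omega>"
  let ?DC = "double_cosets (Sigma_grp \<Omega>) (carrier (Sigma_grp \<Gamma>)) (carrier (Sigma_grp \<Lambda>))"
  have id_in: "id \<in> carrier (Sigma_grp \<Delta>)" for \<Delta> :: "'u point ptn"
    using Sigma.one_closed[of \<Delta>] by simp
  \<comment> \<open>One choice of representatives is used for both rings, so the two double coset
    formulas have corresponding terms.\<close>
  define \<sigma> where "\<sigma> D = (SOME \<sigma>. \<sigma> \<in> D \<inter> carrier (Sigma_grp \<Omega>))" for D :: "('u point \<Rightarrow> 'u point) set"
  have ex: "\<exists>\<sigma>. \<sigma> \<in> D \<inter> carrier (Sigma_grp \<Omega>)" if "D \<in> ?DC" for D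
  proof -
    obtain s where s: "s \<in> carrier (Sigma_grp \<Omega>)"
      "D = carrier (Sigma_grp \<Gamma>) <#>\<^bsub>Sigma_grp \<Omega>\<^esub> (s <#\<^bsub>Sigma_grp \<Omega>\<^esub> carrier (Sigma_grp \<Lambda>))"
      using \<open>D \<in> _\<close> unfolding double_cosets_def by (rule imageE)
    have "s \<in> D" unfolding s(2) Sigma.double_coset_iff
      by (intro bexI[OF _ id_in] bexI[OF _ id_in]) simp
    then show ?thesis using s(1) by blast
  qed
  have \<sigma>: "\<sigma> D \<in> D \<inter> carrier (Sigma_grp \<Omega>)" if "D \<in> ?DC" for D
    unfolding \<sigma>_def by (rule someI_ex[OF ex[OF that]])
  have choice: "\<forall>D \<in> ?DC. \<sigma> D \<in> D" by (rule ballI) (rule IntD1[OF \<sigma>])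
  show "(pf_res S \<Gamma> \<Omega> id (pf_tr S \<Lambda> \<Omega> id \<one>\<^bsub>pf_val S \<Lambda>\<^esub>),
      pf_res R \<Gamma> \<Omega> id (pf_tr R \<Lambda> \<Omega> id \<one>\<^bsub>pf_val R \<Lambda>\<^esub>)) \<in> corr \<Gamma>"
    unfolding S.double_coset[OF \<Gamma> \<Lambda> Sv.one_closed choice] R.double_coset[OF \<Gamma> \<Lambda> Rv.one_closed choice]
  proof (rule corr_finsum)
    fix D assume "D \<in> ?DC"
    then have "\<sigma> D \<in> carrier (Sigma_grp \<Omega>)" by (rule IntD2[OF \<sigma>])
    note tm = transport_meet[OF \<Gamma> \<Lambda> this]
    let ?\<Delta> = "ptn_meet (transport (inv_into UNIV (\<sigma> D)) \<Gamma>) \<Lambda>" and ?\<Delta>' = "ptn_meet \<Gamma> (transport (\<sigma> D) \<Lambda>)"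
    have "(pf_res S ?\<Delta> \<Lambda> id \<one>\<^bsub>pf_val S \<Lambda>\<^esub>, pf_res R ?\<Delta> \<Lambda> id \<one>\<^bsub>pf_val R \<Lambda>\<^esub>) \<in> corr ?\<Delta>"
      using corr_one by (simp add: ring_hom_one[OF S.res_ring_hom] ring_hom_one[OF R.res_ring_hom] tm(2) morphism_id)
    then show "(pf_tr S ?\<Delta>' \<Gamma> id (pf_tr S ?\<Delta> ?\<Delta>' (\<sigma> D) (pf_res S ?\<Delta> \<Lambda> id \<one>\<^bsub>pf_val S \<Lambda>\<^esub>)),
        pf_tr R ?\<Delta>' \<Gamma> id (pf_tr R ?\<Delta> ?\<Delta>' (\<sigma> D) (pf_res R ?\<Delta> \<Lambda> id \<one>\<^bsub>pf_val R \<Lambda>\<^esub>))) \<in> corr \<Gamma>"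
      by (intro corr_tr morphism_id tm(3) isomorphism_morphism[OF tm(1)])
  qed
qed

text \<open>A morphism is an isomorphism onto the transported partition followed by a refinement;
  restriction along the isomorphism is transfer along its inverse, so \<open>corr_tr\<close> covers
  that factor.\<close>

lemma corr_res:
  assumes f: "morphism \<Lambda> \<Omega> f" and ab: "(a, b) \<in> corr \<Omega>"
  shows "(pf_res S \<Lambda> \<Omega> f a, pf_res R \<Lambda> \<Omega> f b) \<in> corr \<Lambda>"
proof -
  let ?T = "transport f \<Lambda>"
  note r = refines_transport[OF f refines_refl]
  note iso = isomorphism_transport[OF r(2)]
  note c = corr_res_id[OF r(1) ab]
  have "pf_res S \<Lambda> \<Omega> f a = pf_res S \<Lambda> ?T f (pf_res S ?T \<Omega> id a)"
    "pf_res R \<Lambda> \<Omega> f b = pf_res R \<Lambda> ?T f (pf_res R ?T \<Omega> id b)"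
    using S.res_comp[OF isomorphism_morphism[OF iso] morphism_id[OF r(1)], of a]
      R.res_comp[OF isomorphism_morphism[OF iso] morphism_id[OF r(1)], of b] corr_closed[OF ab] by simp_all
  then show ?thesis
    using corr_tr[OF isomorphism_morphism[OF isomorphism_inv_into[OF iso]] c] corr_closed[OF c]
    by (simp add: S.res_iso[OF iso] R.res_iso[OF iso])
qed

lemma corr_mult:
  assumes "(a, b) \<in> corr \<Lambda>" and ab': "(a', b') \<in> corr \<Lambda>"
  shows "(a \<otimes>\<^bsub>pf_val S \<Lambda>\<^esub> a', b \<otimes>\<^bsub>pf_val R \<Lambda>\<^esub> b') \<in> corr \<Lambda>"
proof (rule corr_hom[where F="\<lambda>a. a \<otimes>\<^bsub>pf_val S \<Lambda>\<^esub> a'" and G="\<lambda>b. b \<otimes>\<^bsub>pf_val R \<Lambda>\<^esub> b'", OF _ _ _ assms(1)])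
  note c = corr_closed[OF ab']
  show "(\<lambda>a. a \<otimes>\<^bsub>pf_val S \<Lambda>\<^esub> a') \<in> hom (add_monoid (pf_val S \<Lambda>)) (add_monoid (pf_val S \<Lambda>))"
    "(\<lambda>b. b \<otimes>\<^bsub>pf_val R \<Lambda>\<^esub> b') \<in> hom (add_monoid (pf_val R \<Lambda>)) (add_monoid (pf_val R \<Lambda>))"
    using c by (auto intro!: homI simp: Sv.l_distr Rv.l_distr)
  fix \<Gamma> assume \<Gamma>: "refines \<Gamma> \<Lambda>"
  note m = morphism_id[OF \<Gamma>]
  have "pf_tr S \<Gamma> \<Lambda> id \<one>\<^bsub>pf_val S \<Gamma>\<^esub> \<otimes>\<^bsub>pf_val S \<Lambda>\<^esub> a' = pf_tr S \<Gamma> \<Lambda> id (pf_res S \<Gamma> \<Lambda> id a')"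
    using S.frobenius[OF m, of a' "\<one>\<^bsub>pf_val S \<Gamma>\<^esub>"] c S.tr_res_closed[OF m] by (simp add: Sv.m_comm)
  moreover have "pf_tr R \<Gamma> \<Lambda> id \<one>\<^bsub>pf_val R \<Gamma>\<^esub> \<otimes>\<^bsub>pf_val R \<Lambda>\<^esub> b' = pf_tr R \<Gamma> \<Lambda> id (pf_res R \<Gamma> \<Lambda> id b')"
    using R.frobenius[OF m, of b' "\<one>\<^bsub>pf_val R \<Gamma>\<^esub>"] c R.tr_res_closed[OF m] by (simp add: Rv.m_comm)
  ultimately show "(pf_tr S \<Gamma> \<Lambda> id \<one>\<^bsub>pf_val S \<Gamma>\<^esub> \<otimes>\<^bsub>pf_val S \<Lambda>\<^esub> a',
      pf_tr R \<Gamma> \<Lambda> id \<one>\<^bsub>pf_val R \<Gamma>\<^esub> \<otimes>\<^bsub>pf_val R \<Lambda>\<^esub> b') \<in> corr \<Lambda>"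
    using corr_tr[OF m corr_res[OF m ab']] by simp
qed

text \<open>Biadditivity reduces both arguments, one after the other, to generators. For these,
  naturality in transfers and \<open>ext_one\<close> give the transfer of 1 along the sum of the two
  refinements.\<close>

lemma corr_ext:
  assumes ab: "(a, b) \<in> corr \<Lambda>" and ab': "(a', b') \<in> corr \<Omega>"
  shows "(pf_ext S \<Lambda> \<Omega> a a', pf_ext R \<Lambda> \<Omega> b b') \<in> corr (sum_ptn \<Lambda> \<Omega>)"
proof (rule corr_hom[where F="\<lambda>a. pf_ext S \<Lambda> \<Omega> a a'" and G="\<lambda>b. pf_ext R \<Lambda> \<Omega> b b'", OF _ _ _ ab])
  note c = corr_closed[OF ab']
  show "(\<lambda>a. pf_ext S \<Lambda> \<Omega> a a') \<in> hom (add_monoid (pf_val S \<Lambda>)) (add_monoid (pf_val S (sum_ptn \<Lambda> \<Omega>)))"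
    "(\<lambda>b. pf_ext R \<Lambda> \<Omega> b b') \<in> hom (add_monoid (pf_val R \<Lambda>)) (add_monoid (pf_val R (sum_ptn \<Lambda> \<Omega>)))"
    using c by (auto intro!: homI simp: S.ext_closed R.ext_closed S.ext_add_left R.ext_add_left)
  fix \<Gamma> assume \<Gamma>: "refines \<Gamma> \<Lambda>"
  let ?s = "pf_tr S \<Gamma> \<Lambda> id \<one>\<^bsub>pf_val S \<Gamma>\<^esub>" and ?r = "pf_tr R \<Gamma> \<Lambda> id \<one>\<^bsub>pf_val R \<Gamma>\<^esub>"
  note s = corr_closed[OF corr.gen[OF \<Gamma>]]
  show "(pf_ext S \<Lambda> \<Omega> ?s a', pf_ext R \<Lambda> \<Omega> ?r b') \<in> corr (sum_ptn \<Lambda> \<Omega>)"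
  proof (rule corr_hom[where F="pf_ext S \<Lambda> \<Omega> ?s" and G="pf_ext R \<Lambda> \<Omega> ?r", OF _ _ _ ab'])
    show "pf_ext S \<Lambda> \<Omega> ?s \<in> hom (add_monoid (pf_val S \<Omega>)) (add_monoid (pf_val S (sum_ptn \<Lambda> \<Omega>)))"
      "pf_ext R \<Lambda> \<Omega> ?r \<in> hom (add_monoid (pf_val R \<Omega>)) (add_monoid (pf_val R (sum_ptn \<Lambda> \<Omega>)))"
      using s by (auto intro!: homI simp: S.ext_closed R.ext_closed S.ext_add_right R.ext_add_right)
    fix \<Delta> assume \<Delta>: "refines \<Delta> \<Omega>"
    have "(pf_tr S (sum_ptn \<Gamma> \<Delta>) (sum_ptn \<Lambda> \<Omega>) (sum_map id id) (pf_ext S \<Gamma> \<Delta> \<one>\<^bsub>pf_val S \<Gamma>\<^esub> \<one>\<^bsub>pf_val S \<Delta>\<^esub>),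
        pf_tr R (sum_ptn \<Gamma> \<Delta>) (sum_ptn \<Lambda> \<Omega>) (sum_map id id) (pf_ext R \<Gamma> \<Delta> \<one>\<^bsub>pf_val R \<Gamma>\<^esub> \<one>\<^bsub>pf_val R \<Delta>\<^esub>))
      \<in> corr (sum_ptn \<Lambda> \<Omega>)"
      using corr.gen[OF refines_sum[OF \<Gamma> \<Delta>]] by (simp add: sum_map_id S.ext_one R.ext_one)
    then show "(pf_ext S \<Lambda> \<Omega> ?s (pf_tr S \<Delta> \<Omega> id \<one>\<^bsub>pf_val S \<Delta>\<^esub>),
        pf_ext R \<Lambda> \<Omega> ?r (pf_tr R \<Delta> \<Omega> id \<one>\<^bsub>pf_val R \<Delta>\<^esub>)) \<in> corr (sum_ptn \<Lambda> \<Omega>)"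
      by (simp add: S.ext_tr[OF morphism_id[OF \<Gamma>] morphism_id[OF \<Delta>]]
          R.ext_tr[OF morphism_id[OF \<Gamma>] morphism_id[OF \<Delta>]])
  qed
qed

lemma corr_add_pow:
  fixes n :: int
  assumes "(a, b) \<in> corr \<Lambda>"
  shows "([n] \<cdot>\<^bsub>pf_val S \<Lambda>\<^esub> a, [n] \<cdot>\<^bsub>pf_val R \<Lambda>\<^esub> b) \<in> corr \<Lambda>"
proof -
  have nat: "([k] \<cdot>\<^bsub>pf_val S \<Lambda>\<^esub> a, [k] \<cdot>\<^bsub>pf_val R \<Lambda>\<^esub> b) \<in> corr \<Lambda>" for k :: nat
    by (induction k) (simp_all add: corr.zero corr.add assms)
  show ?thesis
  proof (cases "n \<ge> 0")
    case True
    then show ?thesis using nat by (simp add: add_pow_int_ge)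
  next
    case False
    then show ?thesis using corr.neg[OF nat] by (simp add: add_pow_int_lt)
  qed
qed

text \<open>The reason for \<open>pf_unit_eq\<close>: once both unit maps are multiples of 1, they
  correspond.\<close>

lemma corr_unit: "(pf_unit S n, pf_unit R n) \<in> corr empty_ptn"
  unfolding S.pf_unit_eq R.pf_unit_eq by (rule corr_add_pow[OF corr_one])

end

section \<open>The partition ring generated by transfers of units\<close>

definition generated_part :: "('u, 'm, 'z) lax_pfunctor_scheme \<Rightarrow> ('u, 'm, 'z) lax_pfunctor_scheme" where
  "generated_part R = R\<lparr>pf_val := \<lambda>\<Lambda>. pf_val R \<Lambda>\<lparr>carrier := generate (add_monoid (pf_val R \<Lambda>))
     {pf_tr R \<Gamma> \<Lambda> id \<one>\<^bsub>pf_val R \<Gamma>\<^esub> | \<Gamma>. refines \<Gamma> \<Lambda>}\<rparr>\<rparr>"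

lemma generated_part_simps [simp]:
  "pf_res (generated_part R) = pf_res R" "pf_tr (generated_part R) = pf_tr R"
  "pf_unit (generated_part R) = pf_unit R" "pf_ext (generated_part R) = pf_ext R"
  by (simp_all add: generated_part_def)

lemma generated_part_ops [simp]:
  "\<one>\<^bsub>pf_val (generated_part R) \<Lambda>\<^esub> = \<one>\<^bsub>pf_val R \<Lambda>\<^esub>" "\<zero>\<^bsub>pf_val (generated_part R) \<Lambda>\<^esub> = \<zero>\<^bsub>pf_val R \<Lambda>\<^esub>"
  "a \<otimes>\<^bsub>pf_val (generated_part R) \<Lambda>\<^esub> b = a \<otimes>\<^bsub>pf_val R \<Lambda>\<^esub> b"
  "a \<oplus>\<^bsub>pf_val (generated_part R) \<Lambda>\<^esub> b = a \<oplus>\<^bsub>pf_val R \<Lambda>\<^esub> b"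
  by (simp_all add: generated_part_def)

lemma subgroup_Sigma:
  assumes "refines \<Gamma> \<Omega>"
  shows "subgroup (carrier (Sigma_grp \<Gamma>)) (Sigma_grp \<Omega>)"
proof -
  interpret finite_group_inj "Sigma_grp \<Gamma>" "Sigma_grp \<Omega>" "Sigma_map \<Gamma> \<Omega> id"
    by (rule Sigma_map_inj[OF morphism_id[OF assms]])
  show ?thesis using img_is_subgroup by (simp add: Sigma_map_id[OF assms] cong: image_cong)
qed

lemma double_coset_representative:
  assumes "refines \<Gamma> \<Omega>" "refines \<Lambda> \<Omega>"
    "D \<in> double_cosets (Sigma_grp \<Omega>) (carrier (Sigma_grp \<Gamma>)) (carrier (Sigma_grp \<Lambda>))" "s \<in> D"
  shows "s \<in> carrier (Sigma_grp \<Omega>)"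
  using Sigma.double_cosets_partition(3)[OF subgroup_Sigma[OF assms(1)] subgroup_Sigma[OF assms(2)] assms(3,4)]
  by blast

context partition_ring begin

interpretation Rv: cring "pf_val R \<Lambda>" for \<Lambda> by (rule val_ring)
interpretation diag: partition_ring_pair R R by unfold_locales

text \<open>Pairing the ring with itself turns the closure properties of \<open>corr\<close> into
  those of the generated subgroup.\<close>

lemma generated_corr_iff:
  "a \<in> carrier (pf_val (generated_part R) \<Lambda>) \<longleftrightarrow> (a, a) \<in> diag.corr \<Lambda>"
proof
  let ?gens = "{pf_tr R \<Gamma> \<Lambda> id \<one>\<^bsub>pf_val R \<Gamma>\<^esub> | \<Gamma>. refines \<Gamma> \<Lambda>}"
  assume "a \<in> carrier (pf_val (generated_part R) \<Lambda>)"
  then have "a \<in> generate (add_monoid (pf_val R \<Lambda>)) ?gens" by (simp add: generated_part_def)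
  then show "(a, a) \<in> diag.corr \<Lambda>"
  proof (induction rule: generate.induct)
    case one
    then show ?case using diag.corr.zero by simp
  next
    case (incl a)
    then show ?case using diag.corr.gen by blast
  next
    case (inv a)
    then obtain \<Gamma> where "refines \<Gamma> \<Lambda>" "a = pf_tr R \<Gamma> \<Lambda> id \<one>\<^bsub>pf_val R \<Gamma>\<^esub>" by blast
    then show ?case using diag.corr.neg[OF diag.corr.gen] by (simp add: a_inv_def)
  next
    case (eng a b)
    then show ?case using diag.corr.add[of a a \<Lambda> b b] by simp
  qed
next
  define gens where "gens = {pf_tr R \<Gamma> \<Lambda> id \<one>\<^bsub>pf_val R \<Gamma>\<^esub> | \<Gamma>. refines \<Gamma> \<Lambda>}"
  have gens: "gens \<subseteq> carrier (pf_val R \<Lambda>)"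
    by (auto simp: gens_def tr_res_closed morphism_id)
  \<comment> \<open>The induction follows the first component alone, so the second one is left
    arbitrary here and set equal to it afterwards.\<close>
  have "x \<in> generate (add_monoid (pf_val R \<Lambda>)) gens" if "(x, y) \<in> diag.corr \<Lambda>" for x y
    using that
  proof (induction rule: diag.corr.induct)
    case (gen \<Gamma>)
    then show ?case by (intro generate.incl) (auto simp: gens_def)
  next
    case zero
    show ?case using generate.one[of "add_monoid (pf_val R \<Lambda>)" gens] by (simp only: monoid.select_convs)
  next
    case (neg a b)
    show ?case by (rule Rv.add.generate_m_inv_closed[OF gens neg.IH])
  next
    case (add a b a' b')
    then show ?case using generate.eng[of a "add_monoid (pf_val R \<Lambda>)" gens a'] by simp
  qed
  then show "(a, a) \<in> diag.corr \<Lambda> \<Longrightarrow> a \<in> carrier (pf_val (generated_part R) \<Lambda>)"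
    by (simp add: generated_part_def gens_def)
qed

lemma generated_sub: "a \<in> carrier (pf_val (generated_part R) \<Lambda>) \<Longrightarrow> a \<in> carrier (pf_val R \<Lambda>)"
  using diag.corr_closed by (simp add: generated_corr_iff)

lemma generated_subgroup:
  "subgroup (carrier (pf_val (generated_part R) \<Lambda>)) (add_monoid (pf_val R \<Lambda>))"
proof (rule Rv.add.subgroupI)
  have "\<zero>\<^bsub>pf_val R \<Lambda>\<^esub> \<in> carrier (pf_val (generated_part R) \<Lambda>)"
    by (simp add: generated_corr_iff diag.corr.zero)
  then show "carrier (pf_val (generated_part R) \<Lambda>) \<noteq> {}" by blast
qed (auto simp: generated_sub generated_corr_iff a_inv_def[symmetric] diag.corr.neg diag.corr.add)

lemma generated_cring: "cring (pf_val (generated_part R) \<Lambda>)"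
proof -
  let ?C = "carrier (pf_val (generated_part R) \<Lambda>)"
  have sub: "?C \<subseteq> carrier (pf_val R \<Lambda>)" using generated_sub by blast
  have "subring ?C (pf_val R \<Lambda>)"
    by (rule Rv.subringI)
      (auto simp: generated_sub generated_corr_iff diag.corr_one diag.corr.neg diag.corr_mult diag.corr.add)
  then have "cring (pf_val R \<Lambda>\<lparr>carrier := ?C\<rparr>)"
    using Rv.subcringI' Rv.subcring_iff[OF sub] by blast
  then show ?thesis by (simp add: generated_part_def)
qed

lemma generated_add_pow:
  fixes n :: int
  assumes "a \<in> carrier (pf_val (generated_part R) \<Lambda>)"
  shows "[n] \<cdot>\<^bsub>pf_val (generated_part R) \<Lambda>\<^esub> a = [n] \<cdot>\<^bsub>pf_val R \<Lambda>\<^esub> a"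
  using Rv.add.int_pow_consistent[OF generated_subgroup assms]
  by (simp add: add_pow_def generated_part_def)

text \<open>The double coset formula for the generated part sums inside the smaller ring, and this
  compares it with the given formula. On infinite index sets both sums are 0 by convention.\<close>

lemma generated_finsum:
  assumes "f \<in> I \<rightarrow> carrier (pf_val (generated_part R) \<Lambda>)"
  shows "(\<Oplus>\<^bsub>pf_val (generated_part R) \<Lambda>\<^esub> x \<in> I. f x) = (\<Oplus>\<^bsub>pf_val R \<Lambda>\<^esub> x \<in> I. f x)"
proof -
  interpret C: cring "pf_val (generated_part R) \<Lambda>" by (rule generated_cring)
  show ?thesis
    using assms
  proof (induction I rule: infinite_finite_induct)
    case (infinite I)
    then show ?case by (simp add: C.add.finprod_infinite Rv.add.finprod_infinite)
  next
    case (insert x I)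
    then have "f \<in> I \<rightarrow> carrier (pf_val (generated_part R) \<Lambda>)" "f x \<in> carrier (pf_val (generated_part R) \<Lambda>)"
      "f \<in> I \<rightarrow> carrier (pf_val R \<Lambda>)" "f x \<in> carrier (pf_val R \<Lambda>)"
      using generated_sub by auto
    then show ?case using insert by (simp add: C.finsum_insert Rv.finsum_insert)
  qed simp
qed

lemma
  shows generated_tr: "morphism \<Lambda> \<Omega> f \<Longrightarrow> a \<in> carrier (pf_val (generated_part R) \<Lambda>) \<Longrightarrow>
      pf_tr R \<Lambda> \<Omega> f a \<in> carrier (pf_val (generated_part R) \<Omega>)"
    and generated_res: "morphism \<Lambda> \<Omega> f \<Longrightarrow> b \<in> carrier (pf_val (generated_part R) \<Omega>) \<Longrightarrow>
      pf_res R \<Lambda> \<Omega> f b \<in> carrier (pf_val (generated_part R) \<Lambda>)"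
    and generated_ext: "a \<in> carrier (pf_val (generated_part R) \<Lambda>) \<Longrightarrow>
      b \<in> carrier (pf_val (generated_part R) \<Omega>) \<Longrightarrow>
      pf_ext R \<Lambda> \<Omega> a b \<in> carrier (pf_val (generated_part R) (sum_ptn \<Lambda> \<Omega>))"
    and generated_unit: "pf_unit R n \<in> carrier (pf_val (generated_part R) empty_ptn)"
  by (simp_all add: generated_corr_iff diag.corr_tr diag.corr_res diag.corr_ext diag.corr_unit)

lemma partition_functor_generated: "partition_functor (generated_part R)"
proof (rule partition_functor.intro, unfold generated_part_simps)
  fix \<Gamma> \<Lambda> \<Omega> :: "'u point ptn" and a
    and \<sigma> :: "('u point \<Rightarrow> 'u point) set \<Rightarrow> 'u point \<Rightarrow> 'u point"
  let ?DC = "double_cosets (Sigma_grp \<Omega>) (carrier (Sigma_grp \<Gamma>)) (carrier (Sigma_grp \<Lambda>))"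
  let ?t = "\<lambda>D. pf_tr R (ptn_meet \<Gamma> (transport (\<sigma> D) \<Lambda>)) \<Gamma> id
          (pf_tr R (ptn_meet (transport (inv_into UNIV (\<sigma> D)) \<Gamma>) \<Lambda>) (ptn_meet \<Gamma> (transport (\<sigma> D) \<Lambda>)) (\<sigma> D)
            (pf_res R (ptn_meet (transport (inv_into UNIV (\<sigma> D)) \<Gamma>) \<Lambda>) \<Lambda> id a))"
  assume *: "refines \<Gamma> \<Omega>" "refines \<Lambda> \<Omega>" and a: "a \<in> carrier (pf_val (generated_part R) \<Lambda>)"
    and \<sigma>: "\<forall>D \<in> ?DC. \<sigma> D \<in> D"
  have "?t D \<in> carrier (pf_val (generated_part R) \<Gamma>)" if D: "D \<in> ?DC" for D
  proof -
    have "\<sigma> D \<in> carrier (Sigma_grp \<Omega>)" using double_coset_representative[OF * D] \<sigma> D by blast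
    note tm = transport_meet[OF * this]
    show ?thesis
      by (intro generated_tr generated_res a morphism_id tm(2,3) isomorphism_morphism[OF tm(1)])
  qed
  then show "pf_res R \<Gamma> \<Omega> id (pf_tr R \<Lambda> \<Omega> id a) = (\<Oplus>\<^bsub>pf_val (generated_part R) \<Gamma>\<^esub> D \<in> ?DC. ?t D)"
    using double_coset[OF * generated_sub[OF a] \<sigma>] by (subst generated_finsum) auto
next
  show "pf_res R \<Lambda> \<Omega> f \<in> hom (add_monoid (pf_val (generated_part R) \<Omega>)) (add_monoid (pf_val (generated_part R) \<Lambda>))"
    "pf_tr R \<Lambda> \<Omega> f \<in> hom (add_monoid (pf_val (generated_part R) \<Lambda>)) (add_monoid (pf_val (generated_part R) \<Omega>))"
    if "morphism \<Lambda> \<Omega> f" for \<Lambda> \<Omega> f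
    using res_hom[OF that] tr_hom[OF that] generated_tr[OF that] generated_res[OF that] generated_sub
    by (auto simp: hom_def)
qed (simp_all add: generated_cring cring.axioms(1) ring.is_abelian_group generated_sub
    res_id tr_id res_comp tr_comp res_two_iso tr_two_iso tr_iso)

theorem partition_ring_generated: "partition_ring (generated_part R)"
proof (intro partition_ring.intro lax_symmetric_monoidal_partition_functor.intro
    lax_symmetric_monoidal_partition_functor_axioms.intro partition_ring_axioms.intro
    partition_functor_generated, unfold generated_part_simps)
  show "pf_unit R \<in> hom integer_group (add_monoid (pf_val (generated_part R) empty_ptn))"
    using unit_hom generated_unit by (auto simp: hom_def)
  show "pf_res R \<Lambda> \<Omega> f \<in> ring_hom (pf_val (generated_part R) \<Omega>) (pf_val (generated_part R) \<Lambda>)"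
    if "morphism \<Lambda> \<Omega> f" for \<Lambda> \<Omega> f
    using res_ring_hom[OF that] generated_res[OF that] generated_sub by (auto simp: ring_hom_def)
qed (simp_all add: generated_cring generated_sub generated_ext generated_add_pow
    ext_add_left ext_add_right ext_res ext_tr ext_assoc ext_unit_left ext_unit_right ext_symmetric
    ext_mult ext_one frobenius)

end

text \<open>By \<open>A_val_carrier\<close> the two constructions shrink the same carriers to the
  same subgroups, so all axioms for A follow from the result on generated parts.\<close>

lemma A_ring_eq:
  "(A_ring :: ('u, ('u point \<Rightarrow> 'u point) burnside) lax_pfunctor) = generated_part burnside_functor"
proof -
  define B where "B = (burnside_functor :: ('u, ('u point \<Rightarrow> 'u point) burnside) lax_pfunctor)"
  have "(\<lambda>\<Lambda>. pf_val B \<Lambda>\<lparr>carrier := generate (add_monoid (pf_val B \<Lambda>))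
     {pf_tr B \<Gamma> \<Lambda> id \<one>\<^bsub>pf_val B \<Gamma>\<^esub> | \<Gamma>. refines \<Gamma> \<Lambda>}\<rparr>) = A_val"
    by (rule ext, rule trans[OF _ A_val_eq[symmetric]]) (simp only: B_def burnside_functor_simps A_val_carrier)
  then have "generated_part B = A_ring"
    unfolding generated_part_def by (simp add: B_def burnside_functor_def A_ring_def)
  then show ?thesis by (simp add: B_def)
qed

lemma partition_ring_A: "partition_ring A_ring"
  unfolding A_ring_eq by (rule partition_ring.partition_ring_generated[OF partition_ring_burnside])

section \<open>Linear independence of the generators\<close>

text \<open>A triangularity argument that tolerates repeated rows. In the application
  \<open>m\<close> is the table of marks, \<open>r\<close> gives the transfers of 1 in R and
  \<open>size\<close> the order of the group of a refinement. A nonzero entry that goes against the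
  order of sizes is allowed only between indices with equal rows and equal \<open>r\<close>, that
  is, for conjugate refinements. Thus no system of representatives of conjugacy classes has to be
  chosen.\<close>

lemma (in abelian_group) int_combination_eq_zero:
  fixes m :: "'i \<Rightarrow> 'i \<Rightarrow> int" and f :: "'i \<Rightarrow> int" and size :: "'i \<Rightarrow> nat"
  assumes "finite T" "T \<subseteq> I"
    and r: "\<And>i. i \<in> I \<Longrightarrow> r i \<in> carrier G"
    and diag: "\<And>i. i \<in> I \<Longrightarrow> m i i \<noteq> 0"
    and conj: "\<And>i j. i \<in> I \<Longrightarrow> j \<in> I \<Longrightarrow> m i j \<noteq> 0 \<Longrightarrow> size i \<le> size j \<Longrightarrow>
      r i = r j \<and> (\<forall>k \<in> I. m i k = m j k)"
    and "\<And>k. k \<in> I \<Longrightarrow> (\<Sum>i \<in> T. f i * m i k) = 0"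
  shows "(\<Oplus>i \<in> T. [f i] \<cdot> r i) = \<zero>"
  using assms(1,2,6)
proof (induction "card T" arbitrary: T f rule: less_induct)
  case less
  note fin = less.prems(1) and sub = less.prems(2) and zero = less.prems(3)
  have pow: "[n] \<cdot> r i \<in> carrier G" if "i \<in> T" for n :: int and i
    using that sub r by (intro add.int_pow_closed) auto
  show ?case
  proof (cases "T = {}")
    case False
    obtain j where j: "j \<in> T" and max: "\<And>i. i \<in> T \<Longrightarrow> size i \<le> size j"
      using obtains_MAX[OF fin False, of size] fin by (metis Max_ge finite_imageI imageI)
    define T' where "T' = T - {j}"
    have T': "finite T'" "T' \<subseteq> I" "card T' < card T" "j \<notin> T'" "T = insert j T'"
      using fin sub j card_Diff1_less[OF fin j] by (auto simp: T'_def)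
    have sum_T: "(\<Oplus>i \<in> T. [f i] \<cdot> r i) = [f j] \<cdot> r j \<oplus> (\<Oplus>i \<in> T'. [f i] \<cdot> r i)"
      unfolding T'(5) using T' pow by (intro finsum_insert) auto
    have zero': "f j * m j k + (\<Sum>i \<in> T'. f i * m i k) = 0" if "k \<in> I" for k
      using zero[OF that] T' by simp
    show ?thesis
    proof (cases "\<exists>i \<in> T'. m i j \<noteq> 0")
      case True
      then obtain i where i: "i \<in> T'" "m i j \<noteq> 0" by blast
      then have "i \<in> I" "j \<in> I" "size i \<le> size j" using T' sub j max by auto
      then have ij: "r i = r j" "\<And>k. k \<in> I \<Longrightarrow> m i k = m j k" using conj i(2) by blast+
      \<comment> \<open>Equal rows and equal values of \<open>r\<close> allow the coefficient of
        \<open>j\<close> to be moved to \<open>i\<close>; neither the relation nor the combination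
        changes, and the index set loses \<open>j\<close>.\<close>
      define g where "g = f(i := f i + f j)"
      define T'' where "T'' = T' - {i}"
      have T'': "finite T''" "i \<notin> T''" "T' = insert i T''" using T' i by (auto simp: T''_def)
      have "(\<Sum>l \<in> T'. g l * m l k) = 0" if k: "k \<in> I" for k
      proof -
        have "(\<Sum>l \<in> T''. g l * m l k) = (\<Sum>l \<in> T''. f l * m l k)"
          using T'' by (intro sum.cong) (auto simp: g_def)
        then show ?thesis using zero'[OF k] T'' ij(2)[OF k] by (simp add: g_def algebra_simps)
      qed
      then have IH: "(\<Oplus>l \<in> T'. [g l] \<cdot> r l) = \<zero>" by (intro less.hyps T'(1,2,3))
      have eq: "(\<Oplus>l \<in> T''. [g l] \<cdot> r l) = (\<Oplus>l \<in> T''. [f l] \<cdot> r l)"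
        using T'' T' pow by (intro finsum_cong') (auto simp: g_def)
      have closed: "(\<Oplus>l \<in> T''. [f l] \<cdot> r l) \<in> carrier G" using T'' T' pow by (intro finsum_closed) auto
      have "(\<Oplus>l \<in> T'. [f l] \<cdot> r l) = [f i] \<cdot> r i \<oplus> (\<Oplus>l \<in> T''. [f l] \<cdot> r l)"
        unfolding T''(3) using T'' T' pow by (intro finsum_insert) auto
      then have "(\<Oplus>l \<in> T. [f l] \<cdot> r l) = ([f j] \<cdot> r i \<oplus> [f i] \<cdot> r i) \<oplus> (\<Oplus>l \<in> T''. [f l] \<cdot> r l)"
        using sum_T ij(1) closed pow i j T' by (simp add: a_assoc)
      also have "[f j] \<cdot> r i \<oplus> [f i] \<cdot> r i = [g i] \<cdot> r i"
        using add.int_pow_mult[of "r i" "f j" "f i"] r \<open>i \<in> I\<close> by (simp add: g_def add.commute)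
      also have "[g i] \<cdot> r i \<oplus> (\<Oplus>l \<in> T''. [f l] \<cdot> r l) = (\<Oplus>l \<in> T'. [g l] \<cdot> r l)"
        unfolding eq[symmetric] T''(3) using T'' T' pow by (intro finsum_insert[symmetric]) auto
      finally show ?thesis using IH by simp
    next
      case False
      then have "(\<Sum>i \<in> T'. f i * m i j) = 0" by (intro sum.neutral) auto
      \<comment> \<open>Only the diagonal entry is left in column \<open>j\<close>, and it is
        nonzero.\<close>
      then have fj: "f j = 0" using zero'[of j] diag[of j] j sub by auto
      then have "(\<Oplus>i \<in> T'. [f i] \<cdot> r i) = \<zero>" using zero' by (intro less.hyps T'(1,2,3)) simp
      moreover have "[(0 :: int)] \<cdot> r j = \<zero>" by (simp add: add_pow_int_ge)
      ultimately show ?thesis using sum_T fj by simp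
    qed
  qed simp
qed

section \<open>The table of marks for the groups of refinements\<close>

lemma finite_refinements: "finite {\<Gamma>. refines \<Gamma> \<Lambda>}"
proof (rule finite_imageD[of rel])
  show "finite (rel ` {\<Gamma>. refines \<Gamma> \<Lambda>})"
    by (rule finite_subset[of _ "Pow (pts \<Lambda> \<times> pts \<Lambda>)"])
      (auto simp: refines_iff finite_pts dest: rel_pts)
  show "inj_on rel {\<Gamma>. refines \<Gamma> \<Lambda>}"
    by (rule inj_onI) (auto simp: refines_iff intro: ptn_eqI)
qed

text \<open>Transpositions detect equivalence of points; in this way a partition of a given set can
  be recovered from its group.\<close>

lemma transpose_Sigma_iff:
  assumes "x \<in> pts \<Gamma>" "y \<in> pts \<Gamma>"
  shows "Transposition.transpose x y \<in> carrier (Sigma_grp \<Gamma>) \<longleftrightarrow> (x, y) \<in> rel \<Gamma>"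
  using assms permutes_swap_id[OF assms]
  by (auto simp: Sigma_iff Transposition.transpose_def intro: rel_refl rel_sym)

lemma Sigma_determines:
  assumes "pts \<Gamma> = pts \<Delta>" "carrier (Sigma_grp \<Gamma>) = carrier (Sigma_grp \<Delta>)"
  shows "\<Gamma> = \<Delta>"
proof (rule ptn_eqI[OF assms(1)])
  have "(x, y) \<in> rel \<Gamma> \<longleftrightarrow> (x, y) \<in> rel \<Delta>" for x y
    using transpose_Sigma_iff[of x \<Gamma> y] transpose_Sigma_iff[of x \<Delta> y] assms
      rel_pts[of x y \<Gamma>] rel_pts[of x y \<Delta>] by auto
  then show "rel \<Gamma> = rel \<Delta>" by auto
qed

text \<open>Conjugation by \<open>k\<close> is the homomorphism induced by the isomorphism from
  \<Delta> to its transport along the inverse of \<open>k\<close>, and induced homomorphisms of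
  isomorphisms are surjective.\<close>

lemma Sigma_transport:
  assumes \<Delta>: "refines \<Delta> \<Lambda>" and k: "k \<in> carrier (Sigma_grp \<Lambda>)"
  shows "carrier (Sigma_grp (transport (inv_into UNIV k) \<Delta>)) = conj_by (Sigma_grp \<Lambda>) k (carrier (Sigma_grp \<Delta>))"
proof -
  let ?k = "inv_into UNIV k"
  note p = Sigma_permutes[OF k]
  note pk = permutes_inv[OF p]
  have pts: "pts \<Delta> = pts \<Lambda>" using \<Delta> by (simp add: refines_iff)
  have iso: "isomorphism \<Delta> (transport ?k \<Delta>) ?k"
    by (rule isomorphism_transport) (rule permutes_inj_on[OF pk])
  have map: "Sigma_map \<Delta> (transport ?k \<Delta>) ?k \<sigma> = ?k \<circ> \<sigma> \<circ> k" if "\<sigma> \<in> carrier (Sigma_grp \<Delta>)" for \<sigma>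
    by (rule Sigma_map_eqI[OF isomorphism_morphism[OF iso]])
      (use permutes_not_in[OF p] permutes_not_in[OF pk] permutes_not_in[OF Sigma_permutes[OF that]] in
        \<open>auto simp: pts permutes_inverses[OF p] permutes_image[OF pk]\<close>)
  have "carrier (Sigma_grp (transport ?k \<Delta>)) = (\<lambda>\<sigma>. ?k \<circ> \<sigma> \<circ> k) ` carrier (Sigma_grp \<Delta>)"
    unfolding Sigma_map_surj[OF iso, symmetric] by (intro image_cong refl map)
  then show ?thesis by (simp add: conj_by_def Sigma_inv[OF k])
qed

lemma bmark_generator:
  assumes \<Gamma>: "refines \<Gamma> \<Lambda>" and \<Delta>: "refines \<Delta> \<Lambda>"
  shows "int (card (carrier (Sigma_grp \<Gamma>))) * bmark (Burn_tr \<Gamma> \<Lambda> id \<one>\<^bsub>Burn \<Gamma>\<^esub>) (carrier (Sigma_grp \<Delta>)) =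
    int (card {k \<in> carrier (Sigma_grp \<Lambda>). conj_by (Sigma_grp \<Lambda>) k (carrier (Sigma_grp \<Delta>)) \<subseteq> carrier (Sigma_grp \<Gamma>)})"
  using Sigma.mark_cosets[OF subgroup_Sigma[OF \<Gamma>] subgroup.subset[OF subgroup_Sigma[OF \<Delta>]]]
    Sigma.gclass(2)[OF fin_gset_cosets[OF finite_group_Sigma subgroup_Sigma[OF \<Gamma>]] subgroup_Sigma[OF \<Delta>]]
  by (simp add: Burn_tr_id[OF \<Gamma>])

lemma bmark_generator_self:
  assumes "refines \<Gamma> \<Lambda>"
  shows "bmark (Burn_tr \<Gamma> \<Lambda> id \<one>\<^bsub>Burn \<Gamma>\<^esub>) (carrier (Sigma_grp \<Gamma>)) \<noteq> 0"
proof -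
  have "\<one>\<^bsub>Sigma_grp \<Lambda>\<^esub> \<in> {k \<in> carrier (Sigma_grp \<Lambda>).
      conj_by (Sigma_grp \<Lambda>) k (carrier (Sigma_grp \<Gamma>)) \<subseteq> carrier (Sigma_grp \<Gamma>)}" (is "_ \<in> ?K")
    using Sigma.conj_by_one[OF subgroup.subset[OF subgroup_Sigma[OF assms]]] Sigma.one_closed by simp
  then have "card ?K > 0" using Sigma.finite_carrier[of \<Lambda>] by (auto simp: card_gt_0_iff)
  then show ?thesis using bmark_generator[OF assms assms] by auto
qed

text \<open>A nonzero mark puts a conjugate of the group of \<Delta> into that of \<Gamma>. The
  comparison of orders makes this an equality, and a partition is determined by its group.\<close>

lemma bmark_generator_conj:
  assumes \<Gamma>: "refines \<Gamma> \<Lambda>" and \<Delta>: "refines \<Delta> \<Lambda>"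
    and ne: "bmark (Burn_tr \<Gamma> \<Lambda> id \<one>\<^bsub>Burn \<Gamma>\<^esub>) (carrier (Sigma_grp \<Delta>)) \<noteq> 0"
    and le: "card (carrier (Sigma_grp \<Gamma>)) \<le> card (carrier (Sigma_grp \<Delta>))"
  shows "\<exists>\<sigma> \<in> carrier (Sigma_grp \<Lambda>). \<Gamma> = transport \<sigma> \<Delta>"
proof -
  have "card (carrier (Sigma_grp \<Gamma>)) > 0"
    using Sigma.finite_carrier[of \<Gamma>] Sigma.one_closed[of \<Gamma>] by (auto simp: card_gt_0_iff)
  then have "card {k \<in> carrier (Sigma_grp \<Lambda>). conj_by (Sigma_grp \<Lambda>) k (carrier (Sigma_grp \<Delta>)) \<subseteq>
      carrier (Sigma_grp \<Gamma>)} \<noteq> 0"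
    using bmark_generator[OF \<Gamma> \<Delta>] ne by auto
  then obtain k where k: "k \<in> carrier (Sigma_grp \<Lambda>)"
    "conj_by (Sigma_grp \<Lambda>) k (carrier (Sigma_grp \<Delta>)) \<subseteq> carrier (Sigma_grp \<Gamma>)"
    by (metis (no_types, lifting) card.empty empty_Collect_eq)
  have "conj_by (Sigma_grp \<Lambda>) k (carrier (Sigma_grp \<Delta>)) = carrier (Sigma_grp \<Gamma>)"
    using Sigma.card_conj_by[OF k(1) subgroup.subset[OF subgroup_Sigma[OF \<Delta>]]] le
    by (intro card_seteq k(2) Sigma.finite_carrier) simp
  then have "\<Gamma> = transport (inv_into UNIV k) \<Delta>"
    using \<Gamma> \<Delta> permutes_image[OF permutes_inv[OF Sigma_permutes[OF k(1)]]]
    by (intro Sigma_determines) (simp_all add: Sigma_transport[OF \<Delta> k(1)] refines_iff)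
  then show ?thesis using Sigma_inv_closed[OF k(1)] by blast
qed

section \<open>Initiality\<close>

lemma A_ring_simps:
  fixes \<Lambda> \<Omega> :: "'u point ptn"
  shows "pf_val A_ring \<Lambda> = A_val \<Lambda>" "pf_tr A_ring \<Lambda> \<Omega> f = Burn_tr \<Lambda> \<Omega> f"
  by (simp_all add: A_ring_def)

lemma A_val_ops:
  "\<zero>\<^bsub>A_val \<Lambda>\<^esub> = \<zero>\<^bsub>Burn \<Lambda>\<^esub>" "a \<oplus>\<^bsub>A_val \<Lambda>\<^esub> b = a \<oplus>\<^bsub>Burn \<Lambda>\<^esub> b"
  by (simp_all add: A_val_def)

lemma A_val_uminus:
  assumes "a \<in> carrier (A_val \<Lambda>)"
  shows "\<ominus>\<^bsub>A_val \<Lambda>\<^esub> a = \<ominus>\<^bsub>Burn \<Lambda>\<^esub> a"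
  using Burn.add.m_inv_consistent[OF subgroup_A_val assms]
  by (simp add: a_inv_def A_val_def)

lemma bmark_uminus:
  assumes "a \<in> carrier (Burn \<Lambda>)" "subgroup K (Sigma_grp \<Lambda>)"
  shows "bmark (\<ominus>\<^bsub>Burn \<Lambda>\<^esub> a) K = - bmark a K"
proof -
  have "bmark (a \<oplus>\<^bsub>Burn \<Lambda>\<^esub> \<ominus>\<^bsub>Burn \<Lambda>\<^esub> a) K = 0"
    using assms by (simp add: Burn.r_neg Sigma.burnside_zero)
  then show ?thesis using assms by (simp add: Sigma.burnside_add)
qed

definition tr_one_A :: "'a ptn \<Rightarrow> 'a ptn \<Rightarrow> ('a \<Rightarrow> 'a) burnside" where
  "tr_one_A \<Lambda> \<Gamma> = Burn_tr \<Gamma> \<Lambda> id \<one>\<^bsub>Burn \<Gamma>\<^esub>"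

locale partition_ring_from_A = R: partition_ring R for R :: "('u, 'r, 'z) lax_pfunctor_scheme"

sublocale partition_ring_from_A \<subseteq>
  partition_ring_pair "A_ring :: ('u, ('u point \<Rightarrow> 'u point) burnside) lax_pfunctor" R
  by (intro partition_ring_pair.intro partition_ring_A R.partition_ring_axioms)

context partition_ring_from_A begin

interpretation Rv: cring "pf_val R \<Lambda>" for \<Lambda> by (rule R.val_ring)

definition tr_one :: "'u point ptn \<Rightarrow> 'u point ptn \<Rightarrow> 'r" where
  "tr_one \<Lambda> \<Gamma> = pf_tr R \<Gamma> \<Lambda> id \<one>\<^bsub>pf_val R \<Gamma>\<^esub>"

lemma tr_one_closed: "refines \<Gamma> \<Lambda> \<Longrightarrow> tr_one \<Lambda> \<Gamma> \<in> carrier (pf_val R \<Lambda>)"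
  by (simp add: tr_one_def R.tr_res_closed morphism_id)

text \<open>The components of a pair are combinations with common coefficients. The first one is
  recorded only through its marks, the form in which \<open>int_combination_eq_zero\<close> takes a
  relation.\<close>

lemma corr_combination:
  assumes "(a, b) \<in> corr \<Lambda>"
  shows "\<exists>f :: 'u point ptn \<Rightarrow> int.
    (\<forall>K. subgroup K (Sigma_grp \<Lambda>) \<longrightarrow> bmark a K = (\<Sum>\<Gamma> | refines \<Gamma> \<Lambda>. f \<Gamma> * bmark (tr_one_A \<Lambda> \<Gamma>) K)) \<and>
    b = (\<Oplus>\<^bsub>pf_val R \<Lambda>\<^esub> \<Gamma> \<in> {\<Gamma>. refines \<Gamma> \<Lambda>}. [f \<Gamma>] \<cdot>\<^bsub>pf_val R \<Lambda>\<^esub> tr_one \<Lambda> \<Gamma>)"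
  using assms
proof (induction rule: corr.induct)
  note fin = finite_refinements[of \<Lambda>]
  have pow: "[n] \<cdot>\<^bsub>pf_val R \<Lambda>\<^esub> tr_one \<Lambda> \<Gamma> \<in> carrier (pf_val R \<Lambda>)" if "refines \<Gamma> \<Lambda>" for n :: int and \<Gamma>
    using tr_one_closed[OF that] by (rule Rv.add.int_pow_closed)
  {
    case (gen \<Delta>)
    define f where "f \<Gamma> = (if \<Gamma> = \<Delta> then 1 else 0 :: int)" for \<Gamma>
    have "(\<Oplus>\<^bsub>pf_val R \<Lambda>\<^esub> \<Gamma> \<in> {\<Gamma>. refines \<Gamma> \<Lambda>}. [f \<Gamma>] \<cdot>\<^bsub>pf_val R \<Lambda>\<^esub> tr_one \<Lambda> \<Gamma>) =
        (\<Oplus>\<^bsub>pf_val R \<Lambda>\<^esub> \<Gamma> \<in> {\<Gamma>. refines \<Gamma> \<Lambda>}. if \<Delta> = \<Gamma> then tr_one \<Lambda> \<Gamma> else \<zero>\<^bsub>pf_val R \<Lambda>\<^esub>)"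
      using tr_one_closed Rv.add.int_pow_1 by (intro Rv.finsum_cong') (auto simp: f_def add_pow_int_ge)
    also have "\<dots> = tr_one \<Lambda> \<Delta>"
      using gen fin tr_one_closed by (intro Rv.add.finprod_singleton) auto
    finally have "tr_one \<Lambda> \<Delta> = (\<Oplus>\<^bsub>pf_val R \<Lambda>\<^esub> \<Gamma> \<in> {\<Gamma>. refines \<Gamma> \<Lambda>}. [f \<Gamma>] \<cdot>\<^bsub>pf_val R \<Lambda>\<^esub> tr_one \<Lambda> \<Gamma>)" ..
    moreover have "bmark (tr_one_A \<Lambda> \<Delta>) K = (\<Sum>\<Gamma> | refines \<Gamma> \<Lambda>. f \<Gamma> * bmark (tr_one_A \<Lambda> \<Gamma>) K)" for K
    proof -
      have "(\<Sum>\<Gamma> | refines \<Gamma> \<Lambda>. f \<Gamma> * bmark (tr_one_A \<Lambda> \<Gamma>) K) =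
          (\<Sum>\<Gamma> | refines \<Gamma> \<Lambda>. if \<Gamma> = \<Delta> then bmark (tr_one_A \<Lambda> \<Gamma>) K else 0)"
        by (intro sum.cong) (auto simp: f_def)
      then show ?thesis using gen fin by simp
    qed
    ultimately show ?case by (intro exI[of _ f]) (simp add: A_ring_simps one_A_val tr_one_def[symmetric] tr_one_A_def[symmetric])
  next
    case zero
    have "(\<Oplus>\<^bsub>pf_val R \<Lambda>\<^esub> \<Gamma> \<in> {\<Gamma>. refines \<Gamma> \<Lambda>}. [(0 :: int)] \<cdot>\<^bsub>pf_val R \<Lambda>\<^esub> tr_one \<Lambda> \<Gamma>) = \<zero>\<^bsub>pf_val R \<Lambda>\<^esub>"
      by (simp add: add_pow_int_ge)
    then show ?case
      by (intro exI[of _ "\<lambda>_. 0"]) (simp add: A_ring_simps A_val_ops Sigma.burnside_zero)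
  next
    case (neg a b)
    then obtain f where f: "\<And>K. subgroup K (Sigma_grp \<Lambda>) \<Longrightarrow>
        bmark a K = (\<Sum>\<Gamma> | refines \<Gamma> \<Lambda>. f \<Gamma> * bmark (tr_one_A \<Lambda> \<Gamma>) K)"
      "b = (\<Oplus>\<^bsub>pf_val R \<Lambda>\<^esub> \<Gamma> \<in> {\<Gamma>. refines \<Gamma> \<Lambda>}. [f \<Gamma>] \<cdot>\<^bsub>pf_val R \<Lambda>\<^esub> tr_one \<Lambda> \<Gamma>)" by blast
    have a: "a \<in> carrier (A_val \<Lambda>)" using corr_closed[OF neg.hyps] by (simp add: A_ring_simps)
    have b: "b \<in> carrier (pf_val R \<Lambda>)" using corr_closed[OF neg.hyps] by simp
    let ?c = "\<Oplus>\<^bsub>pf_val R \<Lambda>\<^esub> \<Gamma> \<in> {\<Gamma>. refines \<Gamma> \<Lambda>}. [(- f \<Gamma>)] \<cdot>\<^bsub>pf_val R \<Lambda>\<^esub> tr_one \<Lambda> \<Gamma>"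
    have c: "?c \<in> carrier (pf_val R \<Lambda>)" using pow by (intro Rv.finsum_closed) auto
    \<comment> \<open>The combination with negated coefficients is recognised as the negative of
      \<open>b\<close> because the terms cancel one by one.\<close>
    have "?c \<oplus>\<^bsub>pf_val R \<Lambda>\<^esub> b = (\<Oplus>\<^bsub>pf_val R \<Lambda>\<^esub> \<Gamma> \<in> {\<Gamma>. refines \<Gamma> \<Lambda>}.
        [(- f \<Gamma>)] \<cdot>\<^bsub>pf_val R \<Lambda>\<^esub> tr_one \<Lambda> \<Gamma> \<oplus>\<^bsub>pf_val R \<Lambda>\<^esub> [f \<Gamma>] \<cdot>\<^bsub>pf_val R \<Lambda>\<^esub> tr_one \<Lambda> \<Gamma>)"
      unfolding f(2) using pow by (intro Rv.finsum_addf[symmetric]) auto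
    also have "\<dots> = (\<Oplus>\<^bsub>pf_val R \<Lambda>\<^esub> \<Gamma> \<in> {\<Gamma>. refines \<Gamma> \<Lambda>}. \<zero>\<^bsub>pf_val R \<Lambda>\<^esub>)"
      using Rv.add.int_pow_mult[OF tr_one_closed, of _ \<Lambda> "- f _" "f _", symmetric]
      by (intro Rv.finsum_cong') (auto simp: add_pow_int_ge)
    finally have "\<ominus>\<^bsub>pf_val R \<Lambda>\<^esub> b = ?c" using b c by (simp add: Rv.minus_equality)
    then show ?case
      using a subgroup.mem_carrier[OF subgroup_A_val a]
      by (intro exI[of _ "\<lambda>\<Gamma>. - f \<Gamma>"])
        (simp add: A_ring_simps A_val_uminus bmark_uminus f(1) sum_negf)
  next
    case (add a b a' b')
    then obtain f g where f: "\<And>K. subgroup K (Sigma_grp \<Lambda>) \<Longrightarrow>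
        bmark a K = (\<Sum>\<Gamma> | refines \<Gamma> \<Lambda>. f \<Gamma> * bmark (tr_one_A \<Lambda> \<Gamma>) K)"
      "b = (\<Oplus>\<^bsub>pf_val R \<Lambda>\<^esub> \<Gamma> \<in> {\<Gamma>. refines \<Gamma> \<Lambda>}. [f \<Gamma>] \<cdot>\<^bsub>pf_val R \<Lambda>\<^esub> tr_one \<Lambda> \<Gamma>)"
      and g: "\<And>K. subgroup K (Sigma_grp \<Lambda>) \<Longrightarrow>
        bmark a' K = (\<Sum>\<Gamma> | refines \<Gamma> \<Lambda>. g \<Gamma> * bmark (tr_one_A \<Lambda> \<Gamma>) K)"
      "b' = (\<Oplus>\<^bsub>pf_val R \<Lambda>\<^esub> \<Gamma> \<in> {\<Gamma>. refines \<Gamma> \<Lambda>}. [g \<Gamma>] \<cdot>\<^bsub>pf_val R \<Lambda>\<^esub> tr_one \<Lambda> \<Gamma>)" by blast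
    have a: "a \<in> carrier (Burn \<Lambda>)" "a' \<in> carrier (Burn \<Lambda>)"
      using corr_closed[OF add.hyps(1)] corr_closed[OF add.hyps(2)] subgroup.mem_carrier[OF subgroup_A_val]
      by (auto simp: A_ring_simps)
    have "b \<oplus>\<^bsub>pf_val R \<Lambda>\<^esub> b' = (\<Oplus>\<^bsub>pf_val R \<Lambda>\<^esub> \<Gamma> \<in> {\<Gamma>. refines \<Gamma> \<Lambda>}.
        [f \<Gamma>] \<cdot>\<^bsub>pf_val R \<Lambda>\<^esub> tr_one \<Lambda> \<Gamma> \<oplus>\<^bsub>pf_val R \<Lambda>\<^esub> [g \<Gamma>] \<cdot>\<^bsub>pf_val R \<Lambda>\<^esub> tr_one \<Lambda> \<Gamma>)"
      unfolding f(2) g(2) using pow by (intro Rv.finsum_addf[symmetric]) auto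
    also have "\<dots> = (\<Oplus>\<^bsub>pf_val R \<Lambda>\<^esub> \<Gamma> \<in> {\<Gamma>. refines \<Gamma> \<Lambda>}. [(f \<Gamma> + g \<Gamma>)] \<cdot>\<^bsub>pf_val R \<Lambda>\<^esub> tr_one \<Lambda> \<Gamma>)"
      using pow Rv.add.int_pow_mult[OF tr_one_closed] by (intro Rv.finsum_cong') auto
    finally show ?case
      using a by (intro exI[of _ "\<lambda>\<Gamma>. f \<Gamma> + g \<Gamma>"])
        (simp add: A_ring_simps A_val_ops Sigma.burnside_add f(1) g(1) algebra_simps sum.distrib)
  }
qed

text \<open>The whole content of well-definedness: vanishing marks on the side of A force the same
  combination of transfers in R to vanish.\<close>

lemma corr_zero:
  assumes "(\<zero>\<^bsub>A_val \<Lambda>\<^esub>, b) \<in> corr \<Lambda>"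
  shows "b = \<zero>\<^bsub>pf_val R \<Lambda>\<^esub>"
proof -
  obtain f where f: "\<And>K. subgroup K (Sigma_grp \<Lambda>) \<Longrightarrow>
      bmark \<zero>\<^bsub>Burn \<Lambda>\<^esub> K = (\<Sum>\<Gamma> | refines \<Gamma> \<Lambda>. f \<Gamma> * bmark (tr_one_A \<Lambda> \<Gamma>) K)"
    "b = (\<Oplus>\<^bsub>pf_val R \<Lambda>\<^esub> \<Gamma> \<in> {\<Gamma>. refines \<Gamma> \<Lambda>}. [f \<Gamma>] \<cdot>\<^bsub>pf_val R \<Lambda>\<^esub> tr_one \<Lambda> \<Gamma>)"
    using corr_combination[OF assms] by (auto simp: A_val_ops)
  have "(\<Oplus>\<^bsub>pf_val R \<Lambda>\<^esub> \<Gamma> \<in> {\<Gamma>. refines \<Gamma> \<Lambda>}. [f \<Gamma>] \<cdot>\<^bsub>pf_val R \<Lambda>\<^esub> tr_one \<Lambda> \<Gamma>) = \<zero>\<^bsub>pf_val R \<Lambda>\<^esub>"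
  \<comment> \<open>Only the marks at the groups of refinements enter; they form a square table
    indexed like the generators.\<close>
  proof (rule Rv.int_combination_eq_zero[OF finite_refinements subset_refl,
        where m="\<lambda>\<Gamma> \<Delta>. bmark (tr_one_A \<Lambda> \<Gamma>) (carrier (Sigma_grp \<Delta>))"
          and size="\<lambda>\<Gamma>. card (carrier (Sigma_grp \<Gamma>))"])
    fix \<Gamma> \<Delta> assume *: "\<Gamma> \<in> {\<Gamma>. refines \<Gamma> \<Lambda>}" "\<Delta> \<in> {\<Gamma>. refines \<Gamma> \<Lambda>}"
      and "bmark (tr_one_A \<Lambda> \<Gamma>) (carrier (Sigma_grp \<Delta>)) \<noteq> 0"
      "card (carrier (Sigma_grp \<Gamma>)) \<le> card (carrier (Sigma_grp \<Delta>))"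
    then obtain \<sigma> where \<sigma>: "\<sigma> \<in> carrier (Sigma_grp \<Lambda>)" "\<Gamma> = transport \<sigma> \<Delta>"
      using bmark_generator_conj[of \<Gamma> \<Lambda> \<Delta>] by (auto simp: tr_one_A_def)
    have "refines \<Delta> \<Lambda>" using * by simp
    then have "tr_one \<Lambda> \<Gamma> = tr_one \<Lambda> \<Delta>" "tr_one_A \<Lambda> \<Gamma> = tr_one_A \<Lambda> \<Delta>"
      using R.tr_transport_one[OF _ \<sigma>(1)] \<sigma>(2)
        partition_ring.tr_transport_one[OF partition_ring_burnside, of \<Delta> \<Lambda> \<sigma>] \<sigma>(1)
      by (simp_all add: tr_one_def tr_one_A_def)
    then show "tr_one \<Lambda> \<Gamma> = tr_one \<Lambda> \<Delta> \<and> (\<forall>k \<in> {\<Gamma>. refines \<Gamma> \<Lambda>}.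
        bmark (tr_one_A \<Lambda> \<Gamma>) (carrier (Sigma_grp k)) = bmark (tr_one_A \<Lambda> \<Delta>) (carrier (Sigma_grp k)))"
      by simp
  next
    fix \<Delta> assume "\<Delta> \<in> {\<Gamma>. refines \<Gamma> \<Lambda>}"
    then have "subgroup (carrier (Sigma_grp \<Delta>)) (Sigma_grp \<Lambda>)" by (simp add: subgroup_Sigma)
    then show "(\<Sum>\<Gamma> | refines \<Gamma> \<Lambda>. f \<Gamma> * bmark (tr_one_A \<Lambda> \<Gamma>) (carrier (Sigma_grp \<Delta>))) = 0"
      using f(1) by (simp add: Sigma.burnside_zero)
  qed (simp_all add: tr_one_closed bmark_generator_self tr_one_A_def)
  then show ?thesis using f(2) by simp
qed

text \<open>By additivity of \<open>corr\<close>, the difference of the two pairs has first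
  component 0.\<close>

lemma corr_functional:
  assumes "(a, b) \<in> corr \<Lambda>" "(a, b') \<in> corr \<Lambda>"
  shows "b = b'"
proof -
  interpret A: cring "pf_val (A_ring :: ('u, ('u point \<Rightarrow> 'u point) burnside) lax_pfunctor) \<Lambda>"
    by (rule S.val_ring)
  note c = corr_closed[OF assms(1)] corr_closed[OF assms(2)]
  have "a \<oplus>\<^bsub>pf_val A_ring \<Lambda>\<^esub> \<ominus>\<^bsub>pf_val A_ring \<Lambda>\<^esub> a = \<zero>\<^bsub>pf_val A_ring \<Lambda>\<^esub>"
    using c by (intro A.r_neg) simp
  then have "b \<oplus>\<^bsub>pf_val R \<Lambda>\<^esub> \<ominus>\<^bsub>pf_val R \<Lambda>\<^esub> b' = \<zero>\<^bsub>pf_val R \<Lambda>\<^esub>"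
    using corr.add[OF assms(1) corr.neg[OF assms(2)]] by (intro corr_zero) (simp add: A_ring_simps)
  then have "\<ominus>\<^bsub>pf_val R \<Lambda>\<^esub> (\<ominus>\<^bsub>pf_val R \<Lambda>\<^esub> b') = b" using c by (intro Rv.minus_equality) auto
  then show ?thesis using c by simp
qed

lemma corr_total:
  assumes "a \<in> carrier (A_val \<Lambda>)"
  shows "\<exists>b. (a, b) \<in> corr \<Lambda>"
  using assms[unfolded A_val_carrier]
proof (induction rule: generate.induct)
  case one
  then show ?case using corr.zero[of \<Lambda>] by (auto simp: A_ring_simps A_val_ops)
next
  case (incl a)
  then show ?case using corr.gen[of _ \<Lambda>] by (auto simp: A_ring_simps one_A_val)
next
  case (inv a)
  then obtain \<Gamma> where \<Gamma>: "refines \<Gamma> \<Lambda>" "a = Burn_tr \<Gamma> \<Lambda> id \<one>\<^bsub>Burn \<Gamma>\<^esub>" by blast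
  have "a \<in> carrier (A_val \<Lambda>)" unfolding A_val_carrier using inv by (rule generate.incl)
  then have "inv\<^bsub>add_monoid (Burn \<Lambda>)\<^esub> a = \<ominus>\<^bsub>pf_val A_ring \<Lambda>\<^esub> pf_tr A_ring \<Gamma> \<Lambda> id \<one>\<^bsub>pf_val A_ring \<Gamma>\<^esub>"
    using \<Gamma>(2) by (simp add: A_ring_simps one_A_val A_val_uminus) (simp add: a_inv_def)
  then show ?case using corr.neg[OF corr.gen[OF \<Gamma>(1)]] by auto
next
  case (eng a a')
  then obtain b b' where "(a, b) \<in> corr \<Lambda>" "(a', b') \<in> corr \<Lambda>" by blast
  from corr.add[OF this] show ?case by (auto simp: A_ring_simps A_val_ops)
qed

text \<open>Every clause that builds up \<open>corr\<close> is respected by a map of partition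
  rings, so \<open>corr\<close> is contained in its graph. This yields uniqueness.\<close>

lemma corr_map:
  assumes \<phi>: "partition_ring_map A_ring R \<phi>" and "(a, b) \<in> corr \<Lambda>"
  shows "\<phi> \<Lambda> a = b"
  using assms(2)
proof (induction rule: corr.induct)
  let ?A = "A_ring :: ('u, ('u point \<Rightarrow> 'u point) burnside) lax_pfunctor"
  interpret A: cring "pf_val ?A \<Delta>" for \<Delta> by (rule S.val_ring)
  have hom: "\<phi> \<Delta> \<in> ring_hom (pf_val ?A \<Delta>) (pf_val R \<Delta>)" for \<Delta>
    using \<phi> by (simp add: partition_ring_map_def)
  {
    case (gen \<Gamma>)
    have "\<phi> \<Lambda> (pf_tr ?A \<Gamma> \<Lambda> id \<one>\<^bsub>pf_val ?A \<Gamma>\<^esub>) = pf_tr R \<Gamma> \<Lambda> id (\<phi> \<Gamma> \<one>\<^bsub>pf_val ?A \<Gamma>\<^esub>)"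
      using \<phi> morphism_id[OF gen] S.one_closed[of \<Gamma>] unfolding partition_ring_map_def by blast
    then show ?case by (simp add: ring_hom_one[OF hom])
  next
    case zero
    show ?case by (rule ring_hom_zero[OF hom A.ring_axioms Rv.ring_axioms])
  next
    case (neg a b)
    have a: "a \<in> carrier (pf_val ?A \<Lambda>)" "b \<in> carrier (pf_val R \<Lambda>)" using corr_closed[OF neg.hyps] by auto
    have "\<phi> \<Lambda> (\<ominus>\<^bsub>pf_val ?A \<Lambda>\<^esub> a) \<oplus>\<^bsub>pf_val R \<Lambda>\<^esub> \<phi> \<Lambda> a = \<phi> \<Lambda> (\<ominus>\<^bsub>pf_val ?A \<Lambda>\<^esub> a \<oplus>\<^bsub>pf_val ?A \<Lambda>\<^esub> a)"
      using a by (intro ring_hom_add[OF hom, symmetric]) simp_all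
    also have "\<dots> = \<zero>\<^bsub>pf_val R \<Lambda>\<^esub>"
      using a by (simp add: A.l_neg ring_hom_zero[OF hom A.ring_axioms Rv.ring_axioms])
    finally show ?case
      using a neg.IH ring_hom_closed[OF hom, of _ \<Lambda>] by (intro Rv.minus_equality[symmetric]) auto
  next
    case (add a b a' b')
    then show ?case using ring_hom_add[OF hom] corr_closed by metis
  }
qed

theorem initial: "\<exists>!\<phi>. partition_ring_map (A_ring :: ('u, ('u point \<Rightarrow> 'u point) burnside) lax_pfunctor) R \<phi>"
proof (rule ex1I)
  let ?A = "A_ring :: ('u, ('u point \<Rightarrow> 'u point) burnside) lax_pfunctor"
  interpret A: cring "pf_val ?A \<Lambda>" for \<Lambda> by (rule S.val_ring)
  \<comment> \<open>The function with graph \<open>corr\<close>, restricted to the carrier because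
    maps are taken extensional.\<close>
  define \<phi> where "\<phi> \<Lambda> = (\<lambda>a \<in> carrier (pf_val ?A \<Lambda>). THE b. (a, b) \<in> corr \<Lambda>)" for \<Lambda>
  have graph: "(a, \<phi> \<Lambda> a) \<in> corr \<Lambda>" if a: "a \<in> carrier (pf_val ?A \<Lambda>)" for a \<Lambda>
  proof -
    have "\<exists>!b. (a, b) \<in> corr \<Lambda>"
      using corr_total[of a \<Lambda>] corr_functional a by (auto simp: A_ring_simps)
    then have "(a, THE b. (a, b) \<in> corr \<Lambda>) \<in> corr \<Lambda>" by (rule theI')
    then show ?thesis using a by (simp add: \<phi>_def)
  qed
  have \<phi>: "\<phi> \<Lambda> a = b" if "(a, b) \<in> corr \<Lambda>" for a b \<Lambda>
    using corr_functional[OF graph that] corr_closed[OF that] by simp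
  show "partition_ring_map ?A R \<phi>"
    unfolding partition_ring_map_def
  proof (intro conjI allI impI ballI)
    show "\<phi> \<Lambda> \<in> extensional (carrier (pf_val ?A \<Lambda>))" for \<Lambda> by (simp add: \<phi>_def)
    show "\<phi> \<Lambda> \<in> ring_hom (pf_val ?A \<Lambda>) (pf_val R \<Lambda>)" for \<Lambda>
      by (rule ring_hom_memI)
        (use corr_closed[OF graph] \<phi>[OF corr_mult[OF graph graph]] \<phi>[OF corr.add[OF graph graph]]
          \<phi>[OF corr_one] in auto)
    show "\<phi> \<Lambda> (pf_res ?A \<Lambda> \<Omega> f a) = pf_res R \<Lambda> \<Omega> f (\<phi> \<Omega> a)"
      if "morphism \<Lambda> \<Omega> f" "a \<in> carrier (pf_val ?A \<Omega>)" for \<Lambda> \<Omega> f a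
      by (rule \<phi>[OF corr_res[OF that(1) graph[OF that(2)]]])
    show "\<phi> \<Omega> (pf_tr ?A \<Lambda> \<Omega> f a) = pf_tr R \<Lambda> \<Omega> f (\<phi> \<Lambda> a)"
      if "morphism \<Lambda> \<Omega> f" "a \<in> carrier (pf_val ?A \<Lambda>)" for \<Lambda> \<Omega> f a
      by (rule \<phi>[OF corr_tr[OF that(1) graph[OF that(2)]]])
    show "\<phi> empty_ptn (pf_unit ?A n) = pf_unit R n" for n by (rule \<phi>[OF corr_unit])
    show "\<phi> (sum_ptn \<Lambda> \<Omega>) (pf_ext ?A \<Lambda> \<Omega> a b) = pf_ext R \<Lambda> \<Omega> (\<phi> \<Lambda> a) (\<phi> \<Omega> b)"
      if "a \<in> carrier (pf_val ?A \<Lambda>)" "b \<in> carrier (pf_val ?A \<Omega>)" for \<Lambda> \<Omega> a b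
      by (rule \<phi>[OF corr_ext[OF graph[OF that(1)] graph[OF that(2)]]])
  qed
  fix \<psi> assume \<psi>: "partition_ring_map ?A R \<psi>"
  show "\<psi> = \<phi>"
  proof
    fix \<Lambda>
    show "\<psi> \<Lambda> = \<phi> \<Lambda>"
    proof (rule extensionalityI)
      show "\<psi> \<Lambda> \<in> extensional (carrier (pf_val ?A \<Lambda>))" using \<psi> by (simp add: partition_ring_map_def)
      show "\<phi> \<Lambda> \<in> extensional (carrier (pf_val ?A \<Lambda>))" by (simp add: \<phi>_def)
      show "\<psi> \<Lambda> a = \<phi> \<Lambda> a" if "a \<in> carrier (pf_val ?A \<Lambda>)" for a
        by (rule corr_map[OF \<psi> graph[OF that]])
    qed
  qed
qed

end

theorem proposition12p1:
  shows "partition_ring (A_ring :: ('u, ('u point \<Rightarrow> 'u point) burnside) lax_pfunctor) \<and>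
    (\<forall>R :: ('u, 'r) lax_pfunctor. partition_ring R \<longrightarrow>
       (\<exists>!\<phi>. partition_ring_map A_ring R \<phi>))"
  using partition_ring_A partition_ring_from_A.initial[OF partition_ring_from_A.intro] by blast

end
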